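(* Let $X$ be a smooth CW complex and let $\mathcal{V}$ be any covering of $X$ by $D$-open subsets. Then there exists a smooth partition of unity on $X$ subordinate to $\mathcal{V}$.
   Context: A diffeological space is a set $X$ together with, for every $n\ge 0$ and every open set $U\subset\mathbb{R}^n$, a set of maps $U\to X$ (called plots), such that: all constant maps are plots; if $P:U\to X$ is a plot and $\phi:V\to U$ is a smooth map between open subsets of Euclidean spaces, then $P\circ\phi$ is a plot; and if $P:U\to X$ is a map and $U$ has an open covering $\{U_\alpha\}$ with every $P|_{U_\alpha}$ a plot, then $P$ is a plot. A map $f:X\to Y$ of diffeological spaces is smooth if $f\circ P$ is a plot of $Y$ for every plot $P$ of $X$. The category $\mathsf{Diffeology}$ of diffeological spaces and smooth maps is complete and cocomplete. Spheres $S^n$ and closed disks $D^{n+1}$ carry their standard diffeologies as subsets of $\mathbb{R}^{n+1}$ (plots are the maps that are smooth as maps into $\mathbb{R}^{n+1}$). The $D$-topology of a diffeological space $X$ is the finest topology making all plots continuous; its open sets are called $D$-open. A smooth CW complex $X$ is the colimit in $\mathsf{Diffeology}$ of skeleta $\{X_n\}_{n\ge0}$ defined inductively: $X_0$ is a discrete set with the discrete diffeology; for each $n\ge0$ there is a smooth attaching map $h_n: S_n=\coprod_\alpha S^n_\alpha\to X_n$ from a disjoint union of $n$-spheres, and $X_{n+1}=X_n\cup_{h_n}\coprod_\alpha D^{n+1}_\alpha$ is the pushout in $\mathsf{Diffeology}$ of $h_n$ and the natural inclusion $S_n\hookrightarrow\coprod_\alpha D^{n+1}_\alpha$. A smooth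 partition of unity on $X$ subordinate to $\mathcal{V}$ is a family $\{\rho_\lambda\}_{\lambda\in\Lambda}$ of smooth functions $\rho_\lambda:X\to[0,1]\subset\mathbb{R}$ whose supports (closures, in the $D$-topology, of the sets where $\rho_\lambda\ne0$) form a locally finite family, such that each $\operatorname{supp}\rho_\lambda$ is contained in some $V\in\mathcal{V}$, and $\sum_\lambda\rho_\lambda=1$ on $X$. *)

theory Defs
  imports "HOL-Analysis.Analysis"
begin

section \<open>Smooth maps between open subsets of Euclidean spaces\<close>

text \<open>
  The dimension of the domain of a plot varies, so \<open>\<real>\<^sup>n\<close> is the library's
  \<^const>\<open>Euclidean_space\<close> \<open>n\<close>: the real sequences vanishing from index \<open>n\<close> on.
  \<open>Ck k n U f\<close> says that all partial derivatives of \<open>f\<close> of order at most \<open>k\<close> exist and are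
  continuous on the open set \<open>U\<close> of \<open>\<real>\<^sup>n\<close>. Only the values of \<open>f\<close> on \<open>U\<close> matter.
\<close>

primrec Ck :: "nat \<Rightarrow> nat \<Rightarrow> (nat \<Rightarrow> real) set \<Rightarrow> ((nat \<Rightarrow> real) \<Rightarrow> real) \<Rightarrow> bool" where
  "Ck 0 n U f \<longleftrightarrow> continuous_map (subtopology (Euclidean_space n) U) euclideanreal f"
| "Ck (Suc k) n U f \<longleftrightarrow>
     continuous_map (subtopology (Euclidean_space n) U) euclideanreal f \<and>
     (\<exists>f'. \<forall>i<n.
        (\<forall>x\<in>U. ((\<lambda>t. f (x(i := t))) has_real_derivative f' i x) (at (x i))) \<and> Ck k n U (f' i))"

definition smooth_fun :: "nat \<Rightarrow> (nat \<Rightarrow> real) set \<Rightarrow> ((nat \<Rightarrow> real) \<Rightarrow> real) \<Rightarrow> bool" where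
  "smooth_fun n U f \<longleftrightarrow> (\<forall>k. Ck k n U f)"

definition euclid_smooth ::
    "nat \<Rightarrow> (nat \<Rightarrow> real) set \<Rightarrow> nat \<Rightarrow> ((nat \<Rightarrow> real) \<Rightarrow> nat \<Rightarrow> real) \<Rightarrow> bool" where
  "euclid_smooth m V n \<phi> \<longleftrightarrow>
     \<phi> \<in> V \<rightarrow> topspace (Euclidean_space n) \<and> (\<forall>i<n. smooth_fun m V (\<lambda>x. \<phi> x i))"


section \<open>Diffeological spaces\<close>

text \<open>
  \<open>plots X n U\<close> is the set of plots of \<open>X\<close> with domain the open set \<open>U\<close> of \<open>\<real>\<^sup>n\<close>. Plots are
  extensional functions on \<open>U\<close>, so that they correspond exactly to the maps \<open>U \<rightarrow> X\<close>.
\<close>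

record 'a diffeo_space =
  points :: "'a set"
  plots :: "nat \<Rightarrow> (nat \<Rightarrow> real) set \<Rightarrow> ((nat \<Rightarrow> real) \<Rightarrow> 'a) set"

locale diffeological_space =
  fixes X :: "'a diffeo_space"
  assumes plot_dom: "P \<in> plots X n U \<Longrightarrow> openin (Euclidean_space n) U"
    and plot_fun: "P \<in> plots X n U \<Longrightarrow> P \<in> U \<rightarrow>\<^sub>E points X"
    and plot_const: "\<lbrakk>openin (Euclidean_space n) U; a \<in> points X\<rbrakk> \<Longrightarrow> (\<lambda>x\<in>U. a) \<in> plots X n U"
    and plot_compose: "\<lbrakk>P \<in> plots X n U; openin (Euclidean_space m) V; \<phi> \<in> V \<rightarrow> U;
          euclid_smooth m V n \<phi>\<rbrakk> \<Longrightarrow> compose V P \<phi> \<in> plots X m V"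
    and plot_local: "\<lbrakk>P \<in> U \<rightarrow>\<^sub>E points X; \<And>W. W \<in> \<W> \<Longrightarrow> openin (Euclidean_space n) W; \<Union>\<W> = U;
          \<And>W. W \<in> \<W> \<Longrightarrow> restrict P W \<in> plots X n W\<rbrakk> \<Longrightarrow> P \<in> plots X n U"

definition smooth_map :: "'a diffeo_space \<Rightarrow> 'b diffeo_space \<Rightarrow> ('a \<Rightarrow> 'b) \<Rightarrow> bool" where
  "smooth_map X Y f \<longleftrightarrow> f \<in> points X \<rightarrow> points Y \<and>
     (\<forall>n U. \<forall>P\<in>plots X n U. compose U f P \<in> plots Y n U)"

text \<open>The finest topology on \<open>points X\<close> for which all plots are continuous.\<close>

definition D_topology :: "'a diffeo_space \<Rightarrow> 'a topology" where
  "D_topology X = topology (\<lambda>A. A \<subseteq> points X \<and>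
     (\<forall>n U. \<forall>P\<in>plots X n U. openin (Euclidean_space n) {x\<in>U. P x \<in> A}))"

lemma openin_D_topology:
  assumes "diffeological_space X"
  shows "openin (D_topology X) A \<longleftrightarrow> A \<subseteq> points X \<and>
     (\<forall>n U. \<forall>P\<in>plots X n U. openin (Euclidean_space n) {x\<in>U. P x \<in> A})"
proof -
  define L where "L = (\<lambda>A. A \<subseteq> points X \<and>
     (\<forall>n U. \<forall>P\<in>plots X n U. openin (Euclidean_space n) {x\<in>U. P x \<in> A}))"
  have "L (S \<inter> T)" if S: "L S" and T: "L T" for S T
  proof -
    have "{x\<in>U. P x \<in> S \<inter> T} = {x\<in>U. P x \<in> S} \<inter> {x\<in>U. P x \<in> T}" for U and P :: "(nat \<Rightarrow> real) \<Rightarrow> 'a"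
      by blast
    then show ?thesis using S T by (auto simp: L_def simp del: Int_iff)
  qed
  moreover have "L (\<Union>\<K>)" if K: "\<forall>A\<in>\<K>. L A" for \<K>
  proof -
    have "{x\<in>U. P x \<in> \<Union>\<K>} = (\<Union>A\<in>\<K>. {x\<in>U. P x \<in> A})" for U and P :: "(nat \<Rightarrow> real) \<Rightarrow> 'a"
      by blast
    then show ?thesis using K by (auto simp: L_def simp del: Union_iff intro!: openin_Union)
  qed
  ultimately have "istopology L" by (simp add: istopology_def)
  then have "openin (topology L) A = L A" by (rule topology_inverse'[THEN fun_cong])
  moreover have "D_topology X = topology L" by (simp only: D_topology_def L_def)
  ultimately show ?thesis by (simp only: L_def)
qed

lemma topspace_D_topology:
  assumes "diffeological_space X"
  shows "topspace (D_topology X) = points X"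
proof -
  interpret diffeological_space X by fact
  have "openin (Euclidean_space n) {x\<in>U. P x \<in> points X}" if "P \<in> plots X n U" for n U P
  proof -
    have "{x\<in>U. P x \<in> points X} = U" using plot_fun[OF that] by auto
    then show ?thesis using plot_dom[OF that] by simp
  qed
  then have "openin (D_topology X) (points X)"
    by (simp add: openin_D_topology[OF assms])
  then show ?thesis
    by (metis openin_D_topology[OF assms] openin_subset openin_topspace subset_antisym)
qed


section \<open>Standard, discrete and sum diffeologies\<close>

definition euclid_subspace :: "nat \<Rightarrow> (nat \<Rightarrow> real) set \<Rightarrow> (nat \<Rightarrow> real) diffeo_space" where
  "euclid_subspace n A = \<lparr>points = A,
     plots = (\<lambda>m U. {P \<in> U \<rightarrow>\<^sub>E A. openin (Euclidean_space m) U \<and> euclid_smooth m U n P})\<rparr>"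

definition sphere_space :: "nat \<Rightarrow> (nat \<Rightarrow> real) diffeo_space" where
  "sphere_space n = euclid_subspace (Suc n) (topspace (nsphere n))"

definition disk_space :: "nat \<Rightarrow> (nat \<Rightarrow> real) diffeo_space" where
  "disk_space n = euclid_subspace n {x \<in> topspace (Euclidean_space n). (\<Sum>i<n. (x i)\<^sup>2) \<le> 1}"

definition real_subspace :: "real set \<Rightarrow> real diffeo_space" where
  "real_subspace A = \<lparr>points = A,
     plots = (\<lambda>m U. {P \<in> U \<rightarrow>\<^sub>E A. openin (Euclidean_space m) U \<and> smooth_fun m U P})\<rparr>"

text \<open>\<open>locally_in S K\<close> has as plots the maps into \<open>S\<close> that locally belong to the family \<open>K\<close>.\<close>

definition locally_in :: "'a set \<Rightarrow> (nat \<Rightarrow> (nat \<Rightarrow> real) set \<Rightarrow> ((nat \<Rightarrow> real) \<Rightarrow> 'a) set)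
    \<Rightarrow> 'a diffeo_space" where
  "locally_in S K = \<lparr>points = S,
     plots = (\<lambda>n U. {P \<in> U \<rightarrow>\<^sub>E S. openin (Euclidean_space n) U \<and>
       (\<forall>x\<in>U. \<exists>W. openin (Euclidean_space n) W \<and> x \<in> W \<and> W \<subseteq> U \<and> restrict P W \<in> K n W)})\<rparr>"

definition discrete_space :: "'a set \<Rightarrow> 'a diffeo_space" where
  "discrete_space S = locally_in S (\<lambda>n W. {\<lambda>x\<in>W. a | a. a \<in> S})"

definition coproduct :: "'i set \<Rightarrow> ('i \<Rightarrow> 'a diffeo_space) \<Rightarrow> ('i \<times> 'a) diffeo_space" where
  "coproduct I F = locally_in (SIGMA i:I. points (F i))
     (\<lambda>n W. \<Union>i\<in>I. compose W (Pair i) ` plots (F i) n W)"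


section \<open>Pushouts and sequential colimits\<close>

text \<open>
  \<open>pushout_for A f B g C D p q Z\<close> is the universal property of the square with legs
  \<open>f : A \<rightarrow> B\<close>, \<open>g : A \<rightarrow> C\<close>, \<open>p : B \<rightarrow> D\<close>, \<open>q : C \<rightarrow> D\<close> with respect to the test space \<open>Z\<close>.
  HOL cannot quantify over types inside a definition, so in \<open>is_pushout\<close> the test spaces are those
  carried by subsets of the type \<open>('b + 'c) set\<close>. This is no restriction: that type contains the
  quotient of the disjoint union of \<open>B\<close> and \<open>C\<close>, and by \<open>pushout_universal\<close> below the universal
  property then holds for test spaces over every type. The same applies to \<open>is_colimit\<close>.
\<close>

definition pushout_for :: "'a diffeo_space \<Rightarrow> ('a \<Rightarrow> 'b) \<Rightarrow> 'b diffeo_space \<Rightarrow> ('a \<Rightarrow> 'c)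
    \<Rightarrow> 'c diffeo_space \<Rightarrow> 'd diffeo_space \<Rightarrow> ('b \<Rightarrow> 'd) \<Rightarrow> ('c \<Rightarrow> 'd) \<Rightarrow> 'z diffeo_space \<Rightarrow> bool" where
  "pushout_for A f B g C D p q Z \<longleftrightarrow>
     (\<forall>u v. smooth_map B Z u \<and> smooth_map C Z v \<and> (\<forall>a\<in>points A. u (f a) = v (g a)) \<longrightarrow>
        (\<exists>w. smooth_map D Z w \<and> (\<forall>b\<in>points B. w (p b) = u b) \<and> (\<forall>c\<in>points C. w (q c) = v c) \<and>
           (\<forall>w'. smooth_map D Z w' \<and> (\<forall>b\<in>points B. w' (p b) = u b) \<and> (\<forall>c\<in>points C. w' (q c) = v c)
              \<longrightarrow> (\<forall>d\<in>points D. w' d = w d))))"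

definition is_pushout :: "'a diffeo_space \<Rightarrow> ('a \<Rightarrow> 'b) \<Rightarrow> 'b diffeo_space \<Rightarrow> ('a \<Rightarrow> 'c)
    \<Rightarrow> 'c diffeo_space \<Rightarrow> 'd diffeo_space \<Rightarrow> ('b \<Rightarrow> 'd) \<Rightarrow> ('c \<Rightarrow> 'd) \<Rightarrow> bool" where
  "is_pushout A f B g C D p q \<longleftrightarrow>
     diffeological_space D \<and> smooth_map B D p \<and> smooth_map C D q \<and>
     (\<forall>a\<in>points A. p (f a) = q (g a)) \<and>
     (\<forall>Z :: ('b + 'c) set diffeo_space. diffeological_space Z \<longrightarrow> pushout_for A f B g C D p q Z)"

definition colimit_for :: "(nat \<Rightarrow> 'b diffeo_space) \<Rightarrow> (nat \<Rightarrow> 'b \<Rightarrow> 'b) \<Rightarrow> 'd diffeo_space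
    \<Rightarrow> (nat \<Rightarrow> 'b \<Rightarrow> 'd) \<Rightarrow> 'z diffeo_space \<Rightarrow> bool" where
  "colimit_for F j D p Z \<longleftrightarrow>
     (\<forall>u. (\<forall>n. smooth_map (F n) Z (u n)) \<and> (\<forall>n. \<forall>b\<in>points (F n). u (Suc n) (j n b) = u n b) \<longrightarrow>
        (\<exists>w. smooth_map D Z w \<and> (\<forall>n. \<forall>b\<in>points (F n). w (p n b) = u n b) \<and>
           (\<forall>w'. smooth_map D Z w' \<and> (\<forall>n. \<forall>b\<in>points (F n). w' (p n b) = u n b)
              \<longrightarrow> (\<forall>d\<in>points D. w' d = w d))))"

definition is_colimit :: "(nat \<Rightarrow> 'b diffeo_space) \<Rightarrow> (nat \<Rightarrow> 'b \<Rightarrow> 'b) \<Rightarrow> 'd diffeo_space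
    \<Rightarrow> (nat \<Rightarrow> 'b \<Rightarrow> 'd) \<Rightarrow> bool" where
  "is_colimit F j D p \<longleftrightarrow>
     diffeological_space D \<and> (\<forall>n. smooth_map (F n) D (p n)) \<and>
     (\<forall>n. \<forall>b\<in>points (F n). p (Suc n) (j n b) = p n b) \<and>
     (\<forall>Z :: (nat \<times> 'b) set diffeo_space. diffeological_space Z \<longrightarrow> colimit_for F j D p Z)"

lemma Ck_subset: "Ck k n U f \<Longrightarrow> W \<subseteq> U \<Longrightarrow> Ck k n W f"
proof (induction k arbitrary: f)
  case 0
  then show ?case by (simp add: continuous_map_from_subtopology_mono)
next
  case (Suc k)
  from Suc.prems obtain f' where f': "\<forall>i<n.
        (\<forall>x\<in>U. ((\<lambda>t. f (x(i := t))) has_real_derivative f' i x) (at (x i))) \<and> Ck k n U (f' i)"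
    by auto
  have "\<forall>i<n. (\<forall>x\<in>W. ((\<lambda>t. f (x(i := t))) has_real_derivative f' i x) (at (x i))) \<and> Ck k n W (f' i)"
    using f' Suc.IH Suc.prems(2) by blast
  moreover have "continuous_map (subtopology (Euclidean_space n) W) euclideanreal f"
    by (rule continuous_map_from_subtopology_mono[OF _ Suc.prems(2)]) (use Suc.prems(1) in simp)
  ultimately show ?case by auto
qed

lemma euclid_smooth_subset: "euclid_smooth m V n \<phi> \<Longrightarrow> W \<subseteq> V \<Longrightarrow> euclid_smooth m W n \<phi>"
  unfolding euclid_smooth_def smooth_fun_def using Ck_subset by (metis Pi_anti_mono subsetD)

lemma euclid_smooth_continuous:
  assumes "euclid_smooth m V n \<phi>"
  shows "continuous_map (subtopology (Euclidean_space m) V) (Euclidean_space n) \<phi>"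
proof -
  let ?T = "subtopology (Euclidean_space m) V"
  have "continuous_map ?T euclideanreal (\<lambda>x. \<phi> x i)" if "i < n" for i
    using assms that unfolding euclid_smooth_def smooth_fun_def by (metis Ck.simps(1))
  then have "continuous_map ?T (Euclidean_space n) (\<lambda>x i. if i < n then \<phi> x i else 0)"
    by (simp add: continuous_map_componentwise_Euclidean_space)
  then show ?thesis
    by (rule continuous_map_eq)
      (use assms in \<open>auto simp: euclid_smooth_def topspace_Euclidean_space fun_eq_iff Pi_iff\<close>)
qed

lemma diffeological_locally_in:
  assumes const: "\<And>n W a. \<lbrakk>openin (Euclidean_space n) W; a \<in> S\<rbrakk> \<Longrightarrow> (\<lambda>x\<in>W. a) \<in> K n W"
    and comp: "\<And>n W Q m V \<phi>. \<lbrakk>Q \<in> K n W; openin (Euclidean_space m) V; \<phi> \<in> V \<rightarrow> W;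
      euclid_smooth m V n \<phi>\<rbrakk> \<Longrightarrow> compose V Q \<phi> \<in> K m V"
  shows "diffeological_space (locally_in S K)"
proof
  fix P n U
  assume P: "P \<in> plots (locally_in S K) n U"
  show "openin (Euclidean_space n) U" "P \<in> U \<rightarrow>\<^sub>E points (locally_in S K)"
    using P by (simp_all add: locally_in_def)
  fix m V \<phi>
  assume V: "openin (Euclidean_space m) V" and \<phi>: "\<phi> \<in> V \<rightarrow> U" and sm: "euclid_smooth m V n \<phi>"
  have "\<exists>W. openin (Euclidean_space m) W \<and> y \<in> W \<and> W \<subseteq> V \<and> restrict (compose V P \<phi>) W \<in> K m W"
    if y: "y \<in> V" for y
  proof -
    have "\<phi> y \<in> U" using \<phi> y by blast
    then obtain W where W: "openin (Euclidean_space n) W" "\<phi> y \<in> W" "W \<subseteq> U" "restrict P W \<in> K n W"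
      using P by (auto simp: locally_in_def)
    define V' where "V' = {x\<in>V. \<phi> x \<in> W}"
    have "openin (subtopology (Euclidean_space m) V) V'"
      using openin_continuous_map_preimage[OF euclid_smooth_continuous[OF sm] W(1)]
      using openin_subset[OF V] by (simp add: V'_def inf_absorb2)
    then have V': "openin (Euclidean_space m) V'"
      using V by (simp add: openin_open_subtopology)
    have "compose V' (restrict P W) \<phi> \<in> K m V'"
      by (rule comp[OF W(4) V']) (use sm in \<open>auto simp: V'_def intro: euclid_smooth_subset\<close>)
    moreover have "compose V' (restrict P W) \<phi> = restrict (compose V P \<phi>) V'"
      by (auto simp: compose_def V'_def fun_eq_iff)
    ultimately show ?thesis using V' W(2) y by (auto simp: V'_def)
  qed
  then show "compose V P \<phi> \<in> plots (locally_in S K) m V"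
    using P V \<phi> by (auto simp: locally_in_def compose_def PiE_iff Pi_iff)
next
  fix n U a
  assume "openin (Euclidean_space n) U" "a \<in> points (locally_in S K)"
  then show "(\<lambda>x\<in>U. a) \<in> plots (locally_in S K) n U"
    using const[of n U a] by (auto simp: locally_in_def)
next
  fix P n U \<W>
  assume P: "P \<in> U \<rightarrow>\<^sub>E points (locally_in S K)" and U: "\<Union>\<W> = U"
    and W: "\<And>W. W \<in> \<W> \<Longrightarrow> openin (Euclidean_space n) W"
    and PW: "\<And>W. W \<in> \<W> \<Longrightarrow> restrict P W \<in> plots (locally_in S K) n W"
  have "\<exists>W. openin (Euclidean_space n) W \<and> x \<in> W \<and> W \<subseteq> U \<and> restrict P W \<in> K n W" if x: "x \<in> U" for x
  proof -
    obtain W where W1: "W \<in> \<W>" "x \<in> W" using U x by blast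
    then obtain W' where W': "openin (Euclidean_space n) W'" "x \<in> W'" "W' \<subseteq> W"
        "restrict (restrict P W) W' \<in> K n W'"
      using PW[OF W1(1)] by (auto simp: locally_in_def)
    then have "restrict P W' \<in> K n W'" by (simp add: Int_absorb1)
    then show ?thesis using W' W1 U by blast
  qed
  moreover have "openin (Euclidean_space n) U" using U W by blast
  ultimately show "P \<in> plots (locally_in S K) n U"
    using P by (simp add: locally_in_def)
qed

lemma smooth_map_from_locally_in:
  assumes Z: "diffeological_space Z" and w: "w \<in> S \<rightarrow> points Z"
    and K: "\<And>n W Q. Q \<in> K n W \<Longrightarrow> compose W w Q \<in> plots Z n W"
  shows "smooth_map (locally_in S K) Z w"
  unfolding smooth_map_def
proof (intro conjI allI ballI)
  show "w \<in> points (locally_in S K) \<rightarrow> points Z" using w by (simp add: locally_in_def)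
  fix n U P
  assume P: "P \<in> plots (locally_in S K) n U"
  then have PU: "P \<in> U \<rightarrow>\<^sub>E S" by (simp add: locally_in_def)
  define \<W> where "\<W> = {W. openin (Euclidean_space n) W \<and> W \<subseteq> U \<and> restrict P W \<in> K n W}"
  show "compose U w P \<in> plots Z n U"
  proof (rule diffeological_space.plot_local[OF Z, of _ _ \<W>])
    show "compose U w P \<in> U \<rightarrow>\<^sub>E points Z" using PU w by (auto simp: compose_def PiE_iff Pi_iff)
    have "\<exists>W. openin (Euclidean_space n) W \<and> x \<in> W \<and> W \<subseteq> U \<and> restrict P W \<in> K n W" if "x \<in> U" for x
      using P that by (simp add: locally_in_def)
    then show "\<Union>\<W> = U" unfolding \<W>_def by blast
    fix W assume W: "W \<in> \<W>"
    then show "openin (Euclidean_space n) W" by (simp add: \<W>_def)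
    have "restrict (compose U w P) W = compose W w (restrict P W)"
      using W by (auto simp: compose_def \<W>_def fun_eq_iff)
    then show "restrict (compose U w P) W \<in> plots Z n W"
      using K[of "restrict P W" n W] W by (simp add: \<W>_def)
  qed
qed

lemma smooth_map_compose:
  assumes f: "smooth_map X Y f" and g: "smooth_map Y Z g" and X: "diffeological_space X"
  shows "smooth_map X Z (g \<circ> f)"
  unfolding smooth_map_def
proof (intro conjI allI ballI)
  show "g \<circ> f \<in> points X \<rightarrow> points Z" using f g by (auto simp: smooth_map_def)
  fix n U P
  assume "P \<in> plots X n U"
  then have "compose U g (compose U f P) \<in> plots Z n U" using f g by (simp add: smooth_map_def)
  moreover have "compose U g (compose U f P) = compose U (g \<circ> f) P" by (auto simp: compose_def)
  ultimately show "compose U (g \<circ> f) P \<in> plots Z n U" by simp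
qed

lemma smooth_map_cong:
  assumes "smooth_map X Y f" "diffeological_space X" "\<And>x. x \<in> points X \<Longrightarrow> f x = g x"
  shows "smooth_map X Y g"
  unfolding smooth_map_def
proof (intro conjI allI ballI)
  show "g \<in> points X \<rightarrow> points Y" using assms(1) by (simp add: smooth_map_def assms(3) Pi_iff)
  fix n U P
  assume P: "P \<in> plots X n U"
  have "f (P x) = g (P x)" if "x \<in> U" for x
    using PiE_mem[OF diffeological_space.plot_fun[OF assms(2) P] that] by (rule assms(3))
  then have "compose U g P = compose U f P" by (simp add: compose_def cong: restrict_cong)
  then show "compose U g P \<in> plots Y n U" using P assms(1) by (simp add: smooth_map_def)
qed

text \<open>The indiscrete two-point space detects joint surjectivity of a universal cocone.\<close>

definition indiscrete_space :: "'a set \<Rightarrow> 'a diffeo_space" where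
  "indiscrete_space S = \<lparr>points = S, plots = (\<lambda>n U. {P \<in> U \<rightarrow>\<^sub>E S. openin (Euclidean_space n) U})\<rparr>"

lemma diffeological_indiscrete: "diffeological_space (indiscrete_space S)"
proof
  show "P \<in> plots (indiscrete_space S) n U"
    if "P \<in> U \<rightarrow>\<^sub>E points (indiscrete_space S)" "\<And>W. W \<in> \<W> \<Longrightarrow> openin (Euclidean_space n) W"
      "\<Union>\<W> = U" for P n U \<W>
    using that by (auto simp: indiscrete_space_def)
qed (auto simp: indiscrete_space_def compose_def)

lemma smooth_map_indiscrete:
  "diffeological_space X \<Longrightarrow> f \<in> points X \<rightarrow> S \<Longrightarrow> smooth_map X (indiscrete_space S) f"
  by (fastforce simp: smooth_map_def indiscrete_space_def compose_def
      dest: diffeological_space.plot_fun diffeological_space.plot_dom)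

lemma plots_image_const:
  assumes "diffeological_space X" "openin (Euclidean_space n) W" "a \<in> points X" "h a = b"
  shows "(\<lambda>x\<in>W. b) \<in> compose W h ` plots X n W"
proof
  show "(\<lambda>x\<in>W. b) = compose W h (\<lambda>x\<in>W. a)" using assms(4) by (simp add: compose_def fun_eq_iff)
  show "(\<lambda>x\<in>W. a) \<in> plots X n W"
    using assms(1-3) by (simp add: diffeological_space.plot_const)
qed

lemma plots_image_compose:
  assumes "diffeological_space X" "Q \<in> compose W h ` plots X n W"
    and V: "openin (Euclidean_space m) V" "\<phi> \<in> V \<rightarrow> W" "euclid_smooth m V n \<phi>"
  shows "compose V Q \<phi> \<in> compose V h ` plots X m V"
proof -
  obtain P where P: "P \<in> plots X n W" and Q: "Q = compose W h P" using assms(2) by blast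
  show ?thesis
  proof
    show "compose V P \<phi> \<in> plots X m V"
      using diffeological_space.plot_compose[OF assms(1) P V] .
    show "compose V Q \<phi> = compose V h (compose V P \<phi>)"
      unfolding Q using V(2) by (auto simp: compose_def Pi_iff intro!: restrict_ext)
  qed
qed

lemma diffeological_coproduct:
  assumes F: "\<And>i. i \<in> I \<Longrightarrow> diffeological_space (F i)"
  shows "diffeological_space (coproduct I F)"
  unfolding coproduct_def
proof (rule diffeological_locally_in)
  fix n W a
  assume W: "openin (Euclidean_space n) W" and a: "a \<in> (SIGMA i:I. points (F i))"
  then obtain i x where i: "i \<in> I" "x \<in> points (F i)" "a = (i, x)" by blast
  have "(\<lambda>x\<in>W. a) \<in> compose W (Pair i) ` plots (F i) n W"
    using plots_image_const[OF F[OF i(1)] W i(2)] i(3) by simp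
  then show "(\<lambda>x\<in>W. a) \<in> (\<Union>i\<in>I. compose W (Pair i) ` plots (F i) n W)" using i(1) by blast
next
  fix n W Q m V and \<phi> :: "(nat \<Rightarrow> real) \<Rightarrow> nat \<Rightarrow> real"
  assume "Q \<in> (\<Union>i\<in>I. compose W (Pair i) ` plots (F i) n W)"
    and V: "openin (Euclidean_space m) V" "\<phi> \<in> V \<rightarrow> W" "euclid_smooth m V n \<phi>"
  then obtain i where i: "i \<in> I" "Q \<in> compose W (Pair i) ` plots (F i) n W" by blast
  show "compose V Q \<phi> \<in> (\<Union>i\<in>I. compose V (Pair i) ` plots (F i) m V)"
    using plots_image_compose[OF F[OF i(1)] i(2) V] i(1) by (rule UN_I[rotated])
qed

lemma smooth_map_into_locally_in:
  assumes X: "diffeological_space X" and h: "h \<in> points X \<rightarrow> S"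
    and K: "\<And>n W. compose W h ` plots X n W \<subseteq> K n W"
  shows "smooth_map X (locally_in S K) h"
  unfolding smooth_map_def
proof (intro conjI allI ballI)
  show "h \<in> points X \<rightarrow> points (locally_in S K)" using h by (simp add: locally_in_def)
  fix n U P
  assume P: "P \<in> plots X n U"
  have "openin (Euclidean_space n) U" "P \<in> U \<rightarrow>\<^sub>E points X"
    using diffeological_space.plot_dom[OF X P] diffeological_space.plot_fun[OF X P] .
  moreover have "restrict (compose U h P) U \<in> K n U"
    using K[of U n] P by (auto simp: compose_def)
  ultimately show "compose U h P \<in> plots (locally_in S K) n U"
    using h by (auto simp: locally_in_def compose_def PiE_iff Pi_iff)
qed

lemma generated_class_eq:
  assumes xy: "(x, y) \<in> (R \<union> R\<inverse>)\<^sup>*"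
  shows "(R \<union> R\<inverse>)\<^sup>* `` {x} = (R \<union> R\<inverse>)\<^sup>* `` {y}"
proof
  have yx: "(y, x) \<in> (R \<union> R\<inverse>)\<^sup>*" using sym_rtrancl[OF sym_Un_converse] xy by (rule symD)
  show "(R \<union> R\<inverse>)\<^sup>* `` {x} \<subseteq> (R \<union> R\<inverse>)\<^sup>* `` {y}" using rtrancl_trans[OF yx] by auto
  show "(R \<union> R\<inverse>)\<^sup>* `` {y} \<subseteq> (R \<union> R\<inverse>)\<^sup>* `` {x}" using rtrancl_trans[OF xy] by auto
qed

lemma pushout_for_exists:
  assumes "pushout_for A f B g C D p q Z" "smooth_map B Z u" "smooth_map C Z v"
    and "\<And>a. a \<in> points A \<Longrightarrow> u (f a) = v (g a)"
  shows "\<exists>w. smooth_map D Z w \<and> (\<forall>b\<in>points B. w (p b) = u b) \<and> (\<forall>c\<in>points C. w (q c) = v c)"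
proof -
  have "smooth_map B Z u \<and> smooth_map C Z v \<and> (\<forall>a\<in>points A. u (f a) = v (g a))"
    using assms(2-4) by simp
  from assms(1)[unfolded pushout_for_def, THEN spec, THEN spec, THEN mp, OF this]
  show ?thesis by (elim ex_forward conjE) (intro conjI)
qed

lemma pushout_for_unique:
  assumes "pushout_for A f B g C D p q Z" "smooth_map B Z u" "smooth_map C Z v"
    and "\<And>a. a \<in> points A \<Longrightarrow> u (f a) = v (g a)"
    and w: "smooth_map D Z w" "\<And>b. b \<in> points B \<Longrightarrow> w (p b) = u b" "\<And>c. c \<in> points C \<Longrightarrow> w (q c) = v c"
    and w': "smooth_map D Z w'" "\<And>b. b \<in> points B \<Longrightarrow> w' (p b) = u b" "\<And>c. c \<in> points C \<Longrightarrow> w' (q c) = v c"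
    and d: "d \<in> points D"
  shows "w d = w' d"
proof -
  have "smooth_map B Z u \<and> smooth_map C Z v \<and> (\<forall>a\<in>points A. u (f a) = v (g a))"
    using assms(2-4) by simp
  from assms(1)[unfolded pushout_for_def, THEN spec, THEN spec, THEN mp, OF this]
  obtain w0 where w0: "\<forall>w. smooth_map D Z w \<and> (\<forall>b\<in>points B. w (p b) = u b) \<and> (\<forall>c\<in>points C. w (q c) = v c)
      \<longrightarrow> (\<forall>d\<in>points D. w d = w0 d)"
    by (elim exE conjE)
  have "w d = w0 d" "w' d = w0 d"
    using spec[OF w0, of w] spec[OF w0, of w'] w w' d by simp_all
  then show ?thesis by simp
qed

lemma colimit_for_exists:
  assumes "colimit_for F j D p Z" "\<And>n. smooth_map (F n) Z (u n)"
    and "\<And>n b. b \<in> points (F n) \<Longrightarrow> u (Suc n) (j n b) = u n b"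
  shows "\<exists>w. smooth_map D Z w \<and> (\<forall>n. \<forall>b\<in>points (F n). w (p n b) = u n b)"
proof -
  have "(\<forall>n. smooth_map (F n) Z (u n)) \<and> (\<forall>n. \<forall>b\<in>points (F n). u (Suc n) (j n b) = u n b)"
    using assms(2,3) by simp
  from assms(1)[unfolded colimit_for_def, THEN spec, THEN mp, OF this]
  show ?thesis by (elim ex_forward conjE) (intro conjI)
qed

lemma colimit_for_unique:
  assumes "colimit_for F j D p Z" "\<And>n. smooth_map (F n) Z (u n)"
    and "\<And>n b. b \<in> points (F n) \<Longrightarrow> u (Suc n) (j n b) = u n b"
    and w: "smooth_map D Z w" "\<And>n b. b \<in> points (F n) \<Longrightarrow> w (p n b) = u n b"
    and w': "smooth_map D Z w'" "\<And>n b. b \<in> points (F n) \<Longrightarrow> w' (p n b) = u n b"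
    and d: "d \<in> points D"
  shows "w d = w' d"
proof -
  have "(\<forall>n. smooth_map (F n) Z (u n)) \<and> (\<forall>n. \<forall>b\<in>points (F n). u (Suc n) (j n b) = u n b)"
    using assms(2,3) by simp
  from assms(1)[unfolded colimit_for_def, THEN spec, THEN mp, OF this]
  obtain w0 where w0: "\<forall>w. smooth_map D Z w \<and> (\<forall>n. \<forall>b\<in>points (F n). w (p n b) = u n b)
      \<longrightarrow> (\<forall>d\<in>points D. w d = w0 d)"
    by (elim exE conjE)
  have "w d = w0 d" "w' d = w0 d"
    using spec[OF w0, of w] spec[OF w0, of w'] w w' d by simp_all
  then show ?thesis by simp
qed

lemma pushout_universal:
  fixes A :: "'a diffeo_space" and B :: "'b diffeo_space" and C :: "'c diffeo_space"
    and D :: "'d diffeo_space" and Z :: "'z diffeo_space"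
  assumes po: "is_pushout A f B g C D p q"
    and B: "diffeological_space B" and C: "diffeological_space C" and Z: "diffeological_space Z"
    and f: "f \<in> points A \<rightarrow> points B" and g: "g \<in> points A \<rightarrow> points C"
  shows "pushout_for A f B g C D p q Z"
proof -
  have D: "diffeological_space D" and p: "smooth_map B D p" and q: "smooth_map C D q"
    and U: "\<And>Z :: ('b + 'c) set diffeo_space. diffeological_space Z \<Longrightarrow> pushout_for A f B g C D p q Z"
    using po by (auto simp: is_pushout_def)
  have surj: "d \<in> p ` points B \<union> q ` points C" (is "_ \<in> ?im") if d: "d \<in> points D" for d
  proof (rule ccontr)
    assume nd: "d \<notin> ?im"
    define I where "I = indiscrete_space (UNIV :: ('b + 'c) set set)"
    define e where "e = (\<lambda>_::'d. {} :: ('b + 'c) set)"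
    define e' where "e' = (\<lambda>x. if x \<in> ?im then {} else (UNIV :: ('b + 'c) set))"
    have sm: "smooth_map B I (\<lambda>_. {})" "smooth_map C I (\<lambda>_. {})" "smooth_map D I e" "smooth_map D I e'"
      unfolding I_def using B C D by (auto intro!: smooth_map_indiscrete)
    have "pushout_for A f B g C D p q I" unfolding I_def using U diffeological_indiscrete .
    then have "e d = e' d"
      by (rule pushout_for_unique[OF _ sm(1,2) _ sm(3) _ _ sm(4) _ _ d]) (auto simp: e_def e'_def)
    then show False using nd by (simp add: e_def e'_def)
  qed
  define R :: "('b + 'c) rel" where "R = {(Inl (f a), Inr (g a)) | a. a \<in> points A}"
  define c :: "'b + 'c \<Rightarrow> ('b + 'c) set" where "c x = (R \<union> R\<inverse>)\<^sup>* `` {x}" for x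
  define S where "S = (c \<circ> Inl) ` points B \<union> (c \<circ> Inr) ` points C"
  define K where "K n W = compose W (c \<circ> Inl) ` plots B n W \<union> compose W (c \<circ> Inr) ` plots C n W" for n W
  define Q where "Q = locally_in S K"
  have Q: "diffeological_space Q"
    unfolding Q_def
  proof (rule diffeological_locally_in)
    fix n W a
    assume W: "openin (Euclidean_space n) W" and a: "a \<in> S"
    from a show "(\<lambda>x\<in>W. a) \<in> K n W"
      unfolding S_def
    proof (elim UnE imageE)
      fix b assume b: "a = (c \<circ> Inl) b" "b \<in> points B"
      have "(\<lambda>x\<in>W. a) \<in> compose W (c \<circ> Inl) ` plots B n W"
        using B W b(2) b(1)[symmetric] by (rule plots_image_const)
      then show ?thesis unfolding K_def by (rule UnI1)
    next
      fix b assume b: "a = (c \<circ> Inr) b" "b \<in> points C"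
      have "(\<lambda>x\<in>W. a) \<in> compose W (c \<circ> Inr) ` plots C n W"
        using C W b(2) b(1)[symmetric] by (rule plots_image_const)
      then show ?thesis unfolding K_def by (rule UnI2)
    qed
  next
    fix n W T m V and \<phi> :: "(nat \<Rightarrow> real) \<Rightarrow> nat \<Rightarrow> real"
    assume T: "T \<in> K n W" and V: "openin (Euclidean_space m) V" "\<phi> \<in> V \<rightarrow> W" "euclid_smooth m V n \<phi>"
    from T[unfolded K_def] show "compose V T \<phi> \<in> K m V"
    proof (rule UnE)
      assume "T \<in> compose W (c \<circ> Inl) ` plots B n W"
      from B this V have "compose V T \<phi> \<in> compose V (c \<circ> Inl) ` plots B m V"
        by (rule plots_image_compose)
      then show ?thesis unfolding K_def by (rule UnI1)
    next
      assume "T \<in> compose W (c \<circ> Inr) ` plots C n W"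
      from C this V have "compose V T \<phi> \<in> compose V (c \<circ> Inr) ` plots C m V"
        by (rule plots_image_compose)
      then show ?thesis unfolding K_def by (rule UnI2)
    qed
  qed
  have iB: "smooth_map B Q (c \<circ> Inl)"
    unfolding Q_def using B by (rule smooth_map_into_locally_in) (auto simp: S_def K_def)
  have iC: "smooth_map C Q (c \<circ> Inr)"
    unfolding Q_def using C by (rule smooth_map_into_locally_in) (auto simp: S_def K_def)
  have eq: "(c \<circ> Inl) (f a) = (c \<circ> Inr) (g a)" if a: "a \<in> points A" for a
  proof -
    have "(Inl (f a), Inr (g a)) \<in> (R \<union> R\<inverse>)\<^sup>*" using a by (auto simp: R_def)
    then show ?thesis
      unfolding c_def comp_def by (rule generated_class_eq)
  qed
  have "\<exists>r. smooth_map D Q r \<and>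
      (\<forall>b\<in>points B. r (p b) = (c \<circ> Inl) b) \<and> (\<forall>x\<in>points C. r (q x) = (c \<circ> Inr) x)"
    using U[OF Q] iB iC eq by (rule pushout_for_exists)
  then obtain r where r: "smooth_map D Q r"
      "\<forall>b\<in>points B. r (p b) = (c \<circ> Inl) b" "\<forall>x\<in>points C. r (q x) = (c \<circ> Inr) x"
    by (elim exE conjE)
  show ?thesis
    unfolding pushout_for_def
  proof (intro allI impI, elim conjE)
    fix u v
    assume u: "smooth_map B Z u" and v: "smooth_map C Z v" and uv: "\<forall>a\<in>points A. u (f a) = v (g a)"
    define w where "w X = case_sum u v (SOME x. x \<in> X)" for X
    have w: "w (c x) = case_sum u v x" for x
    proof -
      have R_eq: "case_sum u v y = case_sum u v z" if "(y, z) \<in> R \<union> R\<inverse>" for y z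
        using that uv by (auto simp: R_def)
      have eq: "case_sum u v x = case_sum u v y" if "(x, y) \<in> (R \<union> R\<inverse>)\<^sup>*" for y
        using that
      proof (induction rule: rtrancl_induct)
        case (step y z)
        then show ?case using R_eq[OF step.hyps(2)] by simp
      qed simp
      have "(SOME y. y \<in> c x) \<in> c x" by (rule someI[of _ x]) (simp add: c_def)
      then have "(x, SOME y. y \<in> c x) \<in> (R \<union> R\<inverse>)\<^sup>*" by (subst (asm) (2) c_def) simp
      then show ?thesis unfolding w_def by (rule eq[symmetric])
    qed
    have "smooth_map Q Z w"
      unfolding Q_def
    proof (rule smooth_map_from_locally_in[OF Z])
      show "w \<in> S \<rightarrow> points Z" using u[unfolded smooth_map_def, THEN conjunct1] v[unfolded smooth_map_def, THEN conjunct1]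
        by (auto simp: S_def w)
      fix n W T
      assume "T \<in> K n W"
      then show "compose W w T \<in> plots Z n W"
        unfolding K_def
      proof (elim UnE imageE)
        fix P assume P: "P \<in> plots B n W" "T = compose W (c \<circ> Inl) P"
        have "compose W w T = compose W u P" by (simp add: P(2) compose_def w cong: restrict_cong)
        then show ?thesis using u P(1) by (simp add: smooth_map_def)
      next
        fix P assume P: "P \<in> plots C n W" "T = compose W (c \<circ> Inr) P"
        have "compose W w T = compose W v P" by (simp add: P(2) compose_def w cong: restrict_cong)
        then show ?thesis using v P(1) by (simp add: smooth_map_def)
      qed
    qed
    then have sm: "smooth_map D Z (w \<circ> r)" by (rule smooth_map_compose[OF r(1) _ D])
    have wB: "\<forall>b\<in>points B. (w \<circ> r) (p b) = u b" and wC: "\<forall>x\<in>points C. (w \<circ> r) (q x) = v x"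
      using r(2,3) by (simp_all add: w)
    have uniq: "\<forall>d\<in>points D. w' d = (w \<circ> r) d"
      if "\<forall>b\<in>points B. w' (p b) = u b" "\<forall>x\<in>points C. w' (q x) = v x" for w'
    proof
      fix d assume "d \<in> points D"
      then have "d \<in> p ` points B \<union> q ` points C" by (rule surj)
      then show "w' d = (w \<circ> r) d" using that wB wC by (elim UnE imageE) simp_all
    qed
    show "\<exists>w. smooth_map D Z w \<and> (\<forall>b\<in>points B. w (p b) = u b) \<and>
         (\<forall>c\<in>points C. w (q c) = v c) \<and>
         (\<forall>w'. smooth_map D Z w' \<and> (\<forall>b\<in>points B. w' (p b) = u b) \<and> (\<forall>c\<in>points C. w' (q c) = v c)
            \<longrightarrow> (\<forall>d\<in>points D. w' d = w d))"
    proof (intro exI[of _ "w \<circ> r"] conjI allI impI sm wB wC)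
      fix w' assume "smooth_map D Z w' \<and> (\<forall>b\<in>points B. w' (p b) = u b) \<and> (\<forall>c\<in>points C. w' (q c) = v c)"
      then show "\<forall>d\<in>points D. w' d = (w \<circ> r) d" by (elim conjE) (rule uniq)
    qed
  qed
qed

lemma colimit_universal:
  fixes F :: "nat \<Rightarrow> 'b diffeo_space" and D :: "'d diffeo_space" and Z :: "'z diffeo_space"
  assumes co: "is_colimit F j D p" and F: "\<And>n. diffeological_space (F n)"
    and Z: "diffeological_space Z" and j: "\<And>n. j n \<in> points (F n) \<rightarrow> points (F (Suc n))"
  shows "colimit_for F j D p Z"
proof -
  have D: "diffeological_space D" and p: "\<And>n. smooth_map (F n) D (p n)"
    and U: "\<And>Z :: (nat \<times> 'b) set diffeo_space. diffeological_space Z \<Longrightarrow> colimit_for F j D p Z"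
    using co by (auto simp: is_colimit_def)
  have surj: "d \<in> (\<Union>n. p n ` points (F n))" (is "_ \<in> ?im") if d: "d \<in> points D" for d
  proof (rule ccontr)
    assume nd: "d \<notin> ?im"
    define I where "I = indiscrete_space (UNIV :: (nat \<times> 'b) set set)"
    define e where "e = (\<lambda>_::'d. {} :: (nat \<times> 'b) set)"
    define e' where "e' = (\<lambda>x. if x \<in> ?im then {} else (UNIV :: (nat \<times> 'b) set))"
    have sm: "\<forall>n. smooth_map (F n) I (\<lambda>_. {})" "smooth_map D I e" "smooth_map D I e'"
      unfolding I_def using F D by (auto intro!: smooth_map_indiscrete)
    have "colimit_for F j D p I" unfolding I_def using U diffeological_indiscrete .
    then have "e d = e' d"
      by (rule colimit_for_unique[OF _ sm(1)[THEN spec] _ sm(2) _ sm(3) _ d]) (auto simp: e_def e'_def)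
    then show False using nd by (simp add: e_def e'_def)
  qed
  define R where "R = {((n, b), (Suc n, j n b)) | n b. b \<in> points (F n)}"
  define c :: "nat \<times> 'b \<Rightarrow> (nat \<times> 'b) set" where "c x = (R \<union> R\<inverse>)\<^sup>* `` {x}" for x
  define S where "S = (\<Union>n. (c \<circ> Pair n) ` points (F n))"
  define K where "K m W = (\<Union>n. compose W (c \<circ> Pair n) ` plots (F n) m W)" for m W
  define Q where "Q = locally_in S K"
  have Q: "diffeological_space Q"
    unfolding Q_def
  proof (rule diffeological_locally_in)
    fix n W a
    assume W: "openin (Euclidean_space n) W" and a: "a \<in> S"
    from a show "(\<lambda>x\<in>W. a) \<in> K n W"
      unfolding S_def
    proof (elim UN_E imageE)
      fix i b assume b: "a = (c \<circ> Pair i) b" "b \<in> points (F i)"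
      have "(\<lambda>x\<in>W. a) \<in> compose W (c \<circ> Pair i) ` plots (F i) n W"
        using F W b(2) b(1)[symmetric] by (rule plots_image_const)
      then show ?thesis unfolding K_def by (rule UN_I[OF UNIV_I])
    qed
  next
    fix n W T m V and \<phi> :: "(nat \<Rightarrow> real) \<Rightarrow> nat \<Rightarrow> real"
    assume T: "T \<in> K n W" and V: "openin (Euclidean_space m) V" "\<phi> \<in> V \<rightarrow> W" "euclid_smooth m V n \<phi>"
    from T[unfolded K_def] show "compose V T \<phi> \<in> K m V"
    proof (rule UN_E)
      fix i assume "T \<in> compose W (c \<circ> Pair i) ` plots (F i) n W"
      from F this V have "compose V T \<phi> \<in> compose V (c \<circ> Pair i) ` plots (F i) m V"
        by (rule plots_image_compose)
      then show ?thesis unfolding K_def by (rule UN_I[OF UNIV_I])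
    qed
  qed
  have iF: "\<forall>n. smooth_map (F n) Q (c \<circ> Pair n)"
    unfolding Q_def by (intro allI smooth_map_into_locally_in F) (unfold S_def K_def, blast+)
  have eq: "\<forall>n. \<forall>b\<in>points (F n). (c \<circ> Pair (Suc n)) (j n b) = (c \<circ> Pair n) b"
  proof (intro allI ballI)
    fix n b
    assume b: "b \<in> points (F n)"
    have "((n, b), (Suc n, j n b)) \<in> (R \<union> R\<inverse>)\<^sup>*" using b by (auto simp: R_def)
    then show "(c \<circ> Pair (Suc n)) (j n b) = (c \<circ> Pair n) b"
      unfolding c_def comp_def by (rule generated_class_eq[symmetric])
  qed
  have "\<exists>r. smooth_map D Q r \<and> (\<forall>n. \<forall>b\<in>points (F n). r (p n b) = (c \<circ> Pair n) b)"
    by (rule colimit_for_exists[OF U[OF Q] iF[THEN spec]]) (rule eq[rule_format])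
  then obtain r where r: "smooth_map D Q r" "\<forall>n. \<forall>b\<in>points (F n). r (p n b) = (c \<circ> Pair n) b"
    by (elim exE conjE)
  show ?thesis
    unfolding colimit_for_def
  proof (intro allI impI, elim conjE)
    fix u
    assume u: "\<forall>n. smooth_map (F n) Z (u n)" and uj: "\<forall>n. \<forall>b\<in>points (F n). u (Suc n) (j n b) = u n b"
    define w where "w X = case_prod u (SOME x. x \<in> X)" for X
    have w: "w (c x) = case_prod u x" for x
    proof -
      have R_eq: "case_prod u y = case_prod u z" if "(y, z) \<in> R \<union> R\<inverse>" for y z
        using that uj by (auto simp: R_def)
      have eq: "case_prod u x = case_prod u y" if "(x, y) \<in> (R \<union> R\<inverse>)\<^sup>*" for y
        using that
      proof (induction rule: rtrancl_induct)
        case (step y z)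
        then show ?case using R_eq[OF step.hyps(2)] by simp
      qed simp
      have "(SOME y. y \<in> c x) \<in> c x" by (rule someI[of _ x]) (simp add: c_def)
      then have "(x, SOME y. y \<in> c x) \<in> (R \<union> R\<inverse>)\<^sup>*" by (subst (asm) (2) c_def) simp
      then show ?thesis unfolding w_def by (rule eq[symmetric])
    qed
    have "smooth_map Q Z w"
      unfolding Q_def
    proof (rule smooth_map_from_locally_in[OF Z])
      show "w \<in> S \<rightarrow> points Z" using funcset_mem[OF u[unfolded smooth_map_def, rule_format, THEN conjunct1]]
        by (auto simp: S_def w)
      fix m W T
      assume "T \<in> K m W"
      then show "compose W w T \<in> plots Z m W"
        unfolding K_def
      proof (elim UN_E imageE)
        fix n P assume P: "P \<in> plots (F n) m W" "T = compose W (c \<circ> Pair n) P"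
        have "compose W w T = compose W (u n) P" by (simp add: P(2) compose_def w cong: restrict_cong)
        then show ?thesis using u P(1) by (simp add: smooth_map_def)
      qed
    qed
    then have sm: "smooth_map D Z (w \<circ> r)" by (rule smooth_map_compose[OF r(1) _ D])
    have wF: "\<forall>n. \<forall>b\<in>points (F n). (w \<circ> r) (p n b) = u n b"
      using r(2) by (simp add: w)
    have uniq: "\<forall>d\<in>points D. w' d = (w \<circ> r) d"
      if "\<forall>n. \<forall>b\<in>points (F n). w' (p n b) = u n b" for w'
    proof
      fix d assume "d \<in> points D"
      then have "d \<in> (\<Union>n. p n ` points (F n))" by (rule surj)
      then show "w' d = (w \<circ> r) d" using that wF by (elim UN_E imageE) simp
    qed
    show "\<exists>w. smooth_map D Z w \<and> (\<forall>n. \<forall>b\<in>points (F n). w (p n b) = u n b) \<and>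
         (\<forall>w'. smooth_map D Z w' \<and> (\<forall>n. \<forall>b\<in>points (F n). w' (p n b) = u n b)
            \<longrightarrow> (\<forall>d\<in>points D. w' d = w d))"
    proof (intro exI[of _ "w \<circ> r"] conjI impI sm wF)
      show "\<forall>w'. smooth_map D Z w' \<and> (\<forall>n. \<forall>b\<in>points (F n). w' (p n b) = u n b) \<longrightarrow>
          (\<forall>d\<in>points D. w' d = (w \<circ> r) d)"
        by (intro allI impI, elim conjE) (rule uniq)
    qed
  qed
qed


section \<open>Smooth CW complexes\<close>

text \<open>
  \<open>Sk n\<close> is the \<open>n\<close>-skeleton, \<open>cells n\<close> indexes the \<open>(n+1)\<close>-cells, \<open>h n\<close> is the attaching map,
  \<open>j n : Sk n \<rightarrow> Sk (Suc n)\<close> and \<open>\<Phi> n\<close> are the structure maps of the pushout, and \<open>\<iota> n : Sk n \<rightarrow> X\<close>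
  those of the colimit. The inclusion of the spheres into the disks is the identity on
  pairs \<open>(\<alpha>, x)\<close>.
\<close>

locale smooth_CW_complex =
  fixes X :: "'a diffeo_space" and Sk :: "nat \<Rightarrow> 'b diffeo_space" and cells :: "nat \<Rightarrow> 'c set"
    and h :: "nat \<Rightarrow> 'c \<times> (nat \<Rightarrow> real) \<Rightarrow> 'b" and j :: "nat \<Rightarrow> 'b \<Rightarrow> 'b"
    and \<Phi> :: "nat \<Rightarrow> 'c \<times> (nat \<Rightarrow> real) \<Rightarrow> 'b" and \<iota> :: "nat \<Rightarrow> 'b \<Rightarrow> 'a"
  assumes skeleton: "diffeological_space (Sk n)"
    and skeleton_0: "Sk 0 = discrete_space (points (Sk 0))"
    and attaching: "smooth_map (coproduct (cells n) (\<lambda>_. sphere_space n)) (Sk n) (h n)"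
    and pushout: "is_pushout (coproduct (cells n) (\<lambda>_. sphere_space n)) (h n) (Sk n)
          (\<lambda>x. x) (coproduct (cells n) (\<lambda>_. disk_space (Suc n))) (Sk (Suc n)) (j n) (\<Phi> n)"
    and colimit: "is_colimit Sk j X \<iota>"


section \<open>Partitions of unity\<close>

definition supp :: "'a diffeo_space \<Rightarrow> ('a \<Rightarrow> real) \<Rightarrow> 'a set" where
  "supp X \<rho> = D_topology X closure_of {x \<in> points X. \<rho> x \<noteq> 0}"

text \<open>Local finiteness is that of the indexed family \<open>(supp \<rho>\<^sub>l)\<close>, not merely of the set of supports,
  so the sum below is finite at every point.\<close>

definition smooth_partition_of_unity ::
    "'a diffeo_space \<Rightarrow> 'a set set \<Rightarrow> 'l set \<Rightarrow> ('l \<Rightarrow> 'a \<Rightarrow> real) \<Rightarrow> bool" where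
  "smooth_partition_of_unity X \<V> \<Lambda> \<rho> \<longleftrightarrow>
     (\<forall>l\<in>\<Lambda>. smooth_map X (real_subspace {0..1}) (\<rho> l)) \<and>
     (\<forall>x\<in>points X. \<exists>N. openin (D_topology X) N \<and> x \<in> N \<and> finite {l\<in>\<Lambda>. supp X (\<rho> l) \<inter> N \<noteq> {}}) \<and>
     (\<forall>l\<in>\<Lambda>. \<exists>V\<in>\<V>. supp X (\<rho> l) \<subseteq> V) \<and>
     (\<forall>x\<in>points X. (\<Sum>l | l \<in> \<Lambda> \<and> \<rho> l x \<noteq> 0. \<rho> l x) = 1)"

end

theory Submission
  imports Defs
begin

text \<open>
  The partition of unity is indexed by the cover \<open>\<V>\<close> itself. It is obtained from a simpler object, a
  family of smooth real functions \<open>u V\<close> such that \<open>{u V \<ge> 0} \<subseteq> V\<close>, such that at each point some \<open>u V\<close>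
  is positive, and such that each point has a D-open neighbourhood on which all but finitely many of
  the \<open>u V\<close> are negative (\<open>numeration\<close>). With the function \<open>g t = exp (- 1 / t)\<close> for \<open>t > 0\<close> and \<open>g t = 0\<close>
  otherwise, the quotients of \<open>g (u V)\<close> by \<open>\<Sum>W. g (u W)\<close> form the required partition: the support of
  \<open>g (u V)\<close> lies in the D-closed set \<open>{u V \<ge> 0}\<close> (\<open>numeration_imp_partition_of_unity\<close>). The gain is that
  a numeration carries no exact identity like \<open>\<Sum> = 1\<close> through the induction, and that \<open>u V\<close> encodes
  both the partition function and a D-open set \<open>{u V < 0}\<close> that contains the complement of \<open>V\<close> and on
  which the partition function vanishes.

  A numeration of \<open>X\<close> is built skeleton by skeleton. On the discrete 0-skeleton it takes the values
  \<open>1\<close> and \<open>- 1\<close>. On a new cell with attaching map \<open>h\<close>, the function \<open>u V\<close> is extended by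
  \<open>\<kappa>(x) u V (h (x / \<bar>x\<bar>)) - K (1 - \<bar>x\<bar>\<^sup>2) + w V x\<close>, where \<open>\<kappa>\<close> is a cutoff that is \<open>1\<close> on the sphere and
  vanishes near the centre. The first term is smooth because \<open>x \<mapsto> x / \<bar>x\<bar>\<close> is a plot of the sphere. Only
  finitely many \<open>u V\<close> take nonnegative values on the compact boundary sphere, so one large constant \<open>K\<close>
  makes the sum of the first two terms negative outside the preimage of \<open>V\<close>. The functions \<open>w V\<close> are
  finite sums of bumps, supported in the preimage of \<open>V\<close> and away from the sphere, that restore
  positivity of some member of the family in the interior (\<open>extend_over_disk\<close>).

  Local finiteness survives the infinitely many steps because every D-open set of a skeleton thickens,
  along collars of the new cells, to a D-open set of the next skeleton such that each \<open>u V\<close> that is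
  negative on the former remains negative on the latter (\<open>collared_extension\<close>); the thickenings of all
  stages together form a D-open set of \<open>X\<close>. Smooth functions and D-open sets are both glued by the
  universal properties of pushouts and colimits, the latter as smooth maps into a diffeological
  Sierpinski space.
\<close>

section \<open>Differential calculus on open subsets of Euclidean spaces\<close>

abbreviation euclid :: "nat \<Rightarrow> (nat \<Rightarrow> real) set" where
  "euclid n \<equiv> topspace (Euclidean_space n)"

abbreviation eopen :: "nat \<Rightarrow> (nat \<Rightarrow> real) set \<Rightarrow> bool" where
  "eopen n \<equiv> openin (Euclidean_space n)"

lemma eopen_iff: "eopen n U \<longleftrightarrow> (\<exists>T. open T \<and> U = euclid n \<inter> T)"
proof -
  have "eopen n U \<longleftrightarrow> openin (top_of_set (euclid n)) U"
    by (simp add: Euclidean_space_def euclidean_product_topology)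
  then show ?thesis by (simp add: openin_open)
qed

lemma eopen_subset: "eopen n U \<Longrightarrow> U \<subseteq> euclid n"
  by (rule openin_subset)

lemma continuous_map_euclid_iff:
  assumes "U \<subseteq> euclid n"
  shows "continuous_map (subtopology (Euclidean_space n) U) euclideanreal f \<longleftrightarrow> continuous_on U f"
proof -
  have "subtopology (Euclidean_space n) U = top_of_set U"
    using assms by (simp add: Euclidean_space_def euclidean_product_topology subtopology_subtopology inf_absorb2)
  then show ?thesis by simp
qed

lemma continuous_on_fun_upd: "continuous_on S (\<lambda>t::real. x(i := t) :: nat \<Rightarrow> real)"
proof (rule continuous_on_coordinatewise_then_product)
  fix k show "continuous_on S (\<lambda>t. (x(i := t)) k)" by (cases "k = i") auto
qed

lemma eopen_eventually_fun_upd: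
  assumes "eopen n U" "x \<in> U" "i < n"
  shows "\<forall>\<^sub>F t in nhds (x i). x(i := t) \<in> U"
proof -
  obtain T where T: "open T" "U = euclid n \<inter> T" using assms(1) by (auto simp: eopen_iff)
  have "open ((\<lambda>t. x(i := t)) -` T)"
    by (rule open_vimage[OF T(1) continuous_on_fun_upd])
  moreover have "x i \<in> (\<lambda>t. x(i := t)) -` T" using assms(2) T by simp
  ultimately have "\<forall>\<^sub>F t in nhds (x i). t \<in> (\<lambda>t. x(i := t)) -` T" by (rule eventually_nhds_in_open)
  then show ?thesis
    by (rule eventually_mono) (use assms T in \<open>auto simp: topspace_Euclidean_space\<close>)
qed

lemma has_partial_derivative_cong:
  assumes "eopen n U" "x \<in> U" "i < n" "\<And>y. y \<in> U \<Longrightarrow> f y = g y"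
  shows "((\<lambda>t. f (x(i := t))) has_real_derivative d) (at (x i)) \<longleftrightarrow>
    ((\<lambda>t. g (x(i := t))) has_real_derivative d) (at (x i))"
  by (rule DERIV_cong_ev[OF refl _ refl])
    (use eopen_eventually_fun_upd[OF assms(1-3)] assms(4) in \<open>auto elim: eventually_mono\<close>)

(* Unfolding this equation would introduce an existential quantifier over families of functions;
   the introduction and elimination rules below treat the family explicitly. *)
declare Ck.simps(2) [simp del]

lemma Ck_SucI:
  assumes "continuous_map (subtopology (Euclidean_space n) U) euclideanreal f"
    and "\<And>i x. i < n \<Longrightarrow> x \<in> U \<Longrightarrow> ((\<lambda>t. f (x(i := t))) has_real_derivative f' i x) (at (x i))"
    and "\<And>i. i < n \<Longrightarrow> Ck k n U (f' i)"
  shows "Ck (Suc k) n U f"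
  unfolding Ck.simps by (intro conjI exI[of _ f'] allI impI ballI assms)

lemma Ck_SucE:
  assumes "Ck (Suc k) n U f"
  obtains f' where "continuous_map (subtopology (Euclidean_space n) U) euclideanreal f"
    "\<And>i x. i < n \<Longrightarrow> x \<in> U \<Longrightarrow> ((\<lambda>t. f (x(i := t))) has_real_derivative f' i x) (at (x i))"
    "\<And>i. i < n \<Longrightarrow> Ck k n U (f' i)"
  using assms unfolding Ck.simps by blast

lemma Ck_continuous_map:
  "Ck k n U f \<Longrightarrow> continuous_map (subtopology (Euclidean_space n) U) euclideanreal f"
  by (cases k) (simp_all add: Ck.simps(2))

lemma Ck_continuous_on: "eopen n U \<Longrightarrow> Ck k n U f \<Longrightarrow> continuous_on U f"
  using Ck_continuous_map continuous_map_euclid_iff[OF eopen_subset] by blast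

lemma tendsto_coordinatewise:
  fixes f :: "'b \<Rightarrow> 'i \<Rightarrow> 'a::topological_space"
  shows "(\<And>i. ((\<lambda>x. f x i) \<longlongrightarrow> l i) F) \<Longrightarrow> (f \<longlongrightarrow> l) F"
  using limitin_componentwise[of "\<lambda>_. euclidean" UNIV f l F] by (simp add: euclidean_product_topology)

lemma Ck_cong:
  assumes "eopen n U" "\<And>x. x \<in> U \<Longrightarrow> f x = g x" "Ck k n U f"
  shows "Ck k n U g"
proof (cases k)
  case 0
  then show ?thesis
    using assms(2,3) by (simp add: continuous_map_euclid_iff[OF eopen_subset[OF assms(1)]] cong: continuous_on_cong)
next
  case (Suc l)
  from assms(3)[unfolded Suc] obtain f' where f':
    "\<And>i x. i < n \<Longrightarrow> x \<in> U \<Longrightarrow> ((\<lambda>t. f (x(i := t))) has_real_derivative f' i x) (at (x i))"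
    "\<And>i. i < n \<Longrightarrow> Ck l n U (f' i)" by (rule Ck_SucE) blast
  have "continuous_map (subtopology (Euclidean_space n) U) euclideanreal g"
    using assms(2) Ck_continuous_on[OF assms(1,3)]
    by (simp add: continuous_map_euclid_iff[OF eopen_subset[OF assms(1)]] cong: continuous_on_cong)
  then show ?thesis
    unfolding Suc
  proof (rule Ck_SucI)
    fix i x assume ix: "i < n" "x \<in> U"
    show "((\<lambda>t. g (x(i := t))) has_real_derivative f' i x) (at (x i))"
      using f'(1)[OF ix] has_partial_derivative_cong[OF assms(1) ix(2,1), of f g] assms(2) by blast
  qed (rule f'(2))
qed

definition partial_deriv :: "nat \<Rightarrow> ((nat \<Rightarrow> real) \<Rightarrow> real) \<Rightarrow> (nat \<Rightarrow> real) \<Rightarrow> real" where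
  "partial_deriv i f x = deriv (\<lambda>t. f (x(i := t))) (x i)"

text \<open>
  On an open set the partial derivatives are unique, so the existential quantifier in the definition
  of \<^const>\<open>Ck\<close> can be replaced by the canonical choice. Locality of \<^const>\<open>Ck\<close> depends on this: local
  witnesses could not be patched otherwise.
\<close>

lemma Ck_Suc_iff:
  assumes "eopen n U"
  shows "Ck (Suc k) n U f \<longleftrightarrow> continuous_on U f \<and>
    (\<forall>i<n. (\<forall>x\<in>U. ((\<lambda>t. f (x(i := t))) has_real_derivative partial_deriv i f x) (at (x i))) \<and> Ck k n U (partial_deriv i f))"
    (is "?L \<longleftrightarrow> ?R")
proof
  assume L: ?L
  then obtain f' where f': "\<And>i x. i < n \<Longrightarrow> x \<in> U \<Longrightarrow> ((\<lambda>t. f (x(i := t))) has_real_derivative f' i x) (at (x i))"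
    "\<And>i. i < n \<Longrightarrow> Ck k n U (f' i)" by (rule Ck_SucE) blast
  have eq: "f' i x = partial_deriv i f x" if "i < n" "x \<in> U" for i x
    unfolding partial_deriv_def using f'(1)[OF that] by (rule DERIV_imp_deriv[symmetric])
  show ?R
    using f'(1) eq Ck_cong[OF assms eq f'(2)] Ck_continuous_on[OF assms L] by simp
next
  assume ?R
  then show ?L using continuous_map_euclid_iff[OF eopen_subset[OF assms]] by (intro Ck_SucI) blast+
qed

lemma Ck_Suc_imp_Ck: "Ck (Suc k) n U f \<Longrightarrow> Ck k n U f"
proof (induction k arbitrary: f)
  case (Suc k)
  from Suc.prems show ?case
    by (rule Ck_SucE) (rule Ck_SucI, assumption, blast, rule Suc.IH)
qed (simp add: Ck_continuous_map)

text \<open>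
  Continuity of the restriction to a relatively open set is continuity within the whole space; this
  makes the regularity classes local.
\<close>

lemma continuous_at_within_eopen:
  assumes "eopen n W" "x \<in> W" "continuous_on W f"
  shows "continuous (at x within euclid n) f"
proof -
  obtain T where T: "open T" "W = euclid n \<inter> T" using assms(1) by (auto simp: eopen_iff)
  have "at x within W = at x within euclid n"
    by (rule at_within_nhd[OF _ T(1)]) (use assms(2) T in auto)
  then show ?thesis
    using assms(2,3) by (auto simp: continuous_on_eq_continuous_within continuous_within)
qed

lemma Ck_local:
  assumes "eopen n U" "\<And>x. x \<in> U \<Longrightarrow> \<exists>W. eopen n W \<and> x \<in> W \<and> Ck k n W f"
  shows "Ck k n U f"
  using assms(2)
proof (induction k arbitrary: f)
  case 0
  have "continuous (at x within U) f" if x: "x \<in> U" for x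
  proof -
    obtain W where W: "eopen n W" "x \<in> W" "Ck 0 n W f" using 0 x by blast
    show ?thesis using continuous_at_within_eopen[OF W(1,2) Ck_continuous_on[OF W(1,3)]]
      by (rule continuous_within_subset) (rule eopen_subset[OF assms(1)])
  qed
  then show ?case
    using continuous_map_euclid_iff[OF eopen_subset[OF assms(1)]] by (simp add: continuous_on_eq_continuous_within)
next
  case (Suc k)
  have pd: "((\<lambda>t. f (x(i := t))) has_real_derivative partial_deriv i f x) (at (x i))"
    if i: "i < n" and x: "x \<in> U" for i x
  proof -
    obtain W where W: "eopen n W" "x \<in> W" "Ck (Suc k) n W f" using Suc.prems[OF x] by blast
    then show ?thesis using i by (simp add: Ck_Suc_iff[OF W(1)])
  qed
  moreover have "Ck k n U (partial_deriv i f)" if "i < n" for i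
  proof (rule Suc.IH)
    fix x assume "x \<in> U"
    then obtain W where W: "eopen n W" "x \<in> W" "Ck (Suc k) n W f" using Suc.prems by blast
    then have "Ck k n W (partial_deriv i f)" using that by (simp add: Ck_Suc_iff[OF W(1)])
    then show "\<exists>W. eopen n W \<and> x \<in> W \<and> Ck k n W (partial_deriv i f)" using W by blast
  qed
  moreover have "continuous_on U f"
  proof -
    have "continuous (at x within U) f" if x: "x \<in> U" for x
    proof -
      obtain W where W: "eopen n W" "x \<in> W" "Ck (Suc k) n W f" using Suc.prems x by blast
      show ?thesis using continuous_at_within_eopen[OF W(1,2) Ck_continuous_on[OF W(1,3)]]
        by (rule continuous_within_subset) (rule eopen_subset[OF assms(1)])
    qed
    then show ?thesis by (simp add: continuous_on_eq_continuous_within)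
  qed
  ultimately show ?case by (simp add: Ck_Suc_iff[OF assms(1)])
qed

lemma Ck_const: "Ck k n U (\<lambda>_. c)"
proof (induction k arbitrary: c)
  case (Suc k)
  show ?case by (rule Ck_SucI[where f' = "\<lambda>_ _. 0"]) (auto intro: Suc.IH)
qed simp

lemma Ck_proj: "Ck k n U (\<lambda>x. x i)"
proof -
  have c: "continuous_map (subtopology (Euclidean_space n) U) euclideanreal (\<lambda>x. x i)"
    unfolding Euclidean_space_def subtopology_subtopology
    by (intro continuous_map_from_subtopology continuous_map_product_projection) simp
  show ?thesis
  proof (cases k)
    case (Suc l)
    have "((\<lambda>t. (x(m := t)) i) has_real_derivative (if m = i then 1 else 0)) (at (x m))"
      for x :: "nat \<Rightarrow> real" and m
      by (cases "m = i") auto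
    then show ?thesis unfolding Suc
      by (intro Ck_SucI[where f' = "\<lambda>m _. if m = i then 1 else 0"] c Ck_const)
  qed (use c in simp)
qed

lemma Ck_add: "Ck k n U f \<Longrightarrow> Ck k n U g \<Longrightarrow> Ck k n U (\<lambda>x. f x + g x)"
proof (induction k arbitrary: f g)
  case 0
  then show ?case by (auto intro: continuous_map_add)
next
  case (Suc k)
  obtain f' where f: "continuous_map (subtopology (Euclidean_space n) U) euclideanreal f"
    "\<And>i x. i < n \<Longrightarrow> x \<in> U \<Longrightarrow> ((\<lambda>t. f (x(i := t))) has_real_derivative f' i x) (at (x i))"
    "\<And>i. i < n \<Longrightarrow> Ck k n U (f' i)" using Suc.prems(1) by (rule Ck_SucE) blast
  obtain g' where g: "continuous_map (subtopology (Euclidean_space n) U) euclideanreal g"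
    "\<And>i x. i < n \<Longrightarrow> x \<in> U \<Longrightarrow> ((\<lambda>t. g (x(i := t))) has_real_derivative g' i x) (at (x i))"
    "\<And>i. i < n \<Longrightarrow> Ck k n U (g' i)" using Suc.prems(2) by (rule Ck_SucE) blast
  show ?case
    by (rule Ck_SucI[where f' = "\<lambda>i x. f' i x + g' i x"])
      (intro continuous_map_add DERIV_add Suc.IH f g; assumption)+
qed

lemma Ck_mult: "Ck k n U f \<Longrightarrow> Ck k n U g \<Longrightarrow> Ck k n U (\<lambda>x. f x * g x)"
proof (induction k arbitrary: f g)
  case 0
  then show ?case by (auto intro: continuous_map_real_mult)
next
  case (Suc k)
  obtain f' where f: "continuous_map (subtopology (Euclidean_space n) U) euclideanreal f"
    "\<And>i x. i < n \<Longrightarrow> x \<in> U \<Longrightarrow> ((\<lambda>t. f (x(i := t))) has_real_derivative f' i x) (at (x i))"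
    "\<And>i. i < n \<Longrightarrow> Ck k n U (f' i)" using Suc.prems(1) by (rule Ck_SucE) blast
  obtain g' where g: "continuous_map (subtopology (Euclidean_space n) U) euclideanreal g"
    "\<And>i x. i < n \<Longrightarrow> x \<in> U \<Longrightarrow> ((\<lambda>t. g (x(i := t))) has_real_derivative g' i x) (at (x i))"
    "\<And>i. i < n \<Longrightarrow> Ck k n U (g' i)" using Suc.prems(2) by (rule Ck_SucE) blast
  show ?case
  proof (rule Ck_SucI[where f' = "\<lambda>i x. f' i x * g x + g' i x * f x"])
    show "continuous_map (subtopology (Euclidean_space n) U) euclideanreal (\<lambda>x. f x * g x)"
      using f(1) g(1) by (rule continuous_map_real_mult)
    show "((\<lambda>t. f (x(i := t)) * g (x(i := t))) has_real_derivative f' i x * g x + g' i x * f x) (at (x i))"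
      if "i < n" "x \<in> U" for i x
      using DERIV_mult[OF f(2) g(2), OF that that] by simp
    show "Ck k n U (\<lambda>x. f' i x * g x + g' i x * f x)" if "i < n" for i
      by (intro Ck_add Suc.IH f g that Suc.prems[THEN Ck_Suc_imp_Ck])
  qed
qed

lemma Ck_sum: "(\<And>l. l \<in> L \<Longrightarrow> Ck k n U (f l)) \<Longrightarrow> Ck k n U (\<lambda>x. \<Sum>l\<in>L. f l x)"
  by (induction L rule: infinite_finite_induct) (simp_all add: Ck_const Ck_add)

text \<open>
  The derivatives of \<open>t powr r\<close> and of \<open>exp (- 1 / t)\<close> stay, up to constant coefficients, in a
  sequence of functions; for such sequences the one-variable chain rule can be iterated without
  forming the higher derivatives.
\<close>

lemma Ck_compose_sequence:
  assumes G: "\<And>m t. t \<in> S \<Longrightarrow> (G m has_real_derivative a m * G (m + 1) t + b m * G (m + 2) t) (at t)"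
    and U: "eopen n U" and f: "Ck k n U f" "f \<in> U \<rightarrow> S"
  shows "Ck k n U (\<lambda>x. G m (f x))"
  using f(1)
proof (induction k arbitrary: m)
  case 0
  have "continuous_on S (G m)" by (rule DERIV_continuous_on) (rule has_field_derivative_at_within[OF G])
  then have "continuous_on U (\<lambda>x. G m (f x))"
    by (rule continuous_on_compose2[OF _ Ck_continuous_on[OF U 0]]) (use f(2) in auto)
  then show ?case by (simp add: continuous_map_euclid_iff[OF eopen_subset[OF U]])
next
  case (Suc k)
  let ?d = "\<lambda>i x. (a m * G (m + 1) (f x) + b m * G (m + 2) (f x)) * partial_deriv i f x"
  have "continuous_on S (G m)" by (rule DERIV_continuous_on) (rule has_field_derivative_at_within[OF G])
  then have c: "continuous_on U (\<lambda>x. G m (f x))"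
    by (rule continuous_on_compose2[OF _ Ck_continuous_on[OF U Suc.prems]]) (use f(2) in auto)
  have pd: "((\<lambda>t. f (x(i := t))) has_real_derivative partial_deriv i f x) (at (x i))"
    if "i < n" "x \<in> U" for i x
    using Suc.prems that by (simp add: Ck_Suc_iff[OF U])
  have pd2: "Ck k n U (partial_deriv i f)" if "i < n" for i
    using Suc.prems that by (simp add: Ck_Suc_iff[OF U])
  have d: "((\<lambda>t. G m (f (x(i := t)))) has_real_derivative ?d i x) (at (x i))" if "i < n" "x \<in> U" for i x
    by (rule DERIV_chain2[OF _ pd[OF that]]) (use G f(2) that in auto)
  have c': "continuous_map (subtopology (Euclidean_space n) U) euclideanreal (\<lambda>x. G m (f x))"
    using c by (simp add: continuous_map_euclid_iff[OF eopen_subset[OF U]])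
  show ?case
  proof (rule Ck_SucI[where f' = ?d, OF c' d])
    fix i assume "i < n"
    then show "Ck k n U (?d i)"
      by (intro Ck_mult Ck_add Ck_const Suc.IH Ck_Suc_imp_Ck[OF Suc.prems] pd2)
  qed assumption+
qed

text \<open>
  All coordinates from \<open>n\<close> on vanish identically on \<^term>\<open>euclid n\<close>, so convergence there is convergence
  of the first \<open>n\<close> coordinates, and boxes in these form a neighbourhood basis.
\<close>

lemma eopen_box:
  assumes "eopen n U" "a \<in> U"
  obtains d where "d > 0" "\<And>y. y \<in> euclid n \<Longrightarrow> (\<And>l. l < n \<Longrightarrow> \<bar>y l - a l\<bar> < d) \<Longrightarrow> y \<in> U"
proof (rule ccontr)
  assume neg: "\<not> thesis"
  obtain T where T: "open T" "U = euclid n \<inter> T" using assms(1) by (auto simp: eopen_iff)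
  have "\<exists>y. y \<in> euclid n \<and> (\<forall>l<n. \<bar>y l - a l\<bar> < inverse (real (Suc k))) \<and> y \<notin> U" for k
    using neg that[of "inverse (real (Suc k))"] by fastforce
  then obtain y where y: "\<And>k. y k \<in> euclid n" "\<And>k l. l < n \<Longrightarrow> \<bar>y k l - a l\<bar> < inverse (real (Suc k))"
    "\<And>k. y k \<notin> U" by metis
  have "(\<lambda>k. y k l) \<longlonglongrightarrow> a l" for l
  proof (cases "l < n")
    case True
    then have "eventually (\<lambda>k. \<bar>y k l - a l\<bar> \<le> inverse (real (Suc k))) sequentially"
      using y(2) by (simp add: less_imp_le)
    then have "eventually (\<lambda>k. norm (y k l - a l) \<le> inverse (real (Suc k))) sequentially" by simp
    from LIM_zero_cancel[OF Lim_null_comparison[OF this LIMSEQ_inverse_real_of_nat]] show ?thesis .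
  next
    case False
    then have "y k l = a l" for k using y(1) assms(2) T(2) by (simp add: topspace_Euclidean_space)
    then show ?thesis by simp
  qed
  then have "y \<longlonglongrightarrow> a" by (rule tendsto_coordinatewise)
  then have "eventually (\<lambda>k. y k \<in> T) sequentially"
    using T assms(2) by (intro topological_tendstoD) auto
  then obtain k where "y k \<in> T" by (meson eventually_happens sequentially_bot)
  then show False using y(1,3) T(2) by blast
qed

text \<open>
  The chain rule along a curve \<open>\<gamma>\<close>: the increment of \<open>f\<close> is split into increments along the
  coordinates, to each of which the mean value theorem applies.
\<close>

lemma chain_rule_curve:
  fixes \<gamma> :: "real \<Rightarrow> nat \<Rightarrow> real"
  assumes U: "eopen n U" and f: "Ck (Suc 0) n U f"
    and \<gamma>U: "\<forall>\<^sub>F t in nhds t0. \<gamma> t \<in> U"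
    and \<gamma>: "\<And>l. l < n \<Longrightarrow> ((\<lambda>t. \<gamma> t l) has_real_derivative d l) (at t0)"
  shows "((\<lambda>t. f (\<gamma> t)) has_real_derivative (\<Sum>l<n. partial_deriv l f (\<gamma> t0) * d l)) (at t0)"
proof -
  define a where "a = \<gamma> t0"
  have aU: "a \<in> U" unfolding a_def using \<gamma>U by (rule eventually_nhds_x_imp_x)
  then have aE: "a l = 0" if "l \<ge> n" for l
    using eopen_subset[OF U] that by (auto simp: topspace_Euclidean_space)
  have pd: "((\<lambda>t. f (x(i := t))) has_real_derivative partial_deriv i f x) (at (x i))"
    "continuous_on U (partial_deriv i f)" if "i < n" "x \<in> U" for i x
    using f that by (auto simp: Ck_Suc_iff[OF U] continuous_map_euclid_iff[OF eopen_subset[OF U]])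
  obtain r where r: "r > 0" "\<And>y. y \<in> euclid n \<Longrightarrow> (\<And>l. l < n \<Longrightarrow> \<bar>y l - a l\<bar> < r) \<Longrightarrow> y \<in> U"
    using eopen_box[OF U aU] by blast
  have \<gamma>_lim: "((\<lambda>t. \<gamma> t l) \<longlongrightarrow> a l) (at t0)" if "l < n" for l
    using DERIV_isCont[OF \<gamma>[OF that]] by (simp add: isCont_def a_def)
  have near: "\<forall>\<^sub>F t in at t0. \<forall>l\<in>{..<n}. \<bar>\<gamma> t l - a l\<bar> < r"
    using tendstoD[OF \<gamma>_lim r(1)] by (intro eventually_ball_finite) (auto simp: dist_real_def)
  \<comment> \<open>\<open>mix l t\<close> has already moved from \<open>a\<close> to \<open>\<gamma> t\<close> in its first \<open>l\<close> coordinates.\<close>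
  define mix where "mix l t = (\<lambda>k. if k < l then \<gamma> t k else a k)" for l t
  have step: "\<exists>s. \<bar>s - a l\<bar> \<le> \<bar>\<gamma> t l - a l\<bar> \<and>
      f (mix (Suc l) t) - f (mix l t) = partial_deriv l f ((mix l t)(l := s)) * (\<gamma> t l - a l)"
    if l: "l < n" and t: "\<forall>l\<in>{..<n}. \<bar>\<gamma> t l - a l\<bar> < r" for l t
  proof -
    define g where "g s = f ((mix l t)(l := s))" for s
    have inU: "(mix l t)(l := s) \<in> U" if "\<bar>s - a l\<bar> \<le> \<bar>\<gamma> t l - a l\<bar>" for s
      using t l that r(1) by (intro r(2)) (fastforce simp: mix_def topspace_Euclidean_space aE)+
    have der: "(g has_real_derivative partial_deriv l f ((mix l t)(l := s))) (at s)"
      if "\<bar>s - a l\<bar> \<le> \<bar>\<gamma> t l - a l\<bar>" for s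
      using pd(1)[OF l inU[OF that]] by (simp add: g_def[abs_def])
    have "f (mix (Suc l) t) = g (\<gamma> t l)" "f (mix l t) = g (a l)"
      by (auto simp: g_def mix_def fun_eq_iff intro!: arg_cong[of _ _ f])
    moreover have "\<exists>s. \<bar>s - a l\<bar> \<le> \<bar>\<gamma> t l - a l\<bar> \<and>
        g (\<gamma> t l) - g (a l) = partial_deriv l f ((mix l t)(l := s)) * (\<gamma> t l - a l)"
    proof (cases "\<gamma> t l" "a l" rule: linorder_cases)
      case less
      obtain z where "\<gamma> t l < z" "z < a l"
        "g (a l) - g (\<gamma> t l) = (a l - \<gamma> t l) * partial_deriv l f ((mix l t)(l := z))"
        using MVT2[OF less, of g "\<lambda>s. partial_deriv l f ((mix l t)(l := s))"] der by (force simp: less)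
      then show ?thesis by (intro exI[of _ z]) (auto simp: algebra_simps)
    next
      case greater
      obtain z where "a l < z" "z < \<gamma> t l"
        "g (\<gamma> t l) - g (a l) = (\<gamma> t l - a l) * partial_deriv l f ((mix l t)(l := z))"
        using MVT2[OF greater, of g "\<lambda>s. partial_deriv l f ((mix l t)(l := s))"] der by (force simp: greater)
      then show ?thesis by (intro exI[of _ z]) (auto simp: algebra_simps)
    qed auto
    ultimately show ?thesis by simp
  qed
  have main: "((\<lambda>t. f (mix l t)) has_real_derivative (\<Sum>k<l. partial_deriv k f a * d k)) (at t0)" if "l \<le> n" for l
    using that
  proof (induction l)
    case 0
    then show ?case by (simp add: mix_def)
  next
    case (Suc l)
    then have l: "l < n" by simp
    obtain s where s: "\<And>t. \<forall>l\<in>{..<n}. \<bar>\<gamma> t l - a l\<bar> < r \<Longrightarrow> \<bar>s t - a l\<bar> \<le> \<bar>\<gamma> t l - a l\<bar>"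
      "\<And>t. \<forall>l\<in>{..<n}. \<bar>\<gamma> t l - a l\<bar> < r \<Longrightarrow>
        f (mix (Suc l) t) - f (mix l t) = partial_deriv l f ((mix l t)(l := s t)) * (\<gamma> t l - a l)"
      using step[OF l] by metis
    define y where "y t = (mix l t)(l := s t)" for t
    have lim0: "((\<lambda>t. \<gamma> t l - a l) \<longlongrightarrow> 0) (at t0)"
      using \<gamma>_lim[OF l] by (simp add: LIM_zero)
    have "\<forall>\<^sub>F t in at t0. norm (s t - a l) \<le> \<bar>\<gamma> t l - a l\<bar>"
      using near s(1) by (auto elim: eventually_mono)
    then have "((\<lambda>t. s t - a l) \<longlongrightarrow> 0) (at t0)"
      by (rule Lim_null_comparison[OF _ tendsto_rabs_zero[OF lim0]])
    then have s_lim: "(s \<longlongrightarrow> a l) (at t0)" by (rule LIM_zero_cancel)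
    have "((\<lambda>t. y t k) \<longlongrightarrow> a k) (at t0)" for k
      using s_lim \<gamma>_lim l by (cases k l rule: linorder_cases) (auto simp: y_def mix_def)
    then have y_lim: "(y \<longlongrightarrow> a) (at t0)"
      by (rule tendsto_coordinatewise)
    have yU: "\<forall>\<^sub>F t in at t0. y t \<in> U"
      using near
    proof (rule eventually_mono)
      fix t assume t: "\<forall>l\<in>{..<n}. \<bar>\<gamma> t l - a l\<bar> < r"
      then have "\<bar>\<gamma> t l - a l\<bar> < r" using l by simp
      then have "\<bar>s t - a l\<bar> < r" using s(1)[OF t] by linarith
      then show "y t \<in> U"
        using t l r(1) by (intro r(2)) (auto simp: y_def mix_def topspace_Euclidean_space aE)
    qed
    have lim1: "((\<lambda>t. partial_deriv l f (y t)) \<longlongrightarrow> partial_deriv l f a) (at t0)"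
      by (rule continuous_on_tendsto_compose[OF pd(2)[OF l aU] y_lim aU yU])
    have "((\<lambda>t. (\<gamma> t l - a l) / (t - t0)) \<longlongrightarrow> d l) (at t0)"
      using \<gamma>[OF l] by (simp add: has_field_derivative_iff a_def)
    from tendsto_mult[OF lim1 this]
    have "((\<lambda>t. partial_deriv l f (y t) * ((\<gamma> t l - a l) / (t - t0))) \<longlongrightarrow> partial_deriv l f a * d l) (at t0)" .
    then have "((\<lambda>t. (f (mix (Suc l) t) - f (mix l t)) / (t - t0)) \<longlongrightarrow> partial_deriv l f a * d l) (at t0)"
      by (rule Lim_transform_eventually) (use near in \<open>auto elim!: eventually_mono simp: s(2) y_def\<close>)
    moreover have "f (mix (Suc l) t0) - f (mix l t0) = 0"
      by (simp add: mix_def a_def cong: if_cong)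
    ultimately have "((\<lambda>t. f (mix (Suc l) t) - f (mix l t)) has_real_derivative partial_deriv l f a * d l) (at t0)"
      by (simp add: has_field_derivative_iff)
    from DERIV_add[OF this Suc.IH] show ?case using l by (simp add: add.commute)
  qed
  have "\<forall>\<^sub>F t in nhds t0. f (mix n t) = f (\<gamma> t)"
    using \<gamma>U
  proof (rule eventually_mono)
    fix t assume "\<gamma> t \<in> U"
    then have "\<gamma> t \<in> euclid n" using eopen_subset[OF U] by blast
    then have "mix n t = \<gamma> t" by (auto simp: mix_def fun_eq_iff topspace_Euclidean_space aE)
    then show "f (mix n t) = f (\<gamma> t)" by simp
  qed
  from DERIV_cong_ev[OF refl this refl] main[of n] show ?thesis by (simp add: a_def)
qed

text \<open>
  The derivative of the composite is \<open>\<Sum>l. (\<partial>\<^sub>l f \<circ> \<phi>) \<cdot> \<partial>\<^sub>i \<phi>\<^sub>l\<close>, whose first factors are of the same shape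
  with one derivative less; hence the induction on \<open>k\<close> for all \<open>f\<close> at once.
\<close>

lemma Ck_compose:
  assumes U: "eopen n U" and V: "eopen m V" and \<phi>: "\<phi> \<in> V \<rightarrow> U"
    and f: "Ck k n U f" and \<phi>k: "\<And>l. l < n \<Longrightarrow> Ck k m V (\<lambda>x. \<phi> x l)"
  shows "Ck k m V (\<lambda>x. f (\<phi> x))"
proof -
  have cont: "continuous_map (subtopology (Euclidean_space m) V) euclideanreal (\<lambda>x. f (\<phi> x))"
    if f: "Ck k n U f" and \<phi>k: "\<And>l. l < n \<Longrightarrow> Ck k m V (\<lambda>x. \<phi> x l)" for f k
  proof -
    have "continuous_on V (\<lambda>x. \<phi> x l)" for l
    proof (cases "l < n")
      case False
      then have "\<phi> x l = 0" if "x \<in> V" for x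
        using that \<phi> eopen_subset[OF U] by (auto simp: topspace_Euclidean_space)
      then show ?thesis by (simp cong: continuous_on_cong)
    qed (rule Ck_continuous_on[OF V \<phi>k])
    then have "continuous_on V \<phi>" by (rule continuous_on_coordinatewise_then_product)
    then have "continuous_on V (\<lambda>x. f (\<phi> x))"
      by (rule continuous_on_compose2[OF Ck_continuous_on[OF U f]]) (use \<phi> in auto)
    then show ?thesis by (simp add: continuous_map_euclid_iff[OF eopen_subset[OF V]])
  qed
  show ?thesis
    using f \<phi>k
  proof (induction k arbitrary: f)
    case 0
    show ?case using cont[OF 0] by simp
  next
    case (Suc k)
    have \<phi>d: "((\<lambda>t. \<phi> (x(i := t)) l) has_real_derivative partial_deriv i (\<lambda>x. \<phi> x l) x) (at (x i))"
      if "i < m" "l < n" "x \<in> V" for i l x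
      using Suc.prems(2)[OF that(2)] that by (simp add: Ck_Suc_iff[OF V])
    have \<phi>d2: "Ck k m V (partial_deriv i (\<lambda>x. \<phi> x l))" if "i < m" "l < n" for i l
      using Suc.prems(2)[OF that(2)] that by (simp add: Ck_Suc_iff[OF V])
    have fd2: "Ck k n U (partial_deriv l f)" if "l < n" for l
      using Suc.prems(1) that by (simp add: Ck_Suc_iff[OF U])
    have f1: "Ck (Suc 0) n U f" using Suc.prems(1)
    proof (induction k)
      case (Suc k)
      then show ?case using Ck_Suc_imp_Ck by blast
    qed simp
    show ?case
    proof (rule Ck_SucI[where f' = "\<lambda>i x. \<Sum>l<n. partial_deriv l f (\<phi> x) * partial_deriv i (\<lambda>x. \<phi> x l) x"])
      show "continuous_map (subtopology (Euclidean_space m) V) euclideanreal (\<lambda>x. f (\<phi> x))"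
        using Suc.prems by (rule cont)
      show "((\<lambda>t. f (\<phi> (x(i := t)))) has_real_derivative
          (\<Sum>l<n. partial_deriv l f (\<phi> x) * partial_deriv i (\<lambda>x. \<phi> x l) x)) (at (x i))" if i: "i < m" and x: "x \<in> V" for i x
      proof -
        have "\<forall>\<^sub>F t in nhds (x i). \<phi> (x(i := t)) \<in> U"
          using eopen_eventually_fun_upd[OF V x i] by (rule eventually_mono) (use \<phi> in auto)
        from chain_rule_curve[OF U f1 this \<phi>d[OF i _ x]] show ?thesis by simp
      qed
      show "Ck k m V (\<lambda>x. \<Sum>l<n. partial_deriv l f (\<phi> x) * partial_deriv i (\<lambda>x. \<phi> x l) x)" if i: "i < m" for i
      proof (intro Ck_sum Ck_mult)
        fix l assume l: "l \<in> {..<n}"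
        show "Ck k m V (\<lambda>x. partial_deriv l f (\<phi> x))"
          by (rule Suc.IH[OF fd2 Ck_Suc_imp_Ck[OF Suc.prems(2)]]) (use l in auto)
        show "Ck k m V (partial_deriv i (\<lambda>x. \<phi> x l))" using \<phi>d2 i l by simp
      qed
    qed
  qed
qed

subsection \<open>Smooth functions\<close>

lemma smooth_fun_continuous_on: "eopen n U \<Longrightarrow> smooth_fun n U f \<Longrightarrow> continuous_on U f"
  unfolding smooth_fun_def by (rule Ck_continuous_on) auto

lemma smooth_fun_cong:
  "eopen n U \<Longrightarrow> (\<And>x. x \<in> U \<Longrightarrow> f x = g x) \<Longrightarrow> smooth_fun n U f \<longleftrightarrow> smooth_fun n U g"
  unfolding smooth_fun_def using Ck_cong by metis

lemma smooth_fun_local: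
  assumes "eopen n U" "\<And>x. x \<in> U \<Longrightarrow> \<exists>W. eopen n W \<and> x \<in> W \<and> smooth_fun n W f"
  shows "smooth_fun n U f"
  unfolding smooth_fun_def
proof
  fix k
  show "Ck k n U f"
  proof (rule Ck_local[OF assms(1)])
    fix x assume "x \<in> U"
    from assms(2)[OF this] show "\<exists>W. eopen n W \<and> x \<in> W \<and> Ck k n W f"
      by (elim ex_forward) (simp add: smooth_fun_def)
  qed
qed

lemma smooth_fun_subset: "smooth_fun n U f \<Longrightarrow> W \<subseteq> U \<Longrightarrow> smooth_fun n W f"
  unfolding smooth_fun_def using Ck_subset by blast

named_theorems smooth_intros

lemma smooth_fun_const [smooth_intros]: "smooth_fun n U (\<lambda>_. c)"
  by (simp add: smooth_fun_def Ck_const)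

lemma smooth_fun_proj [smooth_intros]: "smooth_fun n U (\<lambda>x. x i)"
  by (simp add: smooth_fun_def Ck_proj)

lemma smooth_fun_add [smooth_intros]:
  "smooth_fun n U f \<Longrightarrow> smooth_fun n U g \<Longrightarrow> smooth_fun n U (\<lambda>x. f x + g x)"
  by (simp add: smooth_fun_def Ck_add)

lemma smooth_fun_mult [smooth_intros]:
  "smooth_fun n U f \<Longrightarrow> smooth_fun n U g \<Longrightarrow> smooth_fun n U (\<lambda>x. f x * g x)"
  by (simp add: smooth_fun_def Ck_mult)

lemma smooth_fun_sum [smooth_intros]:
  "(\<And>l. l \<in> L \<Longrightarrow> smooth_fun n U (f l)) \<Longrightarrow> smooth_fun n U (\<lambda>x. \<Sum>l\<in>L. f l x)"
  by (simp add: smooth_fun_def Ck_sum)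

lemma smooth_fun_diff [smooth_intros]:
  assumes "smooth_fun n U f" "smooth_fun n U g"
  shows "smooth_fun n U (\<lambda>x. f x - g x)"
  using smooth_fun_add[OF assms(1) smooth_fun_mult[OF smooth_fun_const[of n U "-1"] assms(2)]] by simp

lemma smooth_fun_power2 [smooth_intros]: "smooth_fun n U f \<Longrightarrow> smooth_fun n U (\<lambda>x. (f x)\<^sup>2)"
  unfolding power2_eq_square by (rule smooth_fun_mult)

lemma smooth_fun_compose:
  assumes "eopen n U" "eopen m V" "\<phi> \<in> V \<rightarrow> U" "smooth_fun n U f"
    and "\<And>l. l < n \<Longrightarrow> smooth_fun m V (\<lambda>x. \<phi> x l)"
  shows "smooth_fun m V (\<lambda>x. f (\<phi> x))"
  using assms(4,5) unfolding smooth_fun_def by (blast intro: Ck_compose[OF assms(1-3)])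

lemma smooth_fun_powr:
  assumes "eopen n U" "smooth_fun n U f" "\<And>x. x \<in> U \<Longrightarrow> f x > 0"
  shows "smooth_fun n U (\<lambda>x. f x powr r)"
proof -
  have "((\<lambda>t. t powr (r - real m)) has_real_derivative
      (r - real m) * t powr (r - real (m + 1)) + 0 * t powr (r - real (m + 2))) (at t)"
    if "t \<in> {0<..}" for m t
  proof -
    have eq: "r - real (m + 1) = r - real m - 1" by simp
    show ?thesis unfolding eq using has_real_derivative_powr[of t "r - real m"] that by simp
  qed
  from Ck_compose_sequence[of "{0<..}" "\<lambda>m t. t powr (r - real m)", OF this assms(1), of _ f 0]
  show ?thesis using assms(2,3) by (auto simp: smooth_fun_def)
qed

text \<open>The standard smooth function that is positive exactly on the positive half line.\<close>

definition flat :: "real \<Rightarrow> real" where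
  "flat t = (if 0 < t then exp (- 1 / t) else 0)"

lemma flat_nonneg: "0 \<le> flat t" and flat_pos_iff: "0 < flat t \<longleftrightarrow> 0 < t"
  and flat_eq_0_iff: "flat t = 0 \<longleftrightarrow> t \<le> 0"
  by (auto simp: flat_def)

text \<open>
  The functions \<open>G m t = exp (- 1 / t) / t ^ m\<close>, extended by \<open>0\<close>, satisfy \<open>G m' = - m G (m + 1) + G (m + 2)\<close>
  also at \<open>0\<close>, since exponentials beat powers.
\<close>

lemma smooth_fun_flat:
  assumes U: "eopen n U" and f: "smooth_fun n U f"
  shows "smooth_fun n U (\<lambda>x. flat (f x))"
proof -
  define G where "G m t = (if 0 < t then exp (- 1 / t) / t ^ m else (0::real))" for m :: nat and t
  have "(G m has_real_derivative - real m * G (m + 1) t + 1 * G (m + 2) t) (at t)" for m t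
  proof (cases t "0::real" rule: linorder_cases)
    case greater
    have "((\<lambda>t. exp (- 1 / t) / t ^ m) has_real_derivative
        - real m * G (m + 1) t + 1 * G (m + 2) t) (at t)"
    proof -
      have e: "((\<lambda>t. exp (- 1 / t)) has_real_derivative exp (- 1 / t) / t\<^sup>2) (at t)"
        using greater by (auto intro!: derivative_eq_intros simp: power2_eq_square)
      have p: "((\<lambda>t. t ^ m) has_real_derivative real m * t ^ (m - 1)) (at t)"
        using DERIV_pow[of m t] by simp
      have "(exp (- 1 / t) / t\<^sup>2 * t ^ m - exp (- 1 / t) * (real m * t ^ (m - 1))) / (t ^ m * t ^ m)
          = - real m * G (m + 1) t + 1 * G (m + 2) t"
        using greater by (cases m) (auto simp: G_def field_simps power2_eq_square)
      then show ?thesis using DERIV_divide[OF e p] greater by simp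
    qed
    moreover have "\<forall>\<^sub>F s in nhds t. G m s = exp (- 1 / s) / s ^ m"
      using eventually_nhds_in_open[of "{0<..}" t] greater by (auto simp: G_def elim!: eventually_mono)
    ultimately show ?thesis using DERIV_cong_ev[OF refl, of "G m" "\<lambda>t. exp (- 1 / t) / t ^ m" t, OF _ refl] by simp
  next
    case less
    have "\<forall>\<^sub>F s in nhds t. G m s = 0"
      using eventually_nhds_in_open[of "{..<0}" t] less by (auto simp: G_def elim!: eventually_mono)
    moreover have "- real m * G (m + 1) t + 1 * G (m + 2) t = 0" using less by (simp add: G_def)
    ultimately show ?thesis using DERIV_cong_ev[OF refl _ refl, of "G m" "\<lambda>_. 0"] by simp
  next
    case equal
    have "((\<lambda>s. G m s / s) \<longlongrightarrow> 0) (at_left 0)"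
      by (rule tendsto_eventually) (auto simp: G_def eventually_at_filter)
    moreover have "((\<lambda>s. G m s / s) \<longlongrightarrow> 0) (at_right 0)"
    proof (rule Lim_transform_eventually)
      show "((\<lambda>s. (inverse s) ^ (m + 1) / exp (inverse s)) \<longlongrightarrow> 0) (at_right (0::real))"
        using tendsto_power_div_exp_0 filterlim_inverse_at_top_right by (rule filterlim_compose)
      show "\<forall>\<^sub>F s in at_right 0. (inverse s) ^ (m + 1) / exp (inverse s) = G m s / s"
        by (auto simp: G_def eventually_at_filter field_simps exp_minus power_divide)
    qed
    ultimately have "((\<lambda>s. G m s / s) \<longlongrightarrow> 0) (at 0)" by (simp add: filterlim_split_at)
    then show ?thesis using equal by (simp add: has_field_derivative_iff G_def)
  qed
  from Ck_compose_sequence[of UNIV G, OF this U, of _ f 0]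
  have "Ck k n U (\<lambda>x. G 0 (f x))" for k using f by (auto simp: smooth_fun_def)
  moreover have "G 0 = flat" by (auto simp: G_def flat_def)
  ultimately show ?thesis by (simp add: smooth_fun_def)
qed

section \<open>Diffeological spaces and their D-topology\<close>

text \<open>
  Stability under reparametrisation is the multivariate chain rule; locality is locality of smoothness.
\<close>

lemma diffeological_euclid_subspace:
  assumes A: "A \<subseteq> euclid n"
  shows "diffeological_space (euclid_subspace n A)"
proof
  fix P m U
  assume P: "P \<in> plots (euclid_subspace n A) m U"
  then show U: "eopen m U" and "P \<in> U \<rightarrow>\<^sub>E points (euclid_subspace n A)"
    by (simp_all add: euclid_subspace_def)
  have Ps: "P \<in> U \<rightarrow>\<^sub>E A" "euclid_smooth m U n P" using P by (simp_all add: euclid_subspace_def)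
  fix k V \<phi>
  assume V: "eopen k V" and \<phi>: "\<phi> \<in> V \<rightarrow> U" and sm: "euclid_smooth k V m \<phi>"
  have "smooth_fun k V (\<lambda>x. compose V P \<phi> x i)" if i: "i < n" for i
  proof -
    have "smooth_fun k V (\<lambda>x. P (\<phi> x) i)"
      by (rule smooth_fun_compose[OF U V \<phi>, of "\<lambda>x. P x i"]) (use Ps sm i in \<open>auto simp: euclid_smooth_def\<close>)
    then show ?thesis by (subst smooth_fun_cong[OF V]) (auto simp: compose_def)
  qed
  moreover have "compose V P \<phi> \<in> V \<rightarrow>\<^sub>E A" using Ps \<phi> by (auto simp: compose_def PiE_iff Pi_iff)
  ultimately show "compose V P \<phi> \<in> plots (euclid_subspace n A) k V"
    using V A by (auto simp: euclid_subspace_def euclid_smooth_def)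
next
  fix m U a
  assume U: "eopen m U" and a: "a \<in> points (euclid_subspace n A)"
  have "smooth_fun m U (\<lambda>x. (\<lambda>x\<in>U. a) x i)" for i
    by (subst smooth_fun_cong[OF U, of _ "\<lambda>_. a i"]) (auto intro: smooth_intros)
  then show "(\<lambda>x\<in>U. a) \<in> plots (euclid_subspace n A) m U"
    using U a A by (auto simp: euclid_subspace_def euclid_smooth_def)
next
  fix P m U \<W>
  assume P: "P \<in> U \<rightarrow>\<^sub>E points (euclid_subspace n A)" and W: "\<And>W. W \<in> \<W> \<Longrightarrow> eopen m W" and UW: "\<Union>\<W> = U"
    and PW: "\<And>W. W \<in> \<W> \<Longrightarrow> restrict P W \<in> plots (euclid_subspace n A) m W"
  have U: "eopen m U" using W UW by blast
  have "smooth_fun m U (\<lambda>x. P x i)" if i: "i < n" for i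
  proof (rule smooth_fun_local[OF U])
    fix x assume "x \<in> U"
    then obtain W where xW: "W \<in> \<W>" "x \<in> W" using UW by blast
    have "smooth_fun m W (\<lambda>x. restrict P W x i)"
      using PW[OF xW(1)] i by (simp add: euclid_subspace_def euclid_smooth_def)
    then have "smooth_fun m W (\<lambda>x. P x i)"
      by (subst (asm) smooth_fun_cong[OF W[OF xW(1)], of _ "\<lambda>x. P x i"]) auto
    then show "\<exists>W. eopen m W \<and> x \<in> W \<and> smooth_fun m W (\<lambda>x. P x i)" using xW W by blast
  qed
  then show "P \<in> plots (euclid_subspace n A) m U"
    using P A U by (auto simp: euclid_subspace_def euclid_smooth_def)
qed

lemma diffeological_real_subspace: "diffeological_space (real_subspace A)"
proof
  fix P m U
  assume P: "P \<in> plots (real_subspace A) m U"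
  then show U: "eopen m U" and "P \<in> U \<rightarrow>\<^sub>E points (real_subspace A)"
    by (simp_all add: real_subspace_def)
  have Ps: "P \<in> U \<rightarrow>\<^sub>E A" "smooth_fun m U P" using P by (simp_all add: real_subspace_def)
  fix k V \<phi>
  assume V: "eopen k V" and \<phi>: "\<phi> \<in> V \<rightarrow> U" and sm: "euclid_smooth k V m \<phi>"
  have "smooth_fun k V (\<lambda>x. P (\<phi> x))"
    by (rule smooth_fun_compose[OF U V \<phi> Ps(2)]) (use sm in \<open>auto simp: euclid_smooth_def\<close>)
  then have "smooth_fun k V (compose V P \<phi>)" by (subst smooth_fun_cong[OF V]) (auto simp: compose_def)
  moreover have "compose V P \<phi> \<in> V \<rightarrow>\<^sub>E A" using Ps \<phi> by (auto simp: compose_def PiE_iff Pi_iff)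
  ultimately show "compose V P \<phi> \<in> plots (real_subspace A) k V"
    using V by (auto simp: real_subspace_def)
next
  fix m U a
  assume U: "eopen m U" and a: "a \<in> points (real_subspace A)"
  have "smooth_fun m U (\<lambda>x\<in>U. a)"
    by (subst smooth_fun_cong[OF U, of _ "\<lambda>_. a"]) (auto intro: smooth_intros)
  then show "(\<lambda>x\<in>U. a) \<in> plots (real_subspace A) m U"
    using U a by (auto simp: real_subspace_def)
next
  fix P m U \<W>
  assume P: "P \<in> U \<rightarrow>\<^sub>E points (real_subspace A)" and W: "\<And>W. W \<in> \<W> \<Longrightarrow> eopen m W" and UW: "\<Union>\<W> = U"
    and PW: "\<And>W. W \<in> \<W> \<Longrightarrow> restrict P W \<in> plots (real_subspace A) m W"
  have U: "eopen m U" using W UW by blast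
  have "smooth_fun m U P"
  proof (rule smooth_fun_local[OF U])
    fix x assume "x \<in> U"
    then obtain W where xW: "W \<in> \<W>" "x \<in> W" using UW by blast
    have "smooth_fun m W (restrict P W)"
      using PW[OF xW(1)] by (simp add: real_subspace_def)
    then have "smooth_fun m W P"
      by (subst (asm) smooth_fun_cong[OF W[OF xW(1)], of _ P]) auto
    then show "\<exists>W. eopen m W \<and> x \<in> W \<and> smooth_fun m W P" using xW W by blast
  qed
  then show "P \<in> plots (real_subspace A) m U"
    using P U by (auto simp: real_subspace_def)
qed

lemma smooth_map_real_iff:
  assumes X: "diffeological_space X"
  shows "smooth_map X (real_subspace A) f \<longleftrightarrow> f \<in> points X \<rightarrow> A \<and>
    (\<forall>n U. \<forall>P\<in>plots X n U. smooth_fun n U (\<lambda>x. f (P x)))"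
proof -
  have "compose U f P \<in> plots (real_subspace A) n U \<longleftrightarrow> smooth_fun n U (\<lambda>x. f (P x))"
    if P: "P \<in> plots X n U" and f: "f \<in> points X \<rightarrow> A" for P n U
  proof -
    have U: "eopen n U" and PU: "P \<in> U \<rightarrow>\<^sub>E points X"
      using diffeological_space.plot_dom[OF X P] diffeological_space.plot_fun[OF X P] .
    have "smooth_fun n U (compose U f P) \<longleftrightarrow> smooth_fun n U (\<lambda>x. f (P x))"
      by (rule smooth_fun_cong[OF U]) (simp add: compose_def)
    moreover have "compose U f P \<in> U \<rightarrow>\<^sub>E A" using PU f by (auto simp: compose_def PiE_iff Pi_iff)
    ultimately show ?thesis using U by (simp add: real_subspace_def)
  qed
  moreover have "points (real_subspace A) = A" by (simp add: real_subspace_def)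
  ultimately show ?thesis unfolding smooth_map_def by metis
qed

lemma smooth_map_euclid_subspace:
  assumes A: "A \<subseteq> W" and W: "eopen n W" and f: "smooth_fun n W f"
  shows "smooth_map (euclid_subspace n A) (real_subspace UNIV) f"
proof -
  have AE: "A \<subseteq> euclid n" using A eopen_subset[OF W] by blast
  have "smooth_fun m U (\<lambda>x. f (P x))" if "P \<in> plots (euclid_subspace n A) m U" for m U P
    by (rule smooth_fun_compose[OF W _ _ f])
      (use that A in \<open>auto simp: euclid_subspace_def euclid_smooth_def PiE_iff\<close>)
  then show ?thesis by (simp add: smooth_map_real_iff[OF diffeological_euclid_subspace[OF AE]])
qed

lemma D_open_vimage:
  assumes f: "smooth_map X Y f" and X: "diffeological_space X" and Y: "diffeological_space Y"
    and A: "openin (D_topology Y) A"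
  shows "openin (D_topology X) {x \<in> points X. f x \<in> A}"
proof -
  have "eopen n {x \<in> U. P x \<in> {x \<in> points X. f x \<in> A}}" if P: "P \<in> plots X n U" for n U P
  proof -
    have "compose U f P \<in> plots Y n U" using f P by (simp add: smooth_map_def)
    then have "eopen n {x \<in> U. compose U f P x \<in> A}" using A by (simp add: openin_D_topology[OF Y])
    moreover have "{x \<in> U. compose U f P x \<in> A} = {x \<in> U. P x \<in> {x \<in> points X. f x \<in> A}}"
      using diffeological_space.plot_fun[OF X P] by (auto simp: compose_def)
    ultimately show ?thesis by simp
  qed
  then show ?thesis by (simp add: openin_D_topology[OF X])
qed

lemma D_open_vimage_plot:
  assumes X: "diffeological_space X" and P: "P \<in> plots X n U" and A: "openin (D_topology X) A"
  shows "eopen n {x \<in> U. P x \<in> A}"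
  using A P by (simp add: openin_D_topology[OF X])

lemma eopen_vimage:
  assumes U: "eopen n U" and f: "continuous_on U f" and T: "open T"
  shows "eopen n {x \<in> U. f x \<in> T}"
proof -
  obtain O' where O: "open O'" "U = euclid n \<inter> O'" using U by (auto simp: eopen_iff)
  obtain T' where T': "open T'" "T' \<inter> U = f -` T \<inter> U"
    using f T by (auto simp: continuous_on_open_invariant)
  have "{x \<in> U. f x \<in> T} = euclid n \<inter> (O' \<inter> T')" using O T' by blast
  then show ?thesis using O T' open_Int eopen_iff by metis
qed

lemma D_open_real_vimage:
  assumes f: "smooth_map X (real_subspace A) f" and X: "diffeological_space X" and T: "open T"
  shows "openin (D_topology X) {x \<in> points X. f x \<in> T}"
proof -
  have "eopen n {x \<in> U. P x \<in> {x \<in> points X. f x \<in> T}}" if P: "P \<in> plots X n U" for n U P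
  proof -
    have U: "eopen n U" and PU: "P \<in> U \<rightarrow>\<^sub>E points X"
      using diffeological_space.plot_dom[OF X P] diffeological_space.plot_fun[OF X P] .
    have "continuous_on U (\<lambda>x. f (P x))"
      using f P by (intro smooth_fun_continuous_on[OF U]) (simp add: smooth_map_real_iff[OF X])
    from eopen_vimage[OF U this T]
    show ?thesis using PU by (simp add: PiE_iff cong: conj_cong Collect_cong)
  qed
  then show ?thesis by (simp add: openin_D_topology[OF X])
qed

text \<open>
  A diffeological Sierpinski space: smooth maps into it are the characteristic functions of D-open
  sets. Through it, the universal properties of pushouts and colimits also construct D-open sets.
\<close>

definition sierpinski_space :: "bool diffeo_space" where
  "sierpinski_space = \<lparr>points = UNIV,
     plots = (\<lambda>n U. {P \<in> U \<rightarrow>\<^sub>E UNIV. eopen n U \<and> eopen n {x \<in> U. P x}})\<rparr>"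

lemma diffeological_sierpinski: "diffeological_space sierpinski_space"
proof
  fix P n U m V \<phi>
  assume P: "P \<in> plots sierpinski_space n U" and V: "eopen m V" and \<phi>: "\<phi> \<in> V \<rightarrow> U"
    and sm: "euclid_smooth m V n \<phi>"
  have "eopen n {x \<in> U. P x}" using P by (simp add: sierpinski_space_def)
  then have "openin (subtopology (Euclidean_space m) V) {x \<in> topspace (subtopology (Euclidean_space m) V). \<phi> x \<in> {x \<in> U. P x}}"
    using euclid_smooth_continuous[OF sm] by (rule openin_continuous_map_preimage[rotated])
  then have "eopen m {x \<in> topspace (subtopology (Euclidean_space m) V). \<phi> x \<in> {x \<in> U. P x}}"
    using V openin_trans_full by blast
  moreover have "{x \<in> topspace (subtopology (Euclidean_space m) V). \<phi> x \<in> {x \<in> U. P x}} = {x \<in> V. compose V P \<phi> x}"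
    using \<phi> eopen_subset[OF V] by (auto simp: compose_def)
  moreover have "compose V P \<phi> \<in> V \<rightarrow>\<^sub>E UNIV" by (simp add: compose_def)
  ultimately show "compose V P \<phi> \<in> plots sierpinski_space m V"
    using V by (simp add: sierpinski_space_def)
next
  fix P n U \<W>
  assume P: "P \<in> U \<rightarrow>\<^sub>E points sierpinski_space" and W: "\<And>W. W \<in> \<W> \<Longrightarrow> eopen n W" and U: "\<Union>\<W> = U"
    and PW: "\<And>W. W \<in> \<W> \<Longrightarrow> restrict P W \<in> plots sierpinski_space n W"
  have "{x \<in> U. P x} = (\<Union>W\<in>\<W>. {x \<in> W. restrict P W x})" using U by auto
  moreover have "eopen n (\<Union>W\<in>\<W>. {x \<in> W. restrict P W x})"
    using PW by (intro openin_Union) (auto simp: sierpinski_space_def)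
  moreover have "eopen n U" using W U by blast
  ultimately show "P \<in> plots sierpinski_space n U"
    using P by (simp add: sierpinski_space_def)
next
  fix n U a
  assume U: "eopen n U"
  have "{x \<in> U. (\<lambda>x\<in>U. a) x} = (if a then U else {})" by auto
  then show "(\<lambda>x\<in>U. a) \<in> plots sierpinski_space n U" using U by (simp add: sierpinski_space_def)
qed (auto simp: sierpinski_space_def)

lemma smooth_map_sierpinski_iff:
  assumes X: "diffeological_space X"
  shows "smooth_map X sierpinski_space c \<longleftrightarrow> openin (D_topology X) {x \<in> points X. c x}"
proof -
  have "compose U c P \<in> plots sierpinski_space n U \<longleftrightarrow> eopen n {x \<in> U. P x \<in> {x \<in> points X. c x}}"
    if P: "P \<in> plots X n U" for n U P
  proof -
    have "{x \<in> U. compose U c P x} = {x \<in> U. P x \<in> {x \<in> points X. c x}}"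
      using diffeological_space.plot_fun[OF X P] by (auto simp: compose_def)
    moreover have "compose U c P \<in> U \<rightarrow>\<^sub>E UNIV" by (simp add: compose_def)
    ultimately show ?thesis
      using diffeological_space.plot_dom[OF X P] by (simp add: sierpinski_space_def)
  qed
  then show ?thesis
    by (auto simp: smooth_map_def openin_D_topology[OF X] sierpinski_space_def)
qed

lemma smooth_map_coproduct:
  assumes Z: "diffeological_space Z" and f: "\<And>i. i \<in> I \<Longrightarrow> smooth_map (F i) Z (\<lambda>x. f (i, x))"
  shows "smooth_map (coproduct I F) Z f"
  unfolding coproduct_def
proof (rule smooth_map_from_locally_in[OF Z])
  show "f \<in> (SIGMA i:I. points (F i)) \<rightarrow> points Z" using f by (fastforce simp: smooth_map_def)
  fix n W Q
  assume "Q \<in> (\<Union>i\<in>I. compose W (Pair i) ` plots (F i) n W)"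
  then obtain i P where i: "i \<in> I" "P \<in> plots (F i) n W" "Q = compose W (Pair i) P" by blast
  have "compose W f Q = compose W (\<lambda>x. f (i, x)) P" by (auto simp: i(3) compose_def)
  then show "compose W f Q \<in> plots Z n W" using f[OF i(1)] i(2) by (simp add: smooth_map_def)
qed

lemma smooth_map_coproduct_injection:
  assumes "diffeological_space (F i)" "i \<in> I"
  shows "smooth_map (F i) (coproduct I F) (Pair i)"
  unfolding coproduct_def using assms by (intro smooth_map_into_locally_in) auto

lemma plots_discrete_space_locally_constant:
  assumes "P \<in> plots (discrete_space S) n U" "x \<in> U"
  obtains W where "eopen n W" "x \<in> W" "W \<subseteq> U" "\<And>y. y \<in> W \<Longrightarrow> P y = P x"
proof -
  obtain W a where W: "eopen n W" "x \<in> W" "W \<subseteq> U" "restrict P W = (\<lambda>x\<in>W. a)"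
    using assms by (auto simp: discrete_space_def locally_in_def)
  have "P y = a" if "y \<in> W" for y using fun_cong[OF W(4), of y] that by simp
  then show thesis using W that by metis
qed

lemma diffeological_discrete_space: "diffeological_space (discrete_space S)"
  unfolding discrete_space_def
proof (rule diffeological_locally_in)
  fix n W Q m V and \<phi> :: "(nat \<Rightarrow> real) \<Rightarrow> nat \<Rightarrow> real"
  assume "Q \<in> {\<lambda>x\<in>W. a | a. a \<in> S}" "\<phi> \<in> V \<rightarrow> W"
  then show "compose V Q \<phi> \<in> {\<lambda>x\<in>V. a | a. a \<in> S}" by (auto simp: compose_def fun_eq_iff Pi_iff)
qed blast

lemma D_open_discrete_space:
  assumes "A \<subseteq> S"
  shows "openin (D_topology (discrete_space S)) A"
proof -
  have "eopen n {x \<in> U. P x \<in> A}" if P: "P \<in> plots (discrete_space S) n U" for n U P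
  proof (rule openin_subopen[THEN iffD2, rule_format])
    fix x assume "x \<in> {x \<in> U. P x \<in> A}"
    then have x: "x \<in> U" "P x \<in> A" by simp_all
    obtain W where W: "eopen n W" "x \<in> W" "W \<subseteq> U" "\<And>y. y \<in> W \<Longrightarrow> P y = P x"
      using plots_discrete_space_locally_constant[OF P x(1)] by blast
    have "W \<subseteq> {x \<in> U. P x \<in> A}"
    proof
      fix y assume y: "y \<in> W"
      then show "y \<in> {x \<in> U. P x \<in> A}" using W(3) W(4)[OF y] x(2) by auto
    qed
    then show "\<exists>T. eopen n T \<and> x \<in> T \<and> T \<subseteq> {x \<in> U. P x \<in> A}" using W(1,2) by blast
  qed
  then show ?thesis using assms
    by (simp add: openin_D_topology[OF diffeological_discrete_space]) (simp add: discrete_space_def locally_in_def)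
qed

lemma smooth_map_discrete_space:
  assumes "f \<in> S \<rightarrow> A"
  shows "smooth_map (discrete_space S) (real_subspace A) f"
  unfolding smooth_map_real_iff[OF diffeological_discrete_space]
proof (intro conjI allI ballI)
  show "f \<in> points (discrete_space S) \<rightarrow> A" using assms by (simp add: discrete_space_def locally_in_def)
  fix n U P
  assume P: "P \<in> plots (discrete_space S) n U"
  show "smooth_fun n U (\<lambda>x. f (P x))"
  proof (rule smooth_fun_local[OF diffeological_space.plot_dom[OF diffeological_discrete_space P]])
    fix x assume "x \<in> U"
    then obtain W where W: "eopen n W" "x \<in> W" "W \<subseteq> U" "\<And>y. y \<in> W \<Longrightarrow> P y = P x"
      using plots_discrete_space_locally_constant[OF P] by blast
    have "smooth_fun n W (\<lambda>y. f (P y))"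
      by (subst smooth_fun_cong[OF W(1), of _ "\<lambda>_. f (P x)"]) (auto simp: W(4) intro: smooth_intros)
    then show "\<exists>W. eopen n W \<and> x \<in> W \<and> smooth_fun n W (\<lambda>x. f (P x))" using W by blast
  qed
qed

section \<open>Spheres and disks\<close>

definition norm2 :: "nat \<Rightarrow> (nat \<Rightarrow> real) \<Rightarrow> real" where
  "norm2 n x = (\<Sum>i<n. (x i)\<^sup>2)"

abbreviation unit_disk :: "nat \<Rightarrow> (nat \<Rightarrow> real) set" where
  "unit_disk n \<equiv> points (disk_space n)"

abbreviation unit_sphere :: "nat \<Rightarrow> (nat \<Rightarrow> real) set" where
  "unit_sphere n \<equiv> points (sphere_space n)"

lemma disk_iff: "x \<in> unit_disk n \<longleftrightarrow> x \<in> euclid n \<and> norm2 n x \<le> 1"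
  by (auto simp: disk_space_def euclid_subspace_def norm2_def)

lemma sphere_iff: "x \<in> unit_sphere n \<longleftrightarrow> x \<in> euclid (Suc n) \<and> norm2 (Suc n) x = 1"
  by (auto simp: sphere_space_def euclid_subspace_def norm2_def nsphere_def lessThan_Suc_atMost)

lemma sphere_subset_disk: "unit_sphere n \<subseteq> unit_disk (Suc n)"
  by (auto simp: sphere_iff disk_iff)

lemma disk_space_eq: "disk_space n = euclid_subspace n (unit_disk n)"
  by (simp add: disk_space_def euclid_subspace_def)

lemma sphere_space_eq: "sphere_space n = euclid_subspace (Suc n) (unit_sphere n)"
  by (simp add: sphere_space_def euclid_subspace_def)

lemma diffeological_disk_space: "diffeological_space (disk_space n)"
  by (subst disk_space_eq, rule diffeological_euclid_subspace) (auto simp: disk_iff)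

lemma diffeological_sphere_space: "diffeological_space (sphere_space n)"
  by (subst sphere_space_eq, rule diffeological_euclid_subspace) (auto simp: sphere_iff)

lemma smooth_fun_norm2 [smooth_intros]:
  "(\<And>i. i < n \<Longrightarrow> smooth_fun m U (\<lambda>x. \<phi> x i)) \<Longrightarrow> smooth_fun m U (\<lambda>x. norm2 n (\<phi> x))"
  unfolding norm2_def by (intro smooth_intros) simp

lemma continuous_on_norm2 [continuous_intros]:
  "continuous_on S \<phi> \<Longrightarrow> continuous_on S (\<lambda>x. norm2 n (\<phi> x))"
  unfolding norm2_def
  by (intro continuous_on_sum continuous_on_power) (rule continuous_on_product_then_coordinatewise)

lemma norm2_nonneg: "0 \<le> norm2 n x"
  by (simp add: norm2_def sum_nonneg)

lemma norm2_scale: "norm2 n (\<lambda>i. c * y i) = c\<^sup>2 * norm2 n y"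
  by (simp add: norm2_def power_mult_distrib sum_distrib_left)

lemma abs_le_norm2:
  assumes "norm2 n x \<le> r\<^sup>2" "i < n" "0 \<le> r"
  shows "\<bar>x i\<bar> \<le> r"
proof -
  have "(x i)\<^sup>2 \<le> norm2 n x"
    unfolding norm2_def by (rule member_le_sum) (use assms(2) in auto)
  then have "(x i)\<^sup>2 \<le> r\<^sup>2" using assms(1) by linarith
  then show ?thesis using assms(3) by (simp add: abs_le_square_iff[symmetric])
qed

lemma compact_disk: "compact (unit_disk n)"
proof -
  have "compactin (powertop_real UNIV) (PiE UNIV (\<lambda>_. {- 1..1}))"
    by (simp add: compactin_PiE)
  then have "compact (PiE UNIV (\<lambda>_. {- 1..1}) :: (nat \<Rightarrow> real) set)"
    by (simp add: euclidean_product_topology)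
  moreover have "closed {x. norm2 n x \<le> 1}"
    by (intro closed_Collect_le continuous_intros)
  moreover have "closed (euclid n)"
    using closedin_Euclidean_space[of n] by (simp add: euclidean_product_topology)
  ultimately have "compact (PiE UNIV (\<lambda>_. {- 1..1}) \<inter> (euclid n \<inter> {x. norm2 n x \<le> 1}))"
    by (intro compact_Int_closed closed_Int)
  moreover have "PiE UNIV (\<lambda>_. {- 1..1}) \<inter> (euclid n \<inter> {x. norm2 n x \<le> 1}) = unit_disk n"
  proof -
    have "x i \<in> {- 1..1}" if "x \<in> euclid n" "norm2 n x \<le> 1" for x i
      using abs_le_norm2[of n x 1 i] that by (cases "i < n") (auto simp: topspace_Euclidean_space)
    then show ?thesis by (auto simp: disk_iff)
  qed
  ultimately show ?thesis by simp
qed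

lemma compact_sphere: "compact (unit_sphere n)"
proof -
  have "closed {x. norm2 (Suc n) x = 1}" by (intro closed_Collect_eq continuous_intros)
  then have "compact (unit_disk (Suc n) \<inter> {x. norm2 (Suc n) x = 1})" by (intro compact_Int_closed compact_disk)
  moreover have "unit_disk (Suc n) \<inter> {x. norm2 (Suc n) x = 1} = unit_sphere n" by (auto simp: disk_iff sphere_iff)
  ultimately show ?thesis by simp
qed

text \<open>
  The radial retraction of the punctured space onto the sphere is a plot of the sphere. Smooth functions
  and D-open sets of the sphere are thereby turned into smooth functions and open sets of a Euclidean
  space.
\<close>

definition punctured :: "nat \<Rightarrow> (nat \<Rightarrow> real) set" where
  "punctured n = {x \<in> euclid n. 0 < norm2 n x}"

definition normalize_vec :: "nat \<Rightarrow> (nat \<Rightarrow> real) \<Rightarrow> nat \<Rightarrow> real" where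
  "normalize_vec n x = (\<lambda>i. norm2 n x powr (- 1 / 2) * x i)"

lemma eopen_euclid: "eopen n (euclid n)" by simp

lemma eopen_norm2_less: "open T \<Longrightarrow> eopen n {x \<in> euclid n. norm2 n x \<in> T}"
  by (rule eopen_vimage) (auto intro: continuous_intros)

lemma eopen_punctured: "eopen n (punctured n)"
  using eopen_norm2_less[of "{0<..}" n] by (simp add: punctured_def)

lemma normalize_vec_sphere: "x \<in> unit_sphere n \<Longrightarrow> normalize_vec (Suc n) x = x"
  by (simp add: sphere_iff normalize_vec_def)

lemma sphere_subset_punctured: "unit_sphere n \<subseteq> punctured (Suc n)"
  by (auto simp: sphere_iff punctured_def)

lemma normalize_vec_plot:
  "restrict (normalize_vec (Suc n)) (punctured (Suc n)) \<in> plots (sphere_space n) (Suc n) (punctured (Suc n))"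
proof -
  let ?n = "Suc n"
  have "normalize_vec ?n x \<in> unit_sphere n" if "x \<in> punctured ?n" for x
  proof -
    have pos: "0 < norm2 ?n x" using that by (simp add: punctured_def)
    have "norm2 ?n (normalize_vec ?n x) = (norm2 ?n x powr (- 1 / 2))\<^sup>2 * norm2 ?n x"
      unfolding normalize_vec_def by (rule norm2_scale)
    also have "(norm2 ?n x powr (- 1 / 2))\<^sup>2 = norm2 ?n x powr (- 1)"
      by (simp add: power2_eq_square powr_add[symmetric])
    also have "norm2 ?n x powr (- 1) * norm2 ?n x = 1" using pos by (simp add: powr_minus)
    finally show ?thesis using that
      by (auto simp: sphere_iff normalize_vec_def punctured_def topspace_Euclidean_space)
  qed
  moreover have "smooth_fun ?n (punctured ?n) (\<lambda>x. restrict (normalize_vec ?n) (punctured ?n) x i)" for i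
  proof (subst smooth_fun_cong[OF eopen_punctured])
    show "smooth_fun ?n (punctured ?n) (\<lambda>x. norm2 ?n x powr (- 1 / 2) * x i)"
      by (intro smooth_intros smooth_fun_powr eopen_punctured) (simp add: punctured_def)
  qed (simp add: normalize_vec_def)
  ultimately show ?thesis
    using eopen_punctured[of ?n]
    by (subst sphere_space_eq) (auto simp: euclid_subspace_def euclid_smooth_def sphere_iff)
qed

lemma smooth_fun_radial_extension:
  assumes "smooth_map (sphere_space n) (real_subspace A) f"
  shows "smooth_fun (Suc n) (punctured (Suc n)) (\<lambda>x. f (normalize_vec (Suc n) x))"
proof -
  have "smooth_fun (Suc n) (punctured (Suc n))
      (\<lambda>x. f (restrict (normalize_vec (Suc n)) (punctured (Suc n)) x))"
    using assms normalize_vec_plot[of n] unfolding smooth_map_real_iff[OF diffeological_sphere_space] by blast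
  then show ?thesis by (subst (asm) smooth_fun_cong[OF eopen_punctured]) simp_all
qed

lemma eopen_radial_extension:
  assumes "openin (D_topology (sphere_space n)) A"
  shows "eopen (Suc n) {x \<in> punctured (Suc n). normalize_vec (Suc n) x \<in> A}"
  using D_open_vimage_plot[OF diffeological_sphere_space normalize_vec_plot assms]
  by (simp cong: conj_cong)

lemma D_open_disk:
  assumes "eopen n T"
  shows "openin (D_topology (disk_space n)) (unit_disk n \<inter> T)"
proof -
  have "eopen m {x \<in> U. P x \<in> unit_disk n \<inter> T}" if P: "P \<in> plots (disk_space n) m U" for m U P
  proof -
    have U: "eopen m U" and PU: "P \<in> U \<rightarrow> unit_disk n" and sm: "euclid_smooth m U n P"
      using P by (subst (asm) disk_space_eq, auto simp: euclid_subspace_def)+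
    have "openin (subtopology (Euclidean_space m) U) {x \<in> topspace (subtopology (Euclidean_space m) U). P x \<in> T}"
      by (rule openin_continuous_map_preimage[OF euclid_smooth_continuous[OF sm] assms])
    then have "eopen m {x \<in> topspace (subtopology (Euclidean_space m) U). P x \<in> T}"
      using U openin_trans_full by blast
    moreover have "{x \<in> topspace (subtopology (Euclidean_space m) U). P x \<in> T} = {x \<in> U. P x \<in> unit_disk n \<inter> T}"
      using PU eopen_subset[OF U] by auto
    ultimately show ?thesis by simp
  qed
  then show ?thesis by (simp add: openin_D_topology[OF diffeological_disk_space])
qed

text \<open>
  The map \<open>y \<mapsto> 2 y / (1 + \<bar>y\<bar>\<^sup>2)\<close> folds \<open>\<real>\<^sup>n\<close> smoothly onto the disk and has the continuous section
  \<open>x \<mapsto> x / (1 + sqrt (1 - \<bar>x\<bar>\<^sup>2))\<close>. Pulling a D-open set back along the former, which is a plot,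
  and then along the latter shows that the D-topology of the disk is the usual one.
\<close>

lemma D_open_disk_relatively_open:
  assumes V: "openin (D_topology (disk_space n)) V"
  obtains T where "open T" "V = unit_disk n \<inter> T"
proof -
  define q where "q y = (\<lambda>i. 2 * y i * (1 + norm2 n y) powr (- 1))" for y :: "nat \<Rightarrow> real"
  have pos: "0 < 1 + norm2 n y" for y using norm2_nonneg[of n y] by linarith
  have q: "q y = (\<lambda>i. 2 * y i / (1 + norm2 n y))" for y
    using pos[of y] by (simp add: q_def powr_minus_divide fun_eq_iff)
  have q_disk: "q y \<in> unit_disk n" if "y \<in> euclid n" for y
  proof -
    have "norm2 n (q y) = (2 / (1 + norm2 n y))\<^sup>2 * norm2 n y"
      using norm2_scale[of n "2 / (1 + norm2 n y)" y] by (simp add: q)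
    also have "\<dots> = 4 * norm2 n y / (1 + norm2 n y)\<^sup>2" by (simp add: power_divide)
    also have "\<dots> \<le> 1"
    proof -
      have "0 \<le> (1 - norm2 n y)\<^sup>2" by simp
      then have "4 * norm2 n y \<le> (1 + norm2 n y)\<^sup>2" by (simp add: power2_eq_square algebra_simps)
      then show ?thesis using pos[of y] by simp
    qed
    finally show ?thesis using that by (simp add: disk_iff q topspace_Euclidean_space)
  qed
  have "smooth_fun n (euclid n) (\<lambda>x. (restrict q (euclid n)) x i)" for i
  proof (subst smooth_fun_cong[OF eopen_euclid])
    show "smooth_fun n (euclid n) (\<lambda>y. 2 * y i * (1 + norm2 n y) powr (- 1))"
      by (intro smooth_intros smooth_fun_powr eopen_euclid pos)
  qed (simp add: q_def)
  then have "restrict q (euclid n) \<in> plots (disk_space n) n (euclid n)"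
    using q_disk by (subst disk_space_eq) (auto simp: euclid_subspace_def euclid_smooth_def disk_iff)
  from D_open_vimage_plot[OF diffeological_disk_space this V]
  obtain T where T: "open T" "{y \<in> euclid n. q y \<in> V} = euclid n \<inter> T"
    by (auto simp: eopen_iff cong: conj_cong)
  define r where "r x = (\<lambda>i. x i / (1 + sqrt (1 - norm2 n x)))" for x :: "nat \<Rightarrow> real"
  have qr: "q (r x) = x" if x: "x \<in> unit_disk n" for x
  proof -
    define s where "s = sqrt (1 - norm2 n x)"
    have s: "0 \<le> s" "s\<^sup>2 = 1 - norm2 n x" using x by (simp_all add: s_def disk_iff)
    have "norm2 n (r x) = (1 / (1 + s))\<^sup>2 * norm2 n x"
      using norm2_scale[of n "1 / (1 + s)" x] by (simp add: r_def s_def)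
    also have "norm2 n x = (1 - s) * (1 + s)" using s(2) by (simp add: power2_eq_square algebra_simps)
    finally have "norm2 n (r x) = (1 - s) / (1 + s)" using s(1) by (simp add: power2_eq_square)
    then have "1 + norm2 n (r x) = 2 / (1 + s)" using s(1) by (simp add: field_simps)
    then show ?thesis using s(1) by (simp add: q r_def s_def[symmetric] fun_eq_iff)
  qed
  have r_euclid: "r x \<in> euclid n" if "x \<in> unit_disk n" for x
    using that by (simp add: r_def disk_iff topspace_Euclidean_space)
  have "continuous_on (unit_disk n) r"
    unfolding r_def
  proof (rule continuous_on_coordinatewise_then_product, intro continuous_intros)
    show "continuous_on (unit_disk n) (\<lambda>x. x i)" for i by (rule continuous_on_subset[OF continuous_on_product_coordinates]) simp
    show "\<forall>x\<in>unit_disk n. 1 + sqrt (1 - norm2 n x) \<noteq> 0"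
      by (metis add_pos_nonneg diff_ge_0_iff_ge disk_iff less_numeral_extra(1,3) real_sqrt_ge_zero)
  qed
  then obtain T' where T': "open T'" "T' \<inter> unit_disk n = r -` T \<inter> unit_disk n"
    using T(1) by (auto simp: continuous_on_open_invariant)
  have "V \<subseteq> unit_disk n" using openin_subset[OF V] by (simp add: topspace_D_topology[OF diffeological_disk_space])
  moreover have "x \<in> V \<longleftrightarrow> x \<in> T'" if x: "x \<in> unit_disk n" for x
  proof -
    have "x \<in> V \<longleftrightarrow> r x \<in> {y \<in> euclid n. q y \<in> V}" using qr[OF x] r_euclid[OF x] by simp
    also have "\<dots> \<longleftrightarrow> r x \<in> T" using T(2) r_euclid[OF x] by auto
    also have "\<dots> \<longleftrightarrow> x \<in> T'" using T'(2) x by blast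
    finally show ?thesis .
  qed
  ultimately have "V = unit_disk n \<inter> T'" by blast
  then show thesis using T'(1) that by blast
qed

section \<open>Extending a family of functions from the sphere to the disk\<close>

text \<open>
  This factor makes radial extensions from the sphere smooth at the centre of the disk; the division
  by \<open>flat 1\<close> keeps the values on the sphere.
\<close>

definition cutoff :: "nat \<Rightarrow> (nat \<Rightarrow> real) \<Rightarrow> real" where
  "cutoff n x = 1 / flat 1 * flat (2 * norm2 n x - 1)"

lemma cutoff_nonneg: "0 \<le> cutoff n x"
  by (simp add: cutoff_def flat_nonneg)

lemma cutoff_eq_1: "norm2 n x = 1 \<Longrightarrow> cutoff n x = 1"
  using flat_pos_iff[of 1] by (simp add: cutoff_def)

lemma cutoff_eq_0: "norm2 n x \<le> 1 / 2 \<Longrightarrow> cutoff n x = 0"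
  by (simp add: cutoff_def flat_eq_0_iff)

lemma smooth_fun_cutoff_radial_extension:
  assumes f: "smooth_map (sphere_space n) (real_subspace A) f"
  shows "smooth_fun (Suc n) (euclid (Suc n)) (\<lambda>x. cutoff (Suc n) x * f (normalize_vec (Suc n) x))"
proof (rule smooth_fun_local[OF eopen_euclid])
  fix x assume x: "x \<in> euclid (Suc n)"
  show "\<exists>W. eopen (Suc n) W \<and> x \<in> W \<and>
      smooth_fun (Suc n) W (\<lambda>x. cutoff (Suc n) x * f (normalize_vec (Suc n) x))"
  proof (cases "0 < norm2 (Suc n) x")
    case True
    have "smooth_fun (Suc n) (punctured (Suc n)) (\<lambda>x. cutoff (Suc n) x * f (normalize_vec (Suc n) x))"
      unfolding cutoff_def
      by (intro smooth_intros smooth_fun_flat smooth_fun_radial_extension[OF f] eopen_punctured)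
    moreover have "x \<in> punctured (Suc n)" using x True by (simp add: punctured_def)
    ultimately show ?thesis using eopen_punctured by blast
  next
    case False
    let ?W = "{x \<in> euclid (Suc n). norm2 (Suc n) x \<in> {..<1 / 2}}"
    have W: "eopen (Suc n) ?W" by (rule eopen_norm2_less) simp
    have "smooth_fun (Suc n) ?W (\<lambda>x. cutoff (Suc n) x * f (normalize_vec (Suc n) x))"
      by (subst smooth_fun_cong[OF W, of _ "\<lambda>_. 0"]) (auto simp: cutoff_eq_0 intro: smooth_intros)
    moreover have "x \<in> ?W" using x False by simp
    ultimately show ?thesis using W by blast
  qed
qed

lemma relatively_open_compact_Diff:
  assumes "compact K" "open T" shows "compact (K - T)"
  using assms by (simp add: Diff_eq compact_Int_closed closed_Compl)

text \<open>
  Subtracting a large multiple of \<open>1 - \<bar>x\<bar>\<^sup>2\<close>, which vanishes on the sphere, confines the set where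
  a continuous function is nonnegative to any neighbourhood of the part of it on the sphere.
\<close>

lemma penalty_exists:
  fixes e :: "(nat \<Rightarrow> real) \<Rightarrow> real"
  assumes e: "continuous_on (unit_disk (Suc n)) e" and V: "openin (D_topology (disk_space (Suc n))) V"
    and eV: "\<And>x. x \<in> unit_sphere n \<Longrightarrow> 0 \<le> e x \<Longrightarrow> x \<in> V"
  shows "\<exists>L\<ge>0. \<forall>K\<ge>L. \<forall>x\<in>unit_disk (Suc n). x \<notin> V \<longrightarrow> e x - K * (1 - norm2 (Suc n) x) < 0"
proof -
  let ?D = "unit_disk (Suc n)" and ?r = "norm2 (Suc n)"
  obtain T where T: "open T" "V = ?D \<inter> T" using D_open_disk_relatively_open[OF V] .
  define Z where "Z = (?D \<inter> e -` {0..}) - T"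
  have "closedin (top_of_set ?D) (?D \<inter> e -` {0..})"
    using e by (rule continuous_closedin_preimage) simp
  then have "compact (?D \<inter> e -` {0..})" using compact_disk by (rule closedin_compact[rotated])
  then have Z: "compact Z" unfolding Z_def by (rule relatively_open_compact_Diff) (rule T(1))
  have ZD: "Z \<subseteq> ?D" by (auto simp: Z_def)
  have neg: "e x < 0" if "x \<in> ?D" "x \<notin> V" "x \<notin> Z" for x
    using that T(2) by (auto simp: Z_def not_le)
  show ?thesis
  proof (cases "Z = {}")
    case True
    show ?thesis
    proof (intro exI[of _ 0] conjI allI impI ballI order_refl)
      fix K :: real and x assume "0 \<le> K" "x \<in> ?D" "x \<notin> V"
      then have "e x < 0" "0 \<le> K * (1 - ?r x)" using neg True by (auto simp: disk_iff)
      then show "e x - K * (1 - ?r x) < 0" by linarith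
    qed
  next
    case False
    have "continuous_on Z ?r" by (intro continuous_intros)
    then obtain z where z: "z \<in> Z" "\<And>x. x \<in> Z \<Longrightarrow> ?r x \<le> ?r z"
      using continuous_attains_sup[OF Z False] by blast
    have "continuous_on Z e" using e ZD by (rule continuous_on_subset)
    then obtain y where y: "y \<in> Z" "\<And>x. x \<in> Z \<Longrightarrow> e x \<le> e y"
      using continuous_attains_sup[OF Z False] by blast
    have y0: "0 \<le> e y" using y(1) by (simp add: Z_def)
    have "?r z \<noteq> 1"
    proof
      assume "?r z = 1"
      then have "z \<in> unit_sphere n" using z(1) ZD by (auto simp: sphere_iff disk_iff)
      then show False using eV[of z] z(1) T(2) ZD by (auto simp: Z_def)
    qed
    then have z1: "?r z < 1" using z(1) ZD by (force simp: disk_iff)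
    define L where "L = (e y + 1) / (1 - ?r z)"
    have L0: "0 \<le> L" using y0 z1 by (simp add: L_def)
    have "e x - K * (1 - ?r x) < 0" if K: "L \<le> K" and x: "x \<in> ?D" "x \<notin> V" for K x
    proof (cases "x \<in> Z")
      case True
      have "e x < L * (1 - ?r z)" using y(2)[OF True] z1 by (simp add: L_def)
      also have "\<dots> \<le> K * (1 - ?r x)"
        using K z(2)[OF True] z1 L0 by (intro mult_mono) auto
      finally show ?thesis by simp
    next
      case False
      moreover have "0 \<le> K * (1 - ?r x)" using K L0 x(1) by (intro mult_nonneg_nonneg) (auto simp: disk_iff)
      ultimately show ?thesis using neg[OF x] by simp
    qed
    with L0 show ?thesis by blast
  qed
qed

text \<open>
  A family of functions some member of which is positive at each point of the sphere becomes so on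
  the whole disk by adding finitely many bumps that vanish near the sphere: the points where no member
  is positive form a compact set \<open>K\<close> in the open disk. Around each of them a bump is centred that lifts
  one suitable member above \<open>0\<close> at the centre, hence nearby, and finitely many of these
  neighbourhoods cover \<open>K\<close>.
\<close>

lemma interior_bumps_exist:
  fixes E :: "'i \<Rightarrow> (nat \<Rightarrow> real) \<Rightarrow> real"
  assumes E: "\<And>a. a \<in> I \<Longrightarrow> continuous_on (euclid (Suc n)) (E a)"
    and V: "\<And>a. a \<in> I \<Longrightarrow> openin (D_topology (disk_space (Suc n))) (V a)"
    and cover: "\<And>x. x \<in> unit_disk (Suc n) \<Longrightarrow> \<exists>a\<in>I. x \<in> V a"
    and pos: "\<And>x. x \<in> unit_sphere n \<Longrightarrow> \<exists>a\<in>I. 0 < E a x"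
  obtains w :: "'i \<Rightarrow> (nat \<Rightarrow> real) \<Rightarrow> real" and A T where
    "\<And>a. smooth_fun (Suc n) (euclid (Suc n)) (w a)" "\<And>a x. 0 \<le> w a x"
    "\<And>a x. x \<in> unit_disk (Suc n) \<Longrightarrow> w a x \<noteq> 0 \<Longrightarrow> x \<in> V a"
    "finite A" "\<And>a x. w a x \<noteq> 0 \<Longrightarrow> a \<in> A"
    "\<And>x. x \<in> unit_disk (Suc n) \<Longrightarrow> \<exists>a\<in>I. 0 < E a x + w a x"
    "open T" "unit_sphere n \<subseteq> T" "\<And>a x. x \<in> T \<Longrightarrow> w a x = 0"
proof -
  let ?D = "unit_disk (Suc n)" and ?r = "norm2 (Suc n)"
  have posE: "\<exists>T. open T \<and> {x \<in> euclid (Suc n). g x \<in> {0<..}} = euclid (Suc n) \<inter> T"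
    if "continuous_on (euclid (Suc n)) g" for g :: "(nat \<Rightarrow> real) \<Rightarrow> real"
    using eopen_vimage[OF eopen_euclid that, of "{0<..}"] by (auto simp: eopen_iff)
  have "\<exists>T. open T \<and> {x \<in> euclid (Suc n). E a x \<in> {0<..}} = euclid (Suc n) \<inter> T" if "a \<in> I" for a
    using posE[OF E[OF that]] .
  then obtain TE where TE: "\<And>a. a \<in> I \<Longrightarrow> open (TE a)"
    "\<And>a. a \<in> I \<Longrightarrow> {x \<in> euclid (Suc n). E a x \<in> {0<..}} = euclid (Suc n) \<inter> TE a" by metis
  have TE_iff: "x \<in> TE a \<longleftrightarrow> 0 < E a x" if "a \<in> I" "x \<in> ?D" for a x
    using TE(2)[OF that(1)] that(2) by (auto simp: disk_iff set_eq_iff)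
  define K where "K = ?D - (\<Union>a\<in>I. TE a)"
  have K: "compact K" unfolding K_def
    by (rule relatively_open_compact_Diff[OF compact_disk]) (use TE(1) in blast)
  define bump where "bump p a s c \<longleftrightarrow> a \<in> I \<and> 0 < s \<and> 0 \<le> c \<and> 0 < E a p + c * flat s \<and>
      (\<forall>x\<in>euclid (Suc n). ?r (\<lambda>i. x i - p i) \<le> s \<longrightarrow> x \<in> V a \<and> ?r x < 1)" for p a s c
  have "\<exists>a s c. bump p a s c" if p: "p \<in> K" for p
  proof -
    have pD: "p \<in> ?D" using p by (simp add: K_def)
    obtain a where a: "a \<in> I" "p \<in> V a" using cover[OF pD] by blast
    obtain T where T: "open T" "V a = ?D \<inter> T" using D_open_disk_relatively_open[OF V[OF a(1)]] .
    have "?r p \<noteq> 1"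
    proof
      assume "?r p = 1"
      then have "p \<in> unit_sphere n" using pD by (simp add: sphere_iff disk_iff)
      then obtain b where "b \<in> I" "0 < E b p" using pos by blast
      then show False using p TE_iff[OF _ pD] by (auto simp: K_def)
    qed
    then have p1: "?r p < 1" using pD by (simp add: disk_iff)
    have "eopen (Suc n) (euclid (Suc n) \<inter> T)" using T(1) by (auto simp: eopen_iff)
    then have "eopen (Suc n) ({x \<in> euclid (Suc n). ?r x \<in> {..<1}} \<inter> (euclid (Suc n) \<inter> T))"
      by (intro openin_Int[OF eopen_norm2_less]) simp_all
    moreover have "p \<in> {x \<in> euclid (Suc n). ?r x \<in> {..<1}} \<inter> (euclid (Suc n) \<inter> T)"
      using p1 pD a(2) T(2) by (auto simp: disk_iff)
    ultimately obtain d where d: "0 < d" "\<And>y. y \<in> euclid (Suc n) \<Longrightarrow>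
        (\<And>l. l < Suc n \<Longrightarrow> \<bar>y l - p l\<bar> < d) \<Longrightarrow> y \<in> {x \<in> euclid (Suc n). ?r x \<in> {..<1}} \<inter> (euclid (Suc n) \<inter> T)"
      by (rule eopen_box) blast
    \<comment> \<open>Half the size of the box, so that even the closed ball stays inside; the height \<open>?c\<close> exceeds \<open>- E a p\<close>.\<close>
    let ?s = "(d / 2)\<^sup>2" and ?c = "(\<bar>E a p\<bar> + 1) / flat ((d / 2)\<^sup>2)"
    have s: "0 < ?s" using d(1) by simp
    have fl: "0 < flat ?s" using s by (simp add: flat_pos_iff)
    have "x \<in> V a \<and> ?r x < 1" if x: "x \<in> euclid (Suc n)" "?r (\<lambda>i. x i - p i) \<le> ?s" for x
    proof -
      have "\<bar>x l - p l\<bar> < d" if "l < Suc n" for l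
        using abs_le_norm2[OF x(2) that] d(1) by simp
      from d(2)[OF x(1) this] show ?thesis using T(2) by (simp add: disk_iff)
    qed
    moreover have "0 < E a p + ?c * flat ?s" using fl by simp
    moreover have "0 \<le> ?c" using fl by simp
    ultimately have "bump p a ?s ?c" using a(1) s by (simp add: bump_def)
    then show ?thesis by blast
  qed
  then obtain a s c where bump: "\<And>p. p \<in> K \<Longrightarrow> bump p (a p) (s p) (c p)" by metis
  have a: "\<And>p. p \<in> K \<Longrightarrow> a p \<in> I" and s: "\<And>p. p \<in> K \<Longrightarrow> 0 < s p"
    and c: "\<And>p. p \<in> K \<Longrightarrow> 0 \<le> c p" and Ep: "\<And>p. p \<in> K \<Longrightarrow> 0 < E (a p) p + c p * flat (s p)"
    and ball: "\<And>p x. p \<in> K \<Longrightarrow> x \<in> euclid (Suc n) \<Longrightarrow> ?r (\<lambda>i. x i - p i) \<le> s p \<Longrightarrow> x \<in> V (a p) \<and> ?r x < 1"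
    using bump by (simp_all add: bump_def)
  define b where "b p x = c p * flat (s p - ?r (\<lambda>i. x i - p i))" for p x
  have b_smooth: "smooth_fun (Suc n) (euclid (Suc n)) (b p)" for p
    unfolding b_def[abs_def] by (intro smooth_intros smooth_fun_flat eopen_euclid)
  have b_nonneg: "0 \<le> b p x" if "p \<in> K" for p x using c[OF that] by (simp add: b_def flat_nonneg)
  have b_0: "?r (\<lambda>i. x i - p i) < s p" if "b p x \<noteq> 0" for p x
    using that by (simp add: b_def flat_eq_0_iff)
  have "\<exists>T. open T \<and> {x \<in> euclid (Suc n). E (a p) x + b p x \<in> {0<..}} = euclid (Suc n) \<inter> T"
    if "p \<in> K" for p
  proof (rule posE)
    show "continuous_on (euclid (Suc n)) (\<lambda>x. E (a p) x + b p x)"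
      using E[OF a[OF that]] smooth_fun_continuous_on[OF eopen_euclid b_smooth] by (rule continuous_on_add)
  qed
  then have "\<forall>p\<in>K. \<exists>T. open T \<and> {x \<in> euclid (Suc n). E (a p) x + b p x \<in> {0<..}} = euclid (Suc n) \<inter> T"
    by blast
  from bchoice[OF this] obtain B where B: "\<And>p. p \<in> K \<Longrightarrow> open (B p)"
    "\<And>p. p \<in> K \<Longrightarrow> {x \<in> euclid (Suc n). E (a p) x + b p x \<in> {0<..}} = euclid (Suc n) \<inter> B p" by blast
  have KE: "p \<in> euclid (Suc n)" if "p \<in> K" for p using that by (simp add: K_def disk_iff)
  have B_iff: "x \<in> B p \<longleftrightarrow> 0 < E (a p) x + b p x" if "p \<in> K" "x \<in> euclid (Suc n)" for x p
    using B(2)[OF that(1)] that(2) by (auto simp: set_eq_iff)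
  have "p \<in> B p" if "p \<in> K" for p
    using Ep[OF that] B_iff[OF that KE[OF that]] by (simp add: b_def norm2_def)
  then have "K \<subseteq> (\<Union>p\<in>K. B p)" by blast
  with K B(1) obtain J where J: "J \<subseteq> K" "finite J" "K \<subseteq> (\<Union>p\<in>J. B p)"
    by (rule compactE_image)
  define w where "w i x = (\<Sum>p\<in>{p \<in> J. a p = i}. b p x)" for i x
  define T where "T = {x. \<forall>p\<in>J. s p < ?r (\<lambda>i. x i - p i)}"
  have w_nz: "\<exists>p\<in>J. a p = i \<and> b p x \<noteq> 0" if "w i x \<noteq> 0" for i x
  proof -
    obtain p where "p \<in> {p \<in> J. a p = i}" "b p x \<noteq> 0"
      using \<open>w i x \<noteq> 0\<close> unfolding w_def by (rule sum.not_neutral_contains_not_neutral)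
    then show ?thesis by blast
  qed
  show thesis
  proof (rule that[of w "a ` J" T])
    show "smooth_fun (Suc n) (euclid (Suc n)) (w i)" for i
      unfolding w_def[abs_def] by (intro smooth_intros b_smooth)
    show "0 \<le> w i x" for i x
      unfolding w_def using J(1) by (intro sum_nonneg b_nonneg) auto
    show "x \<in> V i" if x: "x \<in> ?D" and w: "w i x \<noteq> 0" for i x
    proof -
      obtain p where p: "p \<in> J" "a p = i" "b p x \<noteq> 0" using w_nz[OF w] by blast
      have "x \<in> V (a p)" using ball[of p x] b_0[OF p(3)] p(1) J(1) x by (auto simp: disk_iff)
      then show ?thesis using p(2) by simp
    qed
    show "finite (a ` J)" using J(2) by simp
    show "i \<in> a ` J" if "w i x \<noteq> 0" for i x using w_nz[OF that] by blast
    show "\<exists>a\<in>I. 0 < E a x + w a x" if x: "x \<in> ?D" for x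
    proof (cases "x \<in> K")
      case True
      then obtain p where p: "p \<in> J" "x \<in> B p" using J(3) by blast
      have pK: "p \<in> K" using p(1) J(1) by blast
      have "0 < E (a p) x + b p x" using B_iff[OF pK KE[OF True]] p(2) by simp
      moreover have "b p x \<le> w (a p) x"
        unfolding w_def using J p(1) by (intro member_le_sum) (auto intro!: b_nonneg)
      ultimately show ?thesis using a[OF pK] by (intro bexI[of _ "a p"]) auto
    next
      case False
      then obtain i where i: "i \<in> I" "x \<in> TE i" using x by (auto simp: K_def)
      then have "0 < E i x" using TE_iff x by blast
      moreover have "0 \<le> w i x"
        unfolding w_def using J(1) by (intro sum_nonneg b_nonneg) auto
      ultimately show ?thesis using i(1) by (intro bexI[of _ i]) auto
    qed
    have "T = (\<Inter>p\<in>J. {x. s p < ?r (\<lambda>i. x i - p i)})" by (auto simp: T_def)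
    moreover have "open {x. s p < ?r (\<lambda>i. x i - p i)}" for p
      by (intro open_Collect_less continuous_intros continuous_on_coordinatewise_then_product) simp
    ultimately show "open T" using J(2) by (simp add: open_INT)
    show "unit_sphere n \<subseteq> T"
    proof
      fix x assume x: "x \<in> unit_sphere n"
      have "s p < ?r (\<lambda>i. x i - p i)" if p: "p \<in> J" for p
      proof (rule ccontr)
        assume "\<not> ?thesis"
        then have "?r x < 1" using ball[of p x] p J(1) x by (auto simp: sphere_iff)
        then show False using x by (simp add: sphere_iff)
      qed
      then show "x \<in> T" by (simp add: T_def)
    qed
    show "w i x = 0" if "x \<in> T" for i x
    proof (rule ccontr)
      assume "w i x \<noteq> 0"
      then obtain p where "p \<in> J" "b p x \<noteq> 0" using w_nz by blast
      then show False using b_0[of p x] that by (fastforce simp: T_def)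
    qed
  qed
qed

text \<open>
  The extension is \<open>F a x = \<kappa>(x) f a (x / \<bar>x\<bar>) - K (1 - \<bar>x\<bar>\<^sup>2) + w a x\<close> with the cutoff \<open>\<kappa>\<close>, a penalty
  constant \<open>K\<close> and interior bumps \<open>w\<close>. Finiteness of the set of members that are somewhere nonnegative
  allows one \<open>K\<close> to serve for all; the others need no more than \<open>K > 0\<close>. The collar \<open>C\<close> consists of
  the points away from the centre that no bump reaches: there the sign of \<open>f a\<close> at the radial
  projection decides.
\<close>

lemma extend_over_disk:
  fixes f :: "'i \<Rightarrow> (nat \<Rightarrow> real) \<Rightarrow> real"
  assumes V: "\<And>a. a \<in> I \<Longrightarrow> openin (D_topology (disk_space (Suc n))) (V a)"
    and cover: "\<And>x. x \<in> unit_disk (Suc n) \<Longrightarrow> \<exists>a\<in>I. x \<in> V a"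
    and f: "\<And>a. a \<in> I \<Longrightarrow> smooth_map (sphere_space n) (real_subspace UNIV) (f a)"
    and fV: "\<And>a x. a \<in> I \<Longrightarrow> x \<in> unit_sphere n \<Longrightarrow> 0 \<le> f a x \<Longrightarrow> x \<in> V a"
    and pos: "\<And>x. x \<in> unit_sphere n \<Longrightarrow> \<exists>a\<in>I. 0 < f a x"
    and fin: "finite {a \<in> I. \<exists>x\<in>unit_sphere n. 0 \<le> f a x}"
  obtains F C where
    "\<And>a. a \<in> I \<Longrightarrow> smooth_map (disk_space (Suc n)) (real_subspace UNIV) (F a)"
    "\<And>a x. a \<in> I \<Longrightarrow> x \<in> unit_sphere n \<Longrightarrow> F a x = f a x"
    "\<And>a x. a \<in> I \<Longrightarrow> x \<in> unit_disk (Suc n) \<Longrightarrow> 0 \<le> F a x \<Longrightarrow> x \<in> V a"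
    "\<And>x. x \<in> unit_disk (Suc n) \<Longrightarrow> \<exists>a\<in>I. 0 < F a x"
    "finite {a \<in> I. \<exists>x\<in>unit_disk (Suc n). 0 \<le> F a x}"
    "openin (D_topology (disk_space (Suc n))) C" "unit_sphere n \<subseteq> C"
    "\<And>a x. a \<in> I \<Longrightarrow> x \<in> C \<Longrightarrow> f a (normalize_vec (Suc n) x) < 0 \<Longrightarrow> F a x < 0"
proof -
  let ?D = "unit_disk (Suc n)" and ?r = "norm2 (Suc n)"
  define A where "A = {a \<in> I. \<exists>x\<in>unit_sphere n. 0 \<le> f a x}"
  define e where "e a x = cutoff (Suc n) x * f a (normalize_vec (Suc n) x)" for a x
  have e_smooth: "smooth_fun (Suc n) (euclid (Suc n)) (e a)" if "a \<in> I" for a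
    unfolding e_def[abs_def] using f[OF that] by (rule smooth_fun_cutoff_radial_extension)
  have e_sphere: "e a x = f a x" if "x \<in> unit_sphere n" for a x
    using that by (simp add: e_def normalize_vec_sphere cutoff_eq_1 sphere_iff)
  have "\<exists>L\<ge>0. \<forall>K\<ge>L. \<forall>x\<in>?D. x \<notin> V a \<longrightarrow> e a x - K * (1 - ?r x) < 0" if a: "a \<in> I" for a
  proof (rule penalty_exists[OF _ V[OF a]])
    show "continuous_on ?D (e a)"
      by (rule continuous_on_subset[OF smooth_fun_continuous_on[OF eopen_euclid e_smooth[OF a]]])
        (auto simp: disk_iff)
  qed (use fV a e_sphere in auto)
  then obtain L where L: "\<And>a. a \<in> I \<Longrightarrow> 0 \<le> L a"
    "\<And>a K x. a \<in> I \<Longrightarrow> L a \<le> K \<Longrightarrow> x \<in> ?D \<Longrightarrow> x \<notin> V a \<Longrightarrow> e a x - K * (1 - ?r x) < 0" by metis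
  define K where "K = 1 + (\<Sum>a\<in>A. L a)"
  have AI: "A \<subseteq> I" by (auto simp: A_def)
  have LK: "L a \<le> K" if "a \<in> A" for a
    using member_le_sum[of a A L] that fin AI L(1) unfolding K_def A_def[symmetric] by fastforce
  have K0: "0 < K" using sum_nonneg[of A L] AI L(1) unfolding K_def by fastforce
  define E where "E a x = e a x - K * (1 - ?r x)" for a x
  have E_smooth: "smooth_fun (Suc n) (euclid (Suc n)) (E a)" if "a \<in> I" for a
    unfolding E_def[abs_def] using e_smooth[OF that] by (intro smooth_intros)
  have E_sphere: "E a x = f a x" if "x \<in> unit_sphere n" for a x
    using that e_sphere by (simp add: E_def sphere_iff)
  have E_neg: "E a x < 0" if x: "x \<in> ?D" and neg: "0 < ?r x \<Longrightarrow> f a (normalize_vec (Suc n) x) < 0" for a x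
  proof (cases "?r x = 1")
    case True
    then have "x \<in> unit_sphere n" using x by (simp add: sphere_iff disk_iff)
    then show ?thesis using E_sphere neg True normalize_vec_sphere by simp
  next
    case False
    then have "0 < K * (1 - ?r x)" using x K0 by (simp add: disk_iff)
    moreover have "e a x \<le> 0"
    proof (cases "0 < ?r x")
      case True
      then show ?thesis
        using neg cutoff_nonneg[of "Suc n" x] by (simp add: e_def mult_nonneg_nonpos)
    qed (simp add: e_def cutoff_eq_0)
    ultimately show ?thesis by (simp add: E_def)
  qed
  have norm_sphere: "normalize_vec (Suc n) x \<in> unit_sphere n" if "x \<in> ?D" "0 < ?r x" for x
  proof -
    have "x \<in> punctured (Suc n)" using that by (simp add: punctured_def disk_iff)
    then show ?thesis
      using diffeological_space.plot_fun[OF diffeological_sphere_space normalize_vec_plot[of n]]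
      by (auto simp: PiE_iff)
  qed
  have E_A: "a \<in> A" if "a \<in> I" "x \<in> ?D" "0 \<le> E a x" for a x
  proof (rule ccontr)
    assume "a \<notin> A"
    then have neg: "f a (normalize_vec (Suc n) x) < 0" if "0 < ?r x"
      using norm_sphere[OF \<open>x \<in> ?D\<close> that] \<open>a \<in> I\<close> by (auto simp: A_def not_le)
    show False using E_neg[OF \<open>x \<in> ?D\<close> neg] that(3) by simp
  qed
  have E_V: "x \<in> V a" if "a \<in> I" "x \<in> ?D" "0 \<le> E a x" for a x
    using L(2)[OF that(1) LK[OF E_A[OF that]] that(2)] that(3) by (auto simp: E_def)
  have E_cont: "continuous_on (euclid (Suc n)) (E a)" if "a \<in> I" for a
    using smooth_fun_continuous_on[OF eopen_euclid E_smooth[OF that]] .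
  have E_pos: "\<exists>a\<in>I. 0 < E a x" if "x \<in> unit_sphere n" for x
    using pos[OF that] E_sphere[OF that] by simp
  obtain w B T where w: "\<And>a. smooth_fun (Suc n) (euclid (Suc n)) (w a)" "\<And>a x. 0 \<le> w a x"
    "\<And>a x. x \<in> ?D \<Longrightarrow> w a x \<noteq> 0 \<Longrightarrow> x \<in> V a"
    "finite B" "\<And>a x. w a x \<noteq> 0 \<Longrightarrow> a \<in> B"
    "\<And>x. x \<in> ?D \<Longrightarrow> \<exists>a\<in>I. 0 < E a x + w a x"
    and T: "open T" "unit_sphere n \<subseteq> T" "\<And>a x. x \<in> T \<Longrightarrow> w a x = 0"
    using interior_bumps_exist[OF E_cont V cover E_pos] by blast
  define F where "F a x = E a x + w a x" for a x
  define C where "C = ?D \<inter> (punctured (Suc n) \<inter> T)"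
  show thesis
  proof (rule that[of F C])
    show "smooth_map (disk_space (Suc n)) (real_subspace UNIV) (F a)" if "a \<in> I" for a
      unfolding F_def[abs_def]
      by (subst disk_space_eq, rule smooth_map_euclid_subspace[OF _ eopen_euclid])
        (auto simp: disk_iff intro!: smooth_intros E_smooth that w(1))
    show "F a x = f a x" if "a \<in> I" "x \<in> unit_sphere n" for a x
      using that E_sphere T(2,3) by (auto simp: F_def)
    show "x \<in> V a" if "a \<in> I" "x \<in> ?D" "0 \<le> F a x" for a x
      using w(3)[OF that(2)] E_V[OF that(1,2)] that(3) by (cases "w a x = 0") (auto simp: F_def)
    show "\<exists>a\<in>I. 0 < F a x" if "x \<in> ?D" for x
      using w(6)[OF that] by (simp add: F_def)
    have "{a \<in> I. \<exists>x\<in>?D. 0 \<le> F a x} \<subseteq> A \<union> B"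
    proof clarify
      fix a x assume a: "a \<in> I" "x \<in> ?D" "0 \<le> F a x" "a \<notin> B"
      then have "w a x = 0" using w(5) by blast
      then show "a \<in> A" using E_A[OF a(1,2)] a(3) by (simp add: F_def)
    qed
    then show "finite {a \<in> I. \<exists>x\<in>?D. 0 \<le> F a x}"
      by (rule finite_subset) (use fin w(4) in \<open>simp add: A_def\<close>)
    have "eopen (Suc n) (euclid (Suc n) \<inter> T)" using T(1) by (auto simp: eopen_iff)
    then have "eopen (Suc n) (punctured (Suc n) \<inter> (euclid (Suc n) \<inter> T))" by (rule openin_Int[OF eopen_punctured])
    moreover have "punctured (Suc n) \<inter> (euclid (Suc n) \<inter> T) = punctured (Suc n) \<inter> T" by (auto simp: punctured_def)
    ultimately show "openin (D_topology (disk_space (Suc n))) C"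
      unfolding C_def by (intro D_open_disk) simp
    show "unit_sphere n \<subseteq> C" using T(2) sphere_subset_disk sphere_subset_punctured by (auto simp: C_def)
    show "F a x < 0" if "a \<in> I" "x \<in> C" "f a (normalize_vec (Suc n) x) < 0" for a x
      using E_neg[of x a] that T(3) by (auto simp: F_def C_def)
  qed
qed

section \<open>Numerations and their extension over cells\<close>

text \<open>
  The sign conventions make the conditions robust: \<open>{u a \<ge> 0}\<close> is closed, so it contains the closure of
  \<open>{u a > 0}\<close>, whereas \<open>{u a > 0}\<close> and \<open>{u a < 0}\<close> are open.
\<close>

definition numeration ::
    "'a diffeo_space \<Rightarrow> 'i set \<Rightarrow> ('i \<Rightarrow> 'a set) \<Rightarrow> ('i \<Rightarrow> 'a \<Rightarrow> real) \<Rightarrow> bool" where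
  "numeration Y I V u \<longleftrightarrow>
     (\<forall>a\<in>I. smooth_map Y (real_subspace UNIV) (u a)) \<and>
     (\<forall>a\<in>I. \<forall>y\<in>points Y. 0 \<le> u a y \<longrightarrow> y \<in> V a) \<and>
     (\<forall>y\<in>points Y. \<exists>a\<in>I. 0 < u a y) \<and>
     (\<forall>y\<in>points Y. \<exists>N. openin (D_topology Y) N \<and> y \<in> N \<and> finite {a\<in>I. \<exists>z\<in>N. 0 \<le> u a z})"

text \<open>
  Finitely many of the neighbourhoods that witness local finiteness cover the image of the sphere,
  because their preimages, radially extended, are open in a Euclidean space and the sphere is compact.
\<close>

lemma finite_nonneg_on_sphere:
  fixes B :: "'b diffeo_space"
  assumes B: "diffeological_space B" and \<phi>: "smooth_map (sphere_space n) B \<phi>"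
    and fin: "\<And>y. y \<in> points B \<Longrightarrow> \<exists>N. openin (D_topology B) N \<and> y \<in> N \<and> finite {a\<in>I. \<exists>z\<in>N. 0 \<le> u a z}"
  shows "finite {a\<in>I. \<exists>x\<in>unit_sphere n. 0 \<le> (u a (\<phi> x) :: real)}"
proof -
  define good where "good x N T \<longleftrightarrow> finite {a\<in>I. \<exists>z\<in>N. 0 \<le> u a z} \<and> open T \<and> x \<in> T \<and>
      (\<forall>y\<in>unit_sphere n. y \<in> T \<longrightarrow> \<phi> y \<in> N)" for x N T
  have "\<exists>N T. good x N T" if x: "x \<in> unit_sphere n" for x
  proof -
    have "\<phi> x \<in> points B" using \<phi> x by (auto simp: smooth_map_def)
    then obtain N where N: "openin (D_topology B) N" "\<phi> x \<in> N" "finite {a\<in>I. \<exists>z\<in>N. 0 \<le> u a z}"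
      using fin by blast
    have "openin (D_topology (sphere_space n)) {z \<in> unit_sphere n. \<phi> z \<in> N}"
      by (rule D_open_vimage[OF \<phi> diffeological_sphere_space B N(1)])
    from eopen_radial_extension[OF this]
    obtain T where T: "open T"
      "{y \<in> punctured (Suc n). normalize_vec (Suc n) y \<in> {z \<in> unit_sphere n. \<phi> z \<in> N}} = euclid (Suc n) \<inter> T"
      unfolding eopen_iff by blast
    have "y \<in> T \<longleftrightarrow> \<phi> y \<in> N" if y: "y \<in> unit_sphere n" for y
    proof -
      have "y \<in> T \<longleftrightarrow> y \<in> euclid (Suc n) \<inter> T" using y by (simp add: sphere_iff)
      also have "\<dots> \<longleftrightarrow> \<phi> y \<in> N"
        unfolding T(2)[symmetric] using y sphere_subset_punctured normalize_vec_sphere[OF y] by auto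
      finally show ?thesis .
    qed
    then have "good x N T" using T(1) N(2,3) x by (simp add: good_def)
    then show ?thesis by blast
  qed
  then obtain N T where "\<And>x. x \<in> unit_sphere n \<Longrightarrow> good x (N x) (T x)" by metis
  then have NT: "\<And>x. x \<in> unit_sphere n \<Longrightarrow> finite {a\<in>I. \<exists>z\<in>N x. 0 \<le> u a z}"
    "\<And>x. x \<in> unit_sphere n \<Longrightarrow> open (T x)" "\<And>x. x \<in> unit_sphere n \<Longrightarrow> x \<in> T x"
    "\<And>x y. x \<in> unit_sphere n \<Longrightarrow> y \<in> unit_sphere n \<Longrightarrow> y \<in> T x \<Longrightarrow> \<phi> y \<in> N x"
    by (simp_all add: good_def)
  have "unit_sphere n \<subseteq> (\<Union>x\<in>unit_sphere n. T x)" using NT(3) by blast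
  with compact_sphere NT(2) obtain J where J: "J \<subseteq> unit_sphere n" "finite J" "unit_sphere n \<subseteq> (\<Union>x\<in>J. T x)"
    by (rule compactE_image)
  have "{a\<in>I. \<exists>x\<in>unit_sphere n. 0 \<le> u a (\<phi> x)} \<subseteq> (\<Union>x\<in>J. {a\<in>I. \<exists>z\<in>N x. 0 \<le> u a z})"
  proof clarify
    fix a y assume a: "a \<in> I" "y \<in> unit_sphere n" "0 \<le> u a (\<phi> y)"
    then obtain x where x: "x \<in> J" "y \<in> T x" using J(3) by blast
    then have "\<phi> y \<in> N x" using NT(4) J(1) a(2) by blast
    then show "a \<in> (\<Union>x\<in>J. {a\<in>I. \<exists>z\<in>N x. 0 \<le> u a z})" using a x(1) by blast
  qed
  moreover have "finite (\<Union>x\<in>J. {a\<in>I. \<exists>z\<in>N x. 0 \<le> u a z})" using J NT(1) by blast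
  ultimately show ?thesis by (rule finite_subset)
qed

text \<open>
  Maps into an indiscrete space are always smooth, so uniqueness in the universal property compares
  the constant map with the characteristic function of the joint image.
\<close>

lemma pushout_jointly_surjective:
  assumes po: "is_pushout A f B g C D p q" and B: "diffeological_space B" and C: "diffeological_space C"
    and f: "f \<in> points A \<rightarrow> points B" and g: "g \<in> points A \<rightarrow> points C" and d: "d \<in> points D"
  shows "d \<in> p ` points B \<union> q ` points C"
proof (rule ccontr)
  assume nd: "d \<notin> p ` points B \<union> q ` points C"
  let ?I = "indiscrete_space (UNIV :: bool set)"
  have D: "diffeological_space D" using po by (simp add: is_pushout_def)
  have U: "pushout_for A f B g C D p q ?I"
    by (rule pushout_universal[OF po B C diffeological_indiscrete f g])
  have sm: "smooth_map B ?I (\<lambda>_. True)" "smooth_map C ?I (\<lambda>_. True)" "smooth_map D ?I (\<lambda>_. True)"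
    "smooth_map D ?I (\<lambda>x. x \<in> p ` points B \<union> q ` points C)"
    using B C D by (auto intro!: smooth_map_indiscrete)
  have "True = (d \<in> p ` points B \<union> q ` points C)"
    by (rule pushout_for_unique[OF U sm(1,2) _ sm(3) _ _ sm(4) _ _ d]) auto
  then show False using nd by simp
qed

lemma colimit_jointly_surjective:
  assumes co: "is_colimit F j D p" and F: "\<And>n. diffeological_space (F n)"
    and j: "\<And>n. j n \<in> points (F n) \<rightarrow> points (F (Suc n))" and d: "d \<in> points D"
  shows "\<exists>n. d \<in> p n ` points (F n)"
proof (rule ccontr)
  assume nd: "\<nexists>n. d \<in> p n ` points (F n)"
  let ?I = "indiscrete_space (UNIV :: bool set)"
  have D: "diffeological_space D" using co by (simp add: is_colimit_def)
  have U: "colimit_for F j D p ?I"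
    by (rule colimit_universal[OF co F diffeological_indiscrete j])
  have sm: "smooth_map (F n) ?I (\<lambda>_. True)" "smooth_map D ?I (\<lambda>_. True)"
    "smooth_map D ?I (\<lambda>x. \<exists>n. x \<in> p n ` points (F n))" for n
    using F D by (auto intro!: smooth_map_indiscrete)
  have "True = (\<exists>n. d \<in> p n ` points (F n))"
    by (rule colimit_for_unique[OF U sm(1) _ sm(2) _ sm(3) _ d]) auto
  then show False using nd by simp
qed

lemma points_coproduct: "points (coproduct J F) = (SIGMA i:J. points (F i))"
  by (simp add: coproduct_def locally_in_def)

text \<open>
  The extension \<open>u'\<close> comes with a collar: every D-open set downstairs thickens to a D-open set
  upstairs in such a way that members of the family that are negative on the former stay so on the
  latter, all with the same thickening. It is this uniformity that carries local finiteness to the colimit.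
\<close>

definition collared_extension :: "'b diffeo_space \<Rightarrow> 'd diffeo_space \<Rightarrow> ('b \<Rightarrow> 'd) \<Rightarrow> 'i set \<Rightarrow>
    ('i \<Rightarrow> 'b \<Rightarrow> real) \<Rightarrow> ('i \<Rightarrow> 'd \<Rightarrow> real) \<Rightarrow> bool" where
  "collared_extension B D p I u u' \<longleftrightarrow>
     (\<forall>a\<in>I. \<forall>b\<in>points B. u' a (p b) = u a b) \<and>
     (\<forall>N. openin (D_topology B) N \<longrightarrow> (\<exists>N'. openin (D_topology D) N' \<and>
        (\<forall>b\<in>points B. p b \<in> N' \<longleftrightarrow> b \<in> N) \<and>
        (\<forall>a\<in>I. (\<forall>y\<in>N. u a y < 0) \<longrightarrow> (\<forall>y\<in>N'. u' a y < 0))))"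

text \<open>
  The members are extended cell by cell. At a point of an open cell local finiteness holds because
  only finitely many extended members are nonnegative anywhere on that cell; a point of \<open>B\<close> inherits it
  through the collar.
\<close>

lemma numeration_extends_over_cells:
  fixes B :: "'b diffeo_space" and D :: "'d diffeo_space" and J :: "'c set"
  assumes po: "is_pushout (coproduct J (\<lambda>_. sphere_space n)) h B (\<lambda>x. x)
      (coproduct J (\<lambda>_. disk_space (Suc n))) D p q"
    and B: "diffeological_space B" and h: "smooth_map (coproduct J (\<lambda>_. sphere_space n)) B h"
    and V: "\<And>a. a \<in> I \<Longrightarrow> openin (D_topology D) (V a)"
    and cover: "\<And>d. d \<in> points D \<Longrightarrow> \<exists>a\<in>I. d \<in> V a"
    and u: "numeration B I (\<lambda>a. {b \<in> points B. p b \<in> V a}) u"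
  obtains u' where "numeration D I V u'" "collared_extension B D p I u u'"
proof -
  let ?A = "coproduct J (\<lambda>_. sphere_space n)" and ?C = "coproduct J (\<lambda>_. disk_space (Suc n))"
  have A: "diffeological_space ?A" and C: "diffeological_space ?C"
    by (intro diffeological_coproduct diffeological_sphere_space diffeological_disk_space)+
  have D: "diffeological_space D" and p: "smooth_map B D p" and q: "smooth_map ?C D q"
    and pq: "\<And>z. z \<in> points ?A \<Longrightarrow> p (h z) = q z"
    using po by (simp_all add: is_pushout_def)
  have hA: "h \<in> points ?A \<rightarrow> points B" using h by (simp add: smooth_map_def)
  have idA: "(\<lambda>x. x) \<in> points ?A \<rightarrow> points ?C" using sphere_subset_disk by (auto simp: points_coproduct)
  have univ: "pushout_for ?A h B (\<lambda>x. x) ?C D p q Z" if "diffeological_space Z" for Z :: "'z diffeo_space"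
    by (rule pushout_universal[OF po B C that hA idA])
  have surj: "(\<exists>b\<in>points B. d = p b) \<or> (\<exists>c\<in>J. \<exists>x\<in>unit_disk (Suc n). d = q (c, x))" if "d \<in> points D" for d
    using pushout_jointly_surjective[OF po B C hA idA that] by (auto simp: points_coproduct)
  have pB: "p b \<in> points D" if "b \<in> points B" for b using p that by (auto simp: smooth_map_def)
  have qC: "q (c, x) \<in> points D" if "c \<in> J" "x \<in> unit_disk (Suc n)" for c x
    using q that by (auto simp: smooth_map_def points_coproduct)
  have hS: "h (c, x) \<in> points B" if "c \<in> J" "x \<in> unit_sphere n" for c x
    using hA that by (auto simp: points_coproduct)
  have phq: "p (h (c, x)) = q (c, x)" if "c \<in> J" "x \<in> unit_sphere n" for c x
    using that by (intro pq) (simp add: points_coproduct)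
  have u_smooth: "\<And>a. a \<in> I \<Longrightarrow> smooth_map B (real_subspace UNIV) (u a)"
    and u_V: "\<And>a b. a \<in> I \<Longrightarrow> b \<in> points B \<Longrightarrow> 0 \<le> u a b \<Longrightarrow> p b \<in> V a"
    and u_pos: "\<And>b. b \<in> points B \<Longrightarrow> \<exists>a\<in>I. 0 < u a b"
    and u_fin: "\<And>b. b \<in> points B \<Longrightarrow>
      \<exists>N. openin (D_topology B) N \<and> b \<in> N \<and> finite {a\<in>I. \<exists>z\<in>N. 0 \<le> u a z}"
    using u unfolding numeration_def by blast+
  have glue_open: "\<exists>N. openin (D_topology D) N \<and> (\<forall>b\<in>points B. p b \<in> N \<longleftrightarrow> b \<in> OB) \<and>
      (\<forall>c\<in>J. \<forall>x\<in>unit_disk (Suc n). q (c, x) \<in> N \<longleftrightarrow> x \<in> OC c)"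
    if OB: "openin (D_topology B) OB"
      and OC: "\<And>c. c \<in> J \<Longrightarrow> openin (D_topology (disk_space (Suc n))) (OC c)"
      and compat: "\<And>c x. c \<in> J \<Longrightarrow> x \<in> unit_sphere n \<Longrightarrow> h (c, x) \<in> OB \<longleftrightarrow> x \<in> OC c"
    for OB :: "'b set" and OC :: "'c \<Rightarrow> (nat \<Rightarrow> real) set"
  proof -
    have "{b \<in> points B. b \<in> OB} = OB"
      using openin_subset[OF OB] by (auto simp: topspace_D_topology[OF B])
    then have B': "smooth_map B sierpinski_space (\<lambda>b. b \<in> OB)"
      using OB by (simp add: smooth_map_sierpinski_iff[OF B])
    have C': "smooth_map ?C sierpinski_space (\<lambda>z. snd z \<in> OC (fst z))"
    proof (rule smooth_map_coproduct[OF diffeological_sierpinski])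
      fix c assume c: "c \<in> J"
      have "{x \<in> unit_disk (Suc n). x \<in> OC c} = OC c"
        using openin_subset[OF OC[OF c]] by (auto simp: topspace_D_topology[OF diffeological_disk_space])
      then show "smooth_map (disk_space (Suc n)) sierpinski_space (\<lambda>x. snd (c, x) \<in> OC (fst (c, x)))"
        using OC[OF c] by (simp add: smooth_map_sierpinski_iff[OF diffeological_disk_space])
    qed
    obtain w where w: "smooth_map D sierpinski_space w" "\<forall>b\<in>points B. w (p b) = (b \<in> OB)"
      "\<forall>z\<in>points ?C. w (q z) = (snd z \<in> OC (fst z))"
      using pushout_for_exists[OF univ[OF diffeological_sierpinski] B' C'] compat
      by (auto simp: points_coproduct)
    have "openin (D_topology D) {d \<in> points D. w d}" using w(1) by (simp add: smooth_map_sierpinski_iff[OF D])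
    moreover have "\<forall>b\<in>points B. p b \<in> {d \<in> points D. w d} \<longleftrightarrow> b \<in> OB" using w(2) pB by simp
    moreover have "\<forall>c\<in>J. \<forall>x\<in>unit_disk (Suc n). q (c, x) \<in> {d \<in> points D. w d} \<longleftrightarrow> x \<in> OC c"
      using w(3) qC by (simp add: points_coproduct)
    ultimately show ?thesis by blast
  qed
  define good where "good c F K \<longleftrightarrow>
      (\<forall>a\<in>I. smooth_map (disk_space (Suc n)) (real_subspace UNIV) (F a)) \<and>
      (\<forall>a\<in>I. \<forall>x\<in>unit_sphere n. F a x = u a (h (c, x))) \<and>
      (\<forall>a\<in>I. \<forall>x\<in>unit_disk (Suc n). 0 \<le> F a x \<longrightarrow> q (c, x) \<in> V a) \<and>
      (\<forall>x\<in>unit_disk (Suc n). \<exists>a\<in>I. 0 < F a x) \<and>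
      finite {a \<in> I. \<exists>x\<in>unit_disk (Suc n). 0 \<le> F a x} \<and>
      openin (D_topology (disk_space (Suc n))) K \<and> unit_sphere n \<subseteq> K \<and>
      (\<forall>a\<in>I. \<forall>x\<in>K. u a (h (c, normalize_vec (Suc n) x)) < 0 \<longrightarrow> F a x < 0)" for c F K
  have "\<exists>F K. good c F K" if c: "c \<in> J" for c
  proof -
    have qc: "smooth_map (disk_space (Suc n)) D (\<lambda>x. q (c, x))"
      using smooth_map_compose[OF smooth_map_coproduct_injection[OF diffeological_disk_space c] q
          diffeological_disk_space] by (simp add: comp_def)
    have hc: "smooth_map (sphere_space n) B (\<lambda>x. h (c, x))"
      using smooth_map_compose[OF smooth_map_coproduct_injection[OF diffeological_sphere_space c] h
          diffeological_sphere_space] by (simp add: comp_def)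
    have 1: "openin (D_topology (disk_space (Suc n))) {x \<in> unit_disk (Suc n). q (c, x) \<in> V a}" if "a \<in> I" for a
      by (rule D_open_vimage[OF qc diffeological_disk_space D V[OF that]])
    have 2: "\<exists>a\<in>I. x \<in> {x \<in> unit_disk (Suc n). q (c, x) \<in> V a}" if "x \<in> unit_disk (Suc n)" for x
      using cover[OF qC[OF c that]] that by blast
    have 3: "smooth_map (sphere_space n) (real_subspace UNIV) (\<lambda>x. u a (h (c, x)))" if "a \<in> I" for a
      using smooth_map_compose[OF hc u_smooth[OF that] diffeological_sphere_space] by (simp add: comp_def)
    have 4: "x \<in> {x \<in> unit_disk (Suc n). q (c, x) \<in> V a}"
      if "a \<in> I" "x \<in> unit_sphere n" "0 \<le> u a (h (c, x))" for a x
      using u_V[OF that(1) hS[OF c that(2)] that(3)] phq[OF c that(2)] that(2) sphere_subset_disk by auto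
    have 5: "\<exists>a\<in>I. 0 < u a (h (c, x))" if "x \<in> unit_sphere n" for x
      by (rule u_pos[OF hS[OF c that]])
    have 6: "finite {a \<in> I. \<exists>x\<in>unit_sphere n. 0 \<le> u a (h (c, x))}"
      by (rule finite_nonneg_on_sphere[OF B hc u_fin])
    obtain F K where
      "\<And>a. a \<in> I \<Longrightarrow> smooth_map (disk_space (Suc n)) (real_subspace UNIV) (F a)"
      "\<And>a x. a \<in> I \<Longrightarrow> x \<in> unit_sphere n \<Longrightarrow> F a x = u a (h (c, x))"
      "\<And>a x. a \<in> I \<Longrightarrow> x \<in> unit_disk (Suc n) \<Longrightarrow> 0 \<le> F a x \<Longrightarrow> x \<in> {x \<in> unit_disk (Suc n). q (c, x) \<in> V a}"
      "\<And>x. x \<in> unit_disk (Suc n) \<Longrightarrow> \<exists>a\<in>I. 0 < F a x"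
      "finite {a \<in> I. \<exists>x\<in>unit_disk (Suc n). 0 \<le> F a x}"
      "openin (D_topology (disk_space (Suc n))) K" "unit_sphere n \<subseteq> K"
      "\<And>a x. a \<in> I \<Longrightarrow> x \<in> K \<Longrightarrow> u a (h (c, normalize_vec (Suc n) x)) < 0 \<Longrightarrow> F a x < 0"
      using extend_over_disk[OF 1 2 3 4 5 6] by blast
    then have "good c F K" unfolding good_def by simp
    then show ?thesis by blast
  qed
  then obtain F K where FK: "\<And>c. c \<in> J \<Longrightarrow> good c (F c) (K c)" by metis
  have F_smooth: "smooth_map (disk_space (Suc n)) (real_subspace UNIV) (F c a)" if "c \<in> J" "a \<in> I" for c a
    using FK[OF that(1)] that(2) by (simp add: good_def)
  have F_sphere: "F c a x = u a (h (c, x))" if "c \<in> J" "a \<in> I" "x \<in> unit_sphere n" for c a x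
    using FK[OF that(1)] that(2,3) by (simp add: good_def)
  have F_V: "q (c, x) \<in> V a" if "c \<in> J" "a \<in> I" "x \<in> unit_disk (Suc n)" "0 \<le> F c a x" for c a x
    using FK[OF that(1)] that(2-) by (simp add: good_def)
  have F_pos: "\<exists>a\<in>I. 0 < F c a x" if "c \<in> J" "x \<in> unit_disk (Suc n)" for c x
    using FK[OF that(1)] that(2-) by (simp add: good_def)
  have F_fin: "finite {a \<in> I. \<exists>x\<in>unit_disk (Suc n). 0 \<le> F c a x}" if "c \<in> J" for c
    using FK[OF that] by (simp add: good_def)
  have K_open: "openin (D_topology (disk_space (Suc n))) (K c)" and K_sphere: "unit_sphere n \<subseteq> K c"
    if "c \<in> J" for c
    using FK[OF that] by (simp_all add: good_def)
  have F_neg: "F c a x < 0" if "c \<in> J" "a \<in> I" "x \<in> K c" "u a (h (c, normalize_vec (Suc n) x)) < 0" for c a x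
    using FK[OF that(1)] that(2-) by (simp add: good_def)
  have "\<exists>w. smooth_map D (real_subspace UNIV) w \<and> (\<forall>b\<in>points B. w (p b) = u a b) \<and>
      (\<forall>z\<in>points ?C. w (q z) = F (fst z) a (snd z))" if a: "a \<in> I" for a
  proof (rule pushout_for_exists[OF univ[OF diffeological_real_subspace] u_smooth[OF a]])
    show "smooth_map ?C (real_subspace UNIV) (\<lambda>z. F (fst z) a (snd z))"
      by (rule smooth_map_coproduct[OF diffeological_real_subspace]) (simp add: F_smooth[OF _ a])
    show "u a (h z) = F (fst z) a (snd z)" if "z \<in> points ?A" for z
      using that F_sphere[OF _ a] by (auto simp: points_coproduct)
  qed
  then have "\<forall>a\<in>I. \<exists>w. smooth_map D (real_subspace UNIV) w \<and> (\<forall>b\<in>points B. w (p b) = u a b) \<and>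
      (\<forall>z\<in>points ?C. w (q z) = F (fst z) a (snd z))" by blast
  from bchoice[OF this] obtain u' where u': "\<And>a. a \<in> I \<Longrightarrow> smooth_map D (real_subspace UNIV) (u' a)"
    "\<And>a b. a \<in> I \<Longrightarrow> b \<in> points B \<Longrightarrow> u' a (p b) = u a b"
    "\<And>a z. a \<in> I \<Longrightarrow> z \<in> points ?C \<Longrightarrow> u' a (q z) = F (fst z) a (snd z)" by blast
  have u'q: "u' a (q (c, x)) = F c a x" if "a \<in> I" "c \<in> J" "x \<in> unit_disk (Suc n)" for a c x
    using u'(3)[OF that(1), of "(c, x)"] that(2,3) by (simp add: points_coproduct)
  have collar: "\<exists>N'. openin (D_topology D) N' \<and> (\<forall>b\<in>points B. p b \<in> N' \<longleftrightarrow> b \<in> N) \<and>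
      (\<forall>a\<in>I. (\<forall>y\<in>N. u a y < 0) \<longrightarrow> (\<forall>y\<in>N'. u' a y < 0))" if N: "openin (D_topology B) N" for N
  proof -
    \<comment> \<open>Over the cell \<open>c\<close>: the points of its collar whose radial projection is attached to \<open>N\<close>.\<close>
    define OC where "OC c = K c \<inter> (unit_disk (Suc n) \<inter>
        {x \<in> punctured (Suc n). normalize_vec (Suc n) x \<in> {y \<in> unit_sphere n. h (c, y) \<in> N}})" for c
    have "\<exists>N'. openin (D_topology D) N' \<and> (\<forall>b\<in>points B. p b \<in> N' \<longleftrightarrow> b \<in> N) \<and>
        (\<forall>c\<in>J. \<forall>x\<in>unit_disk (Suc n). q (c, x) \<in> N' \<longleftrightarrow> x \<in> OC c)"
    proof (rule glue_open[OF N])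
      fix c assume c: "c \<in> J"
      have hc: "smooth_map (sphere_space n) B (\<lambda>x. h (c, x))"
        using smooth_map_compose[OF smooth_map_coproduct_injection[OF diffeological_sphere_space c] h
            diffeological_sphere_space] by (simp add: comp_def)
      show "openin (D_topology (disk_space (Suc n))) (OC c)"
        unfolding OC_def
        by (rule openin_Int[OF K_open[OF c] D_open_disk[OF eopen_radial_extension[OF
          D_open_vimage[OF hc diffeological_sphere_space B N]]]])
      fix x assume x: "x \<in> unit_sphere n"
      then have "x \<in> K c" "x \<in> unit_disk (Suc n)" "x \<in> punctured (Suc n)"
        using K_sphere[OF c] sphere_subset_disk sphere_subset_punctured by blast+
      then show "h (c, x) \<in> N \<longleftrightarrow> x \<in> OC c"
        using x by (simp add: OC_def normalize_vec_sphere)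
    qed
    then obtain N' where N': "openin (D_topology D) N'" "\<And>b. b \<in> points B \<Longrightarrow> p b \<in> N' \<longleftrightarrow> b \<in> N"
      "\<And>c x. c \<in> J \<Longrightarrow> x \<in> unit_disk (Suc n) \<Longrightarrow> q (c, x) \<in> N' \<longleftrightarrow> x \<in> OC c" by blast
    have "u' a y < 0" if a: "a \<in> I" and neg: "\<forall>y\<in>N. u a y < 0" and y: "y \<in> N'" for a y
    proof -
      have "y \<in> points D" using openin_subset[OF N'(1)] y by (auto simp: topspace_D_topology[OF D])
      from surj[OF this] show ?thesis
      proof (elim disjE bexE)
        fix b assume b: "b \<in> points B" "y = p b"
        then show ?thesis using N'(2) u'(2)[OF a] neg y by auto
      next
        fix c x assume c: "c \<in> J" "x \<in> unit_disk (Suc n)" "y = q (c, x)"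
        then have "x \<in> OC c" using N'(3) y by blast
        then have "x \<in> K c" "h (c, normalize_vec (Suc n) x) \<in> N" by (auto simp: OC_def)
        then show ?thesis using F_neg[OF c(1) a] neg u'q[OF a c(1,2)] c(3) by simp
      qed
    qed
    then show ?thesis using N'(1,2) by blast
  qed
  show thesis
  proof (rule that[of u'])
    show "collared_extension B D p I u u'"
      unfolding collared_extension_def using u'(2) collar by blast
    have fin_B: "\<exists>N. openin (D_topology D) N \<and> p b \<in> N \<and> finite {a\<in>I. \<exists>z\<in>N. 0 \<le> u' a z}"
      if b: "b \<in> points B" for b
    proof -
      obtain N where N: "openin (D_topology B) N" "b \<in> N" "finite {a\<in>I. \<exists>z\<in>N. 0 \<le> u a z}"
        using u_fin[OF b] by blast
      obtain N' where N': "openin (D_topology D) N'" "\<forall>b\<in>points B. p b \<in> N' \<longleftrightarrow> b \<in> N"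
        "\<forall>a\<in>I. (\<forall>y\<in>N. u a y < 0) \<longrightarrow> (\<forall>y\<in>N'. u' a y < 0)" using collar[OF N(1)] by blast
      have "{a\<in>I. \<exists>z\<in>N'. 0 \<le> u' a z} \<subseteq> {a\<in>I. \<exists>z\<in>N. 0 \<le> u a z}" using N'(3) by (force simp: not_less[symmetric])
      then show ?thesis using N(2,3) N'(1,2) b finite_subset by blast
    qed
    have fin_C: "\<exists>N. openin (D_topology D) N \<and> q (c, x) \<in> N \<and> finite {a\<in>I. \<exists>z\<in>N. 0 \<le> u' a z}"
      if c: "c \<in> J" and x: "x \<in> unit_disk (Suc n)" for c x
    proof (cases "norm2 (Suc n) x = 1")
      case True
      then have xS: "x \<in> unit_sphere n" using x by (simp add: sphere_iff disk_iff)
      show ?thesis using fin_B[OF hS[OF c xS]] by (simp add: phq[OF c xS])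
    next
      case False
      define OC where "OC c' = (if c' = c then unit_disk (Suc n) \<inter> {x \<in> euclid (Suc n). norm2 (Suc n) x \<in> {..<1}} else {})" for c'
      have "\<exists>N. openin (D_topology D) N \<and> (\<forall>b\<in>points B. p b \<in> N \<longleftrightarrow> b \<in> {}) \<and>
        (\<forall>c\<in>J. \<forall>x\<in>unit_disk (Suc n). q (c, x) \<in> N \<longleftrightarrow> x \<in> OC c)"
      proof (rule glue_open)
        show "openin (D_topology (disk_space (Suc n))) (OC c')" for c'
          using D_open_disk[OF eopen_norm2_less[of "{..<1}" "Suc n"]] by (simp add: OC_def)
        show "h (c', x) \<in> {} \<longleftrightarrow> x \<in> OC c'" if "x \<in> unit_sphere n" for c' x
          using that by (auto simp: OC_def sphere_iff)
      qed simp
      then obtain N where N: "openin (D_topology D) N" "\<And>b. b \<in> points B \<Longrightarrow> p b \<notin> N"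
        "\<And>c x. c \<in> J \<Longrightarrow> x \<in> unit_disk (Suc n) \<Longrightarrow> q (c, x) \<in> N \<longleftrightarrow> x \<in> OC c" by blast
      have "{a\<in>I. \<exists>z\<in>N. 0 \<le> u' a z} \<subseteq> {a \<in> I. \<exists>x\<in>unit_disk (Suc n). 0 \<le> F c a x}"
      proof clarify
        fix a z assume a: "a \<in> I" and z: "z \<in> N" "0 \<le> u' a z"
        have "z \<in> points D" using openin_subset[OF N(1)] z(1) by (auto simp: topspace_D_topology[OF D])
        then obtain c' x where c': "c' \<in> J" "x \<in> unit_disk (Suc n)" "z = q (c', x)"
          using surj[of z] N(2) z(1) by blast
        then have "x \<in> OC c'" using N(3) z(1) by blast
        then have "c' = c" by (simp add: OC_def split: if_splits)
        then show "\<exists>x\<in>unit_disk (Suc n). 0 \<le> F c a x" using u'q[OF a c'(1,2)] z(2) c'(2,3) by auto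
      qed
      moreover have "q (c, x) \<in> N" using N(3)[OF c x] x False by (auto simp: OC_def disk_iff)
      ultimately show ?thesis using N(1) F_fin[OF c] finite_subset by blast
    qed
    show "numeration D I V u'"
      unfolding numeration_def
    proof (intro conjI ballI impI)
      show "smooth_map D (real_subspace UNIV) (u' a)" if "a \<in> I" for a using u'(1) that .
      show "y \<in> V a" if "a \<in> I" "y \<in> points D" "0 \<le> u' a y" for a y
        using surj[OF that(2)] u_V[OF that(1)] F_V[OF _ that(1)] u'(2)[OF that(1)] u'q[OF that(1)] that(3)
        by auto
      show "\<exists>a\<in>I. 0 < u' a y" if "y \<in> points D" for y
        using surj[OF that] u_pos F_pos u'(2) u'q by metis
      show "\<exists>N. openin (D_topology D) N \<and> y \<in> N \<and> finite {a \<in> I. \<exists>z\<in>N. 0 \<le> u' a z}"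
        if "y \<in> points D" for y
        using surj[OF that] fin_B fin_C by blast
    qed
  qed
qed

section \<open>From numerations to partitions of unity\<close>

text \<open>
  The denominator \<open>S\<close> is locally a finite sum, hence smooth along plots, and positive because some
  member of the numeration is.
\<close>

lemma numeration_imp_partition_of_unity:
  fixes X :: "'a diffeo_space"
  assumes X: "diffeological_space X" and u: "numeration X \<V> (\<lambda>V. V) u"
  shows "\<exists>\<rho>. smooth_partition_of_unity X \<V> \<V> \<rho>"
proof -
  have u_smooth: "\<And>V. V \<in> \<V> \<Longrightarrow> smooth_map X (real_subspace UNIV) (u V)"
    and u_V: "\<And>V x. V \<in> \<V> \<Longrightarrow> x \<in> points X \<Longrightarrow> 0 \<le> u V x \<Longrightarrow> x \<in> V"
    and u_pos: "\<And>x. x \<in> points X \<Longrightarrow> \<exists>V\<in>\<V>. 0 < u V x"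
    and u_fin: "\<And>x. x \<in> points X \<Longrightarrow>
      \<exists>N. openin (D_topology X) N \<and> x \<in> N \<and> finite {V\<in>\<V>. \<exists>z\<in>N. 0 \<le> u V z}"
    using u unfolding numeration_def by blast+
  define S where "S x = (\<Sum>V | V \<in> \<V> \<and> 0 < u V x. flat (u V x))" for x
  define \<rho> where "\<rho> V x = flat (u V x) * S x powr (- 1)" for V x
  have S_eq: "S x = (\<Sum>V\<in>F. flat (u V x))"
    if "finite F" "F \<subseteq> \<V>" "\<And>V. V \<in> \<V> \<Longrightarrow> 0 \<le> u V x \<Longrightarrow> V \<in> F" for x F
    unfolding S_def using that by (intro sum.mono_neutral_left) (auto simp: flat_eq_0_iff)
  have fin: "finite {V \<in> \<V>. 0 < u V x}" if x: "x \<in> points X" for x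
  proof -
    obtain N where N: "x \<in> N" "finite {V\<in>\<V>. \<exists>z\<in>N. 0 \<le> u V z}" using u_fin[OF x] by blast
    have "{V \<in> \<V>. 0 < u V x} \<subseteq> {V\<in>\<V>. \<exists>z\<in>N. 0 \<le> u V z}" using N(1) less_imp_le by blast
    then show ?thesis using N(2) by (rule finite_subset)
  qed
  have S_pos: "0 < S x" if x: "x \<in> points X" for x
  proof -
    obtain V where "V \<in> \<V>" "0 < u V x" using u_pos[OF x] by blast
    then show ?thesis
      unfolding S_def using fin[OF x] by (intro sum_pos) (auto simp: flat_pos_iff)
  qed
  have \<rho>_eq: "\<rho> V x = flat (u V x) / S x" if "x \<in> points X" for V x
    using S_pos[OF that] by (simp add: \<rho>_def powr_minus_divide)
  have \<rho>_nonzero: "\<rho> V x \<noteq> 0 \<longleftrightarrow> 0 < u V x" if "x \<in> points X" for V x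
    using S_pos[OF that] by (auto simp: \<rho>_eq[OF that] flat_eq_0_iff)
  have supp: "supp X (\<rho> V) \<subseteq> {x \<in> points X. 0 \<le> u V x}" if V: "V \<in> \<V>" for V
  proof -
    have "openin (D_topology X) {x \<in> points X. u V x \<in> {..<0}}"
      by (rule D_open_real_vimage[OF u_smooth[OF V] X]) simp
    moreover have "points X - {x \<in> points X. 0 \<le> u V x} = {x \<in> points X. u V x \<in> {..<0}}" by auto
    ultimately have "closedin (D_topology X) {x \<in> points X. 0 \<le> u V x}"
      by (simp add: closedin_def topspace_D_topology[OF X])
    then show ?thesis
      unfolding supp_def by (intro closure_of_minimal) (auto simp: \<rho>_nonzero)
  qed
  have "smooth_partition_of_unity X \<V> \<V> \<rho>"
    unfolding smooth_partition_of_unity_def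
  proof (intro conjI ballI)
    fix V assume V: "V \<in> \<V>"
    show "\<exists>W\<in>\<V>. supp X (\<rho> V) \<subseteq> W" using supp[OF V] u_V[OF V] V by blast
    have "\<rho> V x \<in> {0..1}" if x: "x \<in> points X" for x
    proof (cases "0 < u V x")
      case True
      have "flat (u V x) \<le> S x"
        unfolding S_def using fin[OF x] V True by (intro member_le_sum) (auto simp: flat_nonneg)
      then show ?thesis using S_pos[OF x] by (simp add: \<rho>_eq[OF x] flat_nonneg)
    next
      case False
      then have "\<rho> V x = 0" using \<rho>_nonzero[OF x] by blast
      then show ?thesis by simp
    qed
    moreover have "smooth_fun n U (\<lambda>t. \<rho> V (P t))" if P: "P \<in> plots X n U" for n U P
    proof (rule smooth_fun_local[OF diffeological_space.plot_dom[OF X P]])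
      fix t assume t: "t \<in> U"
      have PX: "P s \<in> points X" if "s \<in> U" for s
        using diffeological_space.plot_fun[OF X P] that by (auto simp: PiE_iff)
      obtain N where N: "openin (D_topology X) N" "P t \<in> N" "finite {V\<in>\<V>. \<exists>z\<in>N. 0 \<le> u V z}"
        using u_fin[OF PX[OF t]] by blast
      let ?F = "{V\<in>\<V>. \<exists>z\<in>N. 0 \<le> u V z}"
      define W where "W = {s \<in> U. P s \<in> N}"
      have W: "eopen n W" unfolding W_def by (rule D_open_vimage_plot[OF X P N(1)])
      have WU: "W \<subseteq> U" by (auto simp: W_def)
      have u_W: "smooth_fun n W (\<lambda>s. u V' (P s))" if "V' \<in> \<V>" for V'
        using u_smooth[OF that] P WU smooth_fun_subset unfolding smooth_map_real_iff[OF X] by blast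
      have S_W: "S (P s) = (\<Sum>V'\<in>?F. flat (u V' (P s)))" if "s \<in> W" for s
        using that by (intro S_eq N(3)) (auto simp: W_def)
      have "smooth_fun n W (\<lambda>s. flat (u V (P s)) * (\<Sum>V'\<in>?F. flat (u V' (P s))) powr (- 1))"
      proof (intro smooth_fun_mult smooth_fun_powr smooth_fun_sum smooth_fun_flat W u_W V)
        show "0 < (\<Sum>V'\<in>?F. flat (u V' (P s)))" if "s \<in> W" for s
          using S_pos[OF PX, of s] S_W[OF that] that WU by auto
      qed auto
      then have "smooth_fun n W (\<lambda>s. \<rho> V (P s))"
        by (subst smooth_fun_cong[OF W]) (auto simp: \<rho>_def S_W)
      then show "\<exists>W. eopen n W \<and> t \<in> W \<and> smooth_fun n W (\<lambda>t. \<rho> V (P t))"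
        using W t N(2) by (auto simp: W_def)
    qed
    ultimately show "smooth_map X (real_subspace {0..1}) (\<rho> V)"
      by (auto simp: smooth_map_real_iff[OF X])
  next
    fix x assume x: "x \<in> points X"
    obtain N where N: "openin (D_topology X) N" "x \<in> N" "finite {V\<in>\<V>. \<exists>z\<in>N. 0 \<le> u V z}"
      using u_fin[OF x] by blast
    have "{V \<in> \<V>. supp X (\<rho> V) \<inter> N \<noteq> {}} \<subseteq> {V\<in>\<V>. \<exists>z\<in>N. 0 \<le> u V z}" using supp by blast
    then show "\<exists>N. openin (D_topology X) N \<and> x \<in> N \<and> finite {V \<in> \<V>. supp X (\<rho> V) \<inter> N \<noteq> {}}"
      using N finite_subset by blast
    have "(\<Sum>V | V \<in> \<V> \<and> \<rho> V x \<noteq> 0. \<rho> V x) = (\<Sum>V | V \<in> \<V> \<and> 0 < u V x. flat (u V x) / S x)"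
      using \<rho>_nonzero[OF x] \<rho>_eq[OF x] by simp
    also have "\<dots> = S x / S x" unfolding S_def by (rule sum_divide_distrib[symmetric])
    finally show "(\<Sum>V | V \<in> \<V> \<and> \<rho> V x \<noteq> 0. \<rho> V x) = 1" using S_pos[OF x] by simp
  qed
  then show ?thesis by blast
qed

section \<open>Smooth CW complexes\<close>

text \<open>
  Each point selects one index; as points are D-open, local finiteness is witnessed by singletons.
\<close>

lemma numeration_discrete_space:
  assumes "\<And>x. x \<in> S \<Longrightarrow> \<exists>a\<in>I. x \<in> V a"
  shows "\<exists>u. numeration (discrete_space S) I V u"
proof -
  obtain c where c: "\<And>x. x \<in> S \<Longrightarrow> c x \<in> I \<and> x \<in> V (c x)" using assms by metis
  have pts: "points (discrete_space S) = S" by (simp add: discrete_space_def locally_in_def)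
  define u where "u a x = (if a = c x then 1 else - 1 :: real)" for a x
  have "finite {a \<in> I. \<exists>z\<in>{x}. 0 \<le> u a z}" for x
    by (rule finite_subset[of _ "{c x}"]) (auto simp: u_def split: if_splits)
  moreover have "openin (D_topology (discrete_space S)) {x}" if "x \<in> S" for x
    using that by (intro D_open_discrete_space) simp
  ultimately have "\<exists>N. openin (D_topology (discrete_space S)) N \<and> x \<in> N \<and> finite {a \<in> I. \<exists>z\<in>N. 0 \<le> u a z}"
    if "x \<in> S" for x using that by blast
  then have "numeration (discrete_space S) I V u"
    unfolding numeration_def pts using c by (auto simp: u_def smooth_map_discrete_space split: if_splits)
  then show ?thesis by blast
qed

context smooth_CW_complex
begin

lemma diffeological_X: "diffeological_space X"
  using colimit by (simp add: is_colimit_def)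

lemma smooth_\<iota>: "smooth_map (Sk n) X (\<iota> n)" and \<iota>_j: "b \<in> points (Sk n) \<Longrightarrow> \<iota> (Suc n) (j n b) = \<iota> n b"
  using colimit by (simp_all add: is_colimit_def)

lemma smooth_j: "smooth_map (Sk n) (Sk (Suc n)) (j n)"
  using pushout[of n] by (simp add: is_pushout_def)

lemma j_in_skeleton: "b \<in> points (Sk n) \<Longrightarrow> j n b \<in> points (Sk (Suc n))"
  using smooth_j[of n] by (auto simp: smooth_map_def)

lemma \<iota>_in_points: "b \<in> points (Sk n) \<Longrightarrow> \<iota> n b \<in> points X"
  using smooth_\<iota>[of n] by (auto simp: smooth_map_def)

lemma universal: "diffeological_space Z \<Longrightarrow> colimit_for Sk j X \<iota> Z"
  using colimit skeleton by (rule colimit_universal) (use j_in_skeleton in auto)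

lemma in_high_skeleton:
  assumes "x \<in> points X"
  shows "\<exists>k. \<exists>b\<in>points (Sk (n + k)). x = \<iota> (n + k) b"
proof (induction n)
  case 0
  show ?case using colimit_jointly_surjective[OF colimit skeleton _ assms] j_in_skeleton by fastforce
next
  case (Suc n)
  then obtain k b where "b \<in> points (Sk (n + k))" "x = \<iota> (n + k) b" by blast
  then have "j (n + k) b \<in> points (Sk (Suc n + k))" "x = \<iota> (Suc n + k) (j (n + k) b)"
    using j_in_skeleton \<iota>_j by simp_all
  then show ?case by blast
qed

text \<open>
  A coherent sequence of D-open sets starting at level \<open>n\<close> suffices, since it extends downwards by
  taking preimages under the inclusions of skeleta.
\<close>

lemma D_open_from_skeleta:
  assumes "\<And>k. openin (D_topology (Sk (n + k))) (M k)"
    and "\<And>k b. b \<in> points (Sk (n + k)) \<Longrightarrow> j (n + k) b \<in> M (Suc k) \<longleftrightarrow> b \<in> M k"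
  shows "\<exists>N. openin (D_topology X) N \<and> (\<forall>k. \<forall>b\<in>points (Sk (n + k)). \<iota> (n + k) b \<in> N \<longleftrightarrow> b \<in> M k)"
  using assms
proof (induction n arbitrary: M)
  case 0
  have "smooth_map (Sk k) sierpinski_space (\<lambda>b. b \<in> M k)" for k
  proof -
    have "{b \<in> points (Sk k). b \<in> M k} = M k"
      using openin_subset[OF "0.prems"(1)[of k]] by (auto simp: topspace_D_topology[OF skeleton])
    then show ?thesis using "0.prems"(1)[of k] by (simp add: smooth_map_sierpinski_iff[OF skeleton])
  qed
  then obtain w where w: "smooth_map X sierpinski_space w" "\<forall>k. \<forall>b\<in>points (Sk k). w (\<iota> k b) = (b \<in> M k)"
    using colimit_for_exists[OF universal[OF diffeological_sierpinski], of "\<lambda>k b. b \<in> M k"] "0.prems"(2)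
    by auto
  then show ?case
    using \<iota>_in_points by (intro exI[of _ "{x \<in> points X. w x}"])
      (auto simp: smooth_map_sierpinski_iff[OF diffeological_X])
next
  case (Suc n)
  define M' where "M' k = (case k of 0 \<Rightarrow> {b \<in> points (Sk n). j n b \<in> M 0} | Suc k \<Rightarrow> M k)" for k
  have "\<exists>N. openin (D_topology X) N \<and> (\<forall>k. \<forall>b\<in>points (Sk (n + k)). \<iota> (n + k) b \<in> N \<longleftrightarrow> b \<in> M' k)"
  proof (rule Suc.IH)
    show "openin (D_topology (Sk (n + k))) (M' k)" for k
      using D_open_vimage[OF smooth_j skeleton skeleton, of n "M 0"] Suc.prems(1)[of 0] Suc.prems(1)[of "k - 1"]
      by (cases k) (simp_all add: M'_def)
    show "j (n + k) b \<in> M' (Suc k) \<longleftrightarrow> b \<in> M' k" if "b \<in> points (Sk (n + k))" for k b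
      using Suc.prems(2)[of b "k - 1"] that by (cases k) (simp_all add: M'_def)
  qed
  then obtain N where N: "openin (D_topology X) N"
    "\<And>k b. b \<in> points (Sk (n + k)) \<Longrightarrow> \<iota> (n + k) b \<in> N \<longleftrightarrow> b \<in> M' k" by blast
  show ?case
    using N(1) N(2)[of _ "Suc _"] by (intro exI[of _ N]) (simp add: M'_def)
qed

text \<open>
  Numerations of the skeleta are chosen inductively, each a collared extension of the previous one. For
  local finiteness at a point of the \<open>n\<close>-skeleton, a neighbourhood there is thickened at each further
  stage, and the members that were negative at the start are negative on all thickenings.
\<close>

lemma numeration_exists:
  assumes V: "\<And>a. a \<in> I \<Longrightarrow> openin (D_topology X) (V a)"
    and cover: "\<And>x. x \<in> points X \<Longrightarrow> \<exists>a\<in>I. x \<in> V a"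
  shows "\<exists>u. numeration X I V u"
proof -
  define VS where "VS n a = {b \<in> points (Sk n). \<iota> n b \<in> V a}" for n a
  have VS_open: "openin (D_topology (Sk n)) (VS n a)" if "a \<in> I" for n a
    unfolding VS_def by (rule D_open_vimage[OF smooth_\<iota> skeleton diffeological_X V[OF that]])
  have VS_cover: "\<exists>a\<in>I. b \<in> VS n a" if "b \<in> points (Sk n)" for n b
    using cover[OF \<iota>_in_points[OF that]] that by (simp add: VS_def)
  have VS_j: "VS n a = {b \<in> points (Sk n). j n b \<in> VS (Suc n) a}" for n a
    using \<iota>_j j_in_skeleton by (auto simp: VS_def)
  have start: "\<exists>u. numeration (Sk 0) I (VS 0) u"
    using numeration_discrete_space[of "points (Sk 0)" I "VS 0"] VS_cover skeleton_0 by simp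
  have step: "\<exists>u'. numeration (Sk (Suc n)) I (VS (Suc n)) u' \<and> collared_extension (Sk n) (Sk (Suc n)) (j n) I u u'"
    if u: "numeration (Sk n) I (VS n) u" for n u
  proof -
    have "numeration (Sk n) I (\<lambda>a. {b \<in> points (Sk n). j n b \<in> VS (Suc n) a}) u"
      using u unfolding VS_j[of n, symmetric] .
    from numeration_extends_over_cells[OF pushout skeleton attaching VS_open VS_cover this]
    show ?thesis by blast
  qed
  obtain u where u: "\<And>n. numeration (Sk n) I (VS n) (u n)"
    and ext: "\<And>n. collared_extension (Sk n) (Sk (Suc n)) (j n) I (u n) (u (Suc n))"
    using dependent_nat_choice[of "\<lambda>n. numeration (Sk n) I (VS n)"
        "\<lambda>n u u'. collared_extension (Sk n) (Sk (Suc n)) (j n) I u u'", OF start step] by blast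
  have u_j: "u (Suc n) a (j n b) = u n a b" if "a \<in> I" "b \<in> points (Sk n)" for n a b
    using ext[of n] that by (simp add: collared_extension_def)
  have "\<forall>a\<in>I. \<exists>w. smooth_map X (real_subspace UNIV) w \<and> (\<forall>n. \<forall>b\<in>points (Sk n). w (\<iota> n b) = u n a b)"
  proof
    fix a assume a: "a \<in> I"
    show "\<exists>w. smooth_map X (real_subspace UNIV) w \<and> (\<forall>n. \<forall>b\<in>points (Sk n). w (\<iota> n b) = u n a b)"
      by (rule colimit_for_exists[OF universal[OF diffeological_real_subspace]])
        (use u a u_j in \<open>auto simp: numeration_def\<close>)
  qed
  from bchoice[OF this] obtain w where w: "\<And>a. a \<in> I \<Longrightarrow> smooth_map X (real_subspace UNIV) (w a)"
    "\<And>a n b. a \<in> I \<Longrightarrow> b \<in> points (Sk n) \<Longrightarrow> w a (\<iota> n b) = u n a b" by blast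
  have in_sk: "\<exists>n. \<exists>b\<in>points (Sk n). x = \<iota> n b" if "x \<in> points X" for x
    using in_high_skeleton[OF that, of 0] by auto
  have "numeration X I V w"
    unfolding numeration_def
  proof (intro conjI ballI impI)
    show "smooth_map X (real_subspace UNIV) (w a)" if "a \<in> I" for a using w(1) that .
    show "x \<in> V a" if a: "a \<in> I" and x: "x \<in> points X" "0 \<le> w a x" for a x
    proof -
      obtain n b where b: "b \<in> points (Sk n)" "x = \<iota> n b" using in_sk[OF x(1)] by blast
      then have "b \<in> VS n a" using u[of n] a x(2) w(2)[OF a b(1)] by (simp add: numeration_def)
      then show ?thesis using b(2) by (simp add: VS_def)
    qed
    show "\<exists>a\<in>I. 0 < w a x" if x: "x \<in> points X" for x
    proof -
      obtain n b where b: "b \<in> points (Sk n)" "x = \<iota> n b" using in_sk[OF x] by blast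
      then obtain a where "a \<in> I" "0 < u n a b" using u[of n] by (auto simp: numeration_def)
      then show ?thesis using w(2) b by (intro bexI[of _ a]) simp_all
    qed
    show "\<exists>N. openin (D_topology X) N \<and> x \<in> N \<and> finite {a \<in> I. \<exists>z\<in>N. 0 \<le> w a z}"
      if x: "x \<in> points X" for x
    proof -
      obtain n b where b: "b \<in> points (Sk n)" "x = \<iota> n b" using in_sk[OF x] by blast
      then obtain N0 where N0: "openin (D_topology (Sk n)) N0" "b \<in> N0" "finite {a \<in> I. \<exists>z\<in>N0. 0 \<le> u n a z}"
        using u[of n] by (auto simp: numeration_def)
      define P where "P k M \<longleftrightarrow> openin (D_topology (Sk (n + k))) M \<and>
          (\<forall>a\<in>I. (\<forall>y\<in>N0. u n a y < 0) \<longrightarrow> (\<forall>y\<in>M. u (n + k) a y < 0)) \<and> (k = 0 \<longrightarrow> M = N0)" for k M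
      \<comment> \<open>The last conjunct fixes the start of the sequence, so that it is a sequence of thickenings of \<open>N0\<close>.\<close>
      define Q where "Q k M M' \<longleftrightarrow> (\<forall>b\<in>points (Sk (n + k)). j (n + k) b \<in> M' \<longleftrightarrow> b \<in> M)" for k M M'
      have "\<exists>M. P 0 M" using N0(1) by (auto simp: P_def)
      moreover have "\<exists>M'. P (Suc k) M' \<and> Q k M M'" if M: "P k M" for k M
      proof -
        have "openin (D_topology (Sk (n + k))) M" using M by (simp add: P_def)
        then obtain M' where M': "openin (D_topology (Sk (Suc (n + k)))) M'"
          "\<forall>b\<in>points (Sk (n + k)). j (n + k) b \<in> M' \<longleftrightarrow> b \<in> M"
          "\<forall>a\<in>I. (\<forall>y\<in>M. u (n + k) a y < 0) \<longrightarrow> (\<forall>y\<in>M'. u (Suc (n + k)) a y < 0)"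
          using ext[of "n + k"] unfolding collared_extension_def by blast
        then have "P (Suc k) M' \<and> Q k M M'" using M by (simp add: P_def Q_def)
        then show ?thesis by blast
      qed
      ultimately obtain M where M: "\<And>k. P k (M k)" "\<And>k. Q k (M k) (M (Suc k))"
        using dependent_nat_choice[of P Q] by blast
      have M_open: "openin (D_topology (Sk (n + k))) (M k)" for k using M(1)[of k] by (simp add: P_def)
      have M_j: "j (n + k) b \<in> M (Suc k) \<longleftrightarrow> b \<in> M k" if "b \<in> points (Sk (n + k))" for k b
        using M(2)[of k] that by (simp add: Q_def)
      obtain N where N: "openin (D_topology X) N"
        "\<And>k b. b \<in> points (Sk (n + k)) \<Longrightarrow> \<iota> (n + k) b \<in> N \<longleftrightarrow> b \<in> M k"
        using D_open_from_skeleta[of n M, OF M_open M_j] by blast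
      have "{a \<in> I. \<exists>z\<in>N. 0 \<le> w a z} \<subseteq> {a \<in> I. \<exists>z\<in>N0. 0 \<le> u n a z}"
      proof (intro subsetI, rule ccontr)
        fix a assume "a \<in> {a \<in> I. \<exists>z\<in>N. 0 \<le> w a z}" and na: "a \<notin> {a \<in> I. \<exists>z\<in>N0. 0 \<le> u n a z}"
        then obtain z where a: "a \<in> I" and z: "z \<in> N" "0 \<le> w a z" by blast
        have neg: "\<forall>y\<in>N0. u n a y < 0" using na a by (auto simp: not_le)
        have "z \<in> points X" using openin_subset[OF N(1)] z(1) by (auto simp: topspace_D_topology[OF diffeological_X])
        then obtain k c where c: "c \<in> points (Sk (n + k))" "z = \<iota> (n + k) c"
          using in_high_skeleton[of z n] by blast
        then have "c \<in> M k" using N(2) z(1) by blast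
        then have "u (n + k) a c < 0" using M(1)[of k] a neg by (simp add: P_def)
        then show False using w(2)[OF a c(1)] c(2) z(2) by simp
      qed
      moreover have "x \<in> N" using N(2)[of b 0] b N0(2) M(1)[of 0] by (simp add: P_def)
      ultimately show ?thesis using N(1) N0(3) finite_subset by blast
    qed
  qed
  then show ?thesis by blast
qed

end

theorem theorem4p2:
  fixes X :: "'a diffeo_space" and Sk :: "nat \<Rightarrow> 'b diffeo_space" and cells :: "nat \<Rightarrow> 'c set"
    and \<V> :: "'a set set"
  assumes "smooth_CW_complex X Sk cells h j \<Phi> \<iota>"
    and "\<And>V. V \<in> \<V> \<Longrightarrow> openin (D_topology X) V"
    and "\<Union>\<V> = points X"
  shows "\<exists>(\<Lambda> :: 'a set set) \<rho>. smooth_partition_of_unity X \<V> \<Lambda> \<rho>"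
proof -
  interpret smooth_CW_complex X Sk cells h j \<Phi> \<iota> by fact
  have "\<exists>u. numeration X \<V> (\<lambda>V. V) u"
    by (rule numeration_exists) (use assms(2,3) in auto)
  then show ?thesis using numeration_imp_partition_of_unity[OF diffeological_X] by blast
qed

end
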